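(* Let $(p_n)_{n\ge 2}$ be positive integers and let $(\sigma_n)_{n\ge2}$, $(\Delta_n)_{n\ge 2}$ be positive reals (write $p=p_n$, $\sigma=\sigma_n$). (i) If $\sigma^2\left(1+\sqrt{p/n}\right)=o(\Delta_n^2)$ as $n\to\infty$, then the estimator $\eta^k$ (spectral initialization followed by $k$ iterations, as defined in the context) with $k=\lfloor3\log n\rfloor$ achieves almost full recovery for $(\Omega_{\Delta_n})_{n\ge2}$. (ii) If $\Delta_n^2=\mathcal O\left(\sigma^2(1+\sqrt{p/n})\right)$, then almost full recovery is impossible for $(\Omega_{\Delta_n})_{n\ge2}$.
   Context: Model: for $n\ge 2$, $p\ge1$, $\sigma>0$, one observes $Y_i=\boldsymbol\theta\eta_i+\sigma\xi_i\in\mathbf R^p$, $i=1,\dots,n$, where $\boldsymbol\theta\in\mathbf R^p$ and $\eta\in\{-1,1\}^n$ are unknown and $\xi_1,\dots,\xi_n$ are i.i.d. standard Gaussian vectors in $\mathbf R^p$. $Y$ is the $p\times n$ matrix with columns $Y_1,\dots,Y_n$; $\mathbf E_{(\boldsymbol\theta,\eta)}$ is expectation under the law of $Y$. $\|\cdot\|$ is the Euclidean norm. For $\Delta>0$, $\Omega_\Delta=\{\boldsymbol\theta\in\mathbf R^p:\|\boldsymbol\theta\|\ge\Delta\}\times\{-1,1\}^n$. An estimator is a measurable function of $Y$ with values in $\{-1,1\}^n$. Loss: $r(\hat\eta,\eta)=\min_{\nu\in\{-1,1\}}\sum_{j=1}^n|\hat\eta_j-\nu\eta_j|$. Almost full recovery: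 an estimator $\hat\eta$ (one for each $n$) achieves almost full recovery for $(\Omega_{\Delta_n})_{n\ge2}$ if $\lim_{n\to\infty}\sup_{(\boldsymbol\theta,\eta)\in\Omega_{\Delta_n}}\frac1n\mathbf E_{(\boldsymbol\theta,\eta)}r(\hat\eta,\eta)=0$. Almost full recovery is impossible if $\liminf_{n\to\infty}\inf_{\tilde\eta}\sup_{(\boldsymbol\theta,\eta)\in\Omega_{\Delta_n}}\frac1n\mathbf E_{(\boldsymbol\theta,\eta)}r(\tilde\eta,\eta)>0$, the infimum being over all estimators. Estimator $\eta^k$: for a square matrix $M$, $\mathbf H(M)=M-\mathrm{diag}(M)$, where $\mathrm{diag}(M)$ is the diagonal matrix with the same diagonal as $M$. Let $\hat v$ be an eigenvector of $\mathbf H(Y^\top Y)$ for its top (largest) eigenvalue, $\eta^0=\mathrm{sign}(\hat v)$, and $\eta^{j+1}=\mathrm{sign}(\mathbf H(Y^\top Y)\eta^j)$ for $j\ge0$; $\mathrm{sign}$ is applied entrywise, with any fixed convention $\mathrm{sign}(0)\in\{-1,1\}$. *)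

theory Defs
  imports
    "HOL-Probability.Probability"
    "HOL-Library.Landau_Symbols"
    "Jordan_Normal_Form.Char_Poly"
begin

unbundle no vec_syntax
hide_const (open) Finite_Cartesian_Product.vec Finite_Cartesian_Product.mat Determinants.det
  Finite_Cartesian_Product.row Finite_Cartesian_Product.column

definition vec_norm2 :: "real Matrix.vec \<Rightarrow> real" where
  "vec_norm2 x = L2_set (\<lambda>i. x $ i) {..<dim_vec x}"

definition labels :: "nat \<Rightarrow> real Matrix.vec set" where
  "labels n = {\<eta> \<in> carrier_vec n. \<forall>j<n. \<eta> $ j \<in> {-1, 1}}"

definition params :: "nat \<Rightarrow> nat \<Rightarrow> real \<Rightarrow> (real Matrix.vec \<times> real Matrix.vec) set" where
  "params p n \<Delta> = {\<theta> \<in> carrier_vec p. \<Delta> \<le> vec_norm2 \<theta>} \<times> labels n"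

text \<open>The type of matrices carries no topology, so the Borel sigma-algebra on real
  \<open>p \<times> n\<close> matrices is pulled back along the entries.\<close>

definition mat_borel :: "nat \<Rightarrow> nat \<Rightarrow> real Matrix.mat measure" where
  "mat_borel p n = vimage_algebra (carrier_mat p n)
     (\<lambda>M. \<lambda>ij\<in>{..<p} \<times> {..<n}. M $$ ij) (\<Pi>\<^sub>M ij\<in>{..<p} \<times> {..<n}. (borel :: real measure))"

definition noise :: "nat \<Rightarrow> nat \<Rightarrow> (nat \<times> nat \<Rightarrow> real) measure" where
  "noise p n = (\<Pi>\<^sub>M ij\<in>{..<p} \<times> {..<n}. density lborel (\<lambda>x. ennreal (std_normal_density x)))"

text \<open>Column \<open>j\<close> of the observation is \<open>\<eta>\<^sub>j \<theta> + \<sigma> \<xi>\<^sub>j\<close>.\<close>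

definition observation ::
  "nat \<Rightarrow> nat \<Rightarrow> real \<Rightarrow> real Matrix.vec \<Rightarrow> real Matrix.vec \<Rightarrow> (nat \<times> nat \<Rightarrow> real) \<Rightarrow> real Matrix.mat" where
  "observation p n \<sigma> \<theta> \<eta> \<xi> = Matrix.mat p n (\<lambda>(i, j). \<theta> $ i * \<eta> $ j + \<sigma> * \<xi> (i, j))"

definition data_law ::
  "nat \<Rightarrow> nat \<Rightarrow> real \<Rightarrow> real Matrix.vec \<Rightarrow> real Matrix.vec \<Rightarrow> real Matrix.mat measure" where
  "data_law p n \<sigma> \<theta> \<eta> = distr (noise p n) (mat_borel p n) (observation p n \<sigma> \<theta> \<eta>)"

lemma observation_measurable: "observation p n \<sigma> \<theta> \<eta> \<in> noise p n \<rightarrow>\<^sub>M mat_borel p n"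
proof -
  have "(\<lambda>\<xi>. \<lambda>ij\<in>{..<p} \<times> {..<n}. observation p n \<sigma> \<theta> \<eta> \<xi> $$ ij) \<in>
      noise p n \<rightarrow>\<^sub>M (\<Pi>\<^sub>M ij\<in>{..<p} \<times> {..<n}. (borel :: real measure))"
  proof (rule measurable_restrict)
    fix ij assume ij: "ij \<in> {..<p} \<times> {..<n}"
    have "(\<lambda>\<xi>. \<xi> ij) \<in> borel_measurable (noise p n)"
      unfolding noise_def
      using measurable_component_singleton[OF ij, of "\<lambda>_. density lborel (\<lambda>x. ennreal (std_normal_density x))"]
      by simp
    then have "(\<lambda>\<xi>. \<theta> $ fst ij * \<eta> $ snd ij + \<sigma> * \<xi> ij) \<in> borel_measurable (noise p n)"
      by measurable
    moreover have "observation p n \<sigma> \<theta> \<eta> \<xi> $$ ij = \<theta> $ fst ij * \<eta> $ snd ij + \<sigma> * \<xi> ij" for \<xi>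
      using ij by (auto simp: observation_def)
    ultimately show "(\<lambda>\<xi>. observation p n \<sigma> \<theta> \<eta> \<xi> $$ ij) \<in> borel_measurable (noise p n)"
      by simp
  qed
  then show ?thesis
    unfolding mat_borel_def
    by (intro measurable_vimage_algebra2) (auto simp: observation_def)
qed

lemma prob_space_data_law: "prob_space (data_law p n \<sigma> \<theta> \<eta>)"
proof -
  have "prob_space (noise p n)"
    unfolding noise_def
    by (intro prob_space_PiM prob_space_normal_density) simp
  then show ?thesis
    unfolding data_law_def by (rule prob_space.prob_space_distr) (rule observation_measurable)
qed

definition estimators :: "nat \<Rightarrow> nat \<Rightarrow> (real Matrix.mat \<Rightarrow> real Matrix.vec) set" where
  "estimators p n = mat_borel p n \<rightarrow>\<^sub>M count_space (labels n)"

definition loss :: "nat \<Rightarrow> real Matrix.vec \<Rightarrow> real Matrix.vec \<Rightarrow> real" where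
  "loss n a b = (MIN \<nu>\<in>{-1, 1}. \<Sum>j<n. \<bar>a $ j - \<nu> * b $ j\<bar>)"

definition risk ::
  "nat \<Rightarrow> nat \<Rightarrow> real \<Rightarrow> (real Matrix.mat \<Rightarrow> real Matrix.vec) \<Rightarrow> real Matrix.vec \<Rightarrow> real Matrix.vec \<Rightarrow> real" where
  "risk p n \<sigma> est \<theta> \<eta> = (1 / real n) * (LINT Y|data_law p n \<sigma> \<theta> \<eta>. loss n (est Y) \<eta>)"

text \<open>Suprema and infima are taken in \<open>ereal\<close>, a complete lattice, so that they need no
  boundedness side conditions.\<close>

definition max_risk ::
  "nat \<Rightarrow> nat \<Rightarrow> real \<Rightarrow> real \<Rightarrow> (real Matrix.mat \<Rightarrow> real Matrix.vec) \<Rightarrow> ereal" where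
  "max_risk p n \<sigma> \<Delta> est = (SUP (\<theta>, \<eta>)\<in>params p n \<Delta>. ereal (risk p n \<sigma> est \<theta> \<eta>))"

definition achieves_almost_full_recovery ::
  "(nat \<Rightarrow> nat) \<Rightarrow> (nat \<Rightarrow> real) \<Rightarrow> (nat \<Rightarrow> real) \<Rightarrow> (nat \<Rightarrow> real Matrix.mat \<Rightarrow> real Matrix.vec) \<Rightarrow> bool" where
  "achieves_almost_full_recovery p \<sigma> \<Delta> est \<longleftrightarrow>
     (\<forall>n\<ge>2. est n \<in> estimators (p n) n) \<and>
     (\<lambda>n. max_risk (p n) n (\<sigma> n) (\<Delta> n) (est n)) \<longlonglongrightarrow> 0"

definition almost_full_recovery_impossible ::
  "(nat \<Rightarrow> nat) \<Rightarrow> (nat \<Rightarrow> real) \<Rightarrow> (nat \<Rightarrow> real) \<Rightarrow> bool" where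
  "almost_full_recovery_impossible p \<sigma> \<Delta> \<longleftrightarrow>
     liminf (\<lambda>n. INF est\<in>estimators (p n) n. max_risk (p n) n (\<sigma> n) (\<Delta> n) est) > 0"

definition hollow :: "real Matrix.mat \<Rightarrow> real Matrix.mat" where
  "hollow M = M - mat_diag (dim_row M) (\<lambda>i. M $$ (i, i))"

definition hollow_gram :: "real Matrix.mat \<Rightarrow> real Matrix.mat" where
  "hollow_gram Y = hollow (transpose_mat Y * Y)"

definition top_eigenvector :: "real Matrix.mat \<Rightarrow> real Matrix.vec \<Rightarrow> bool" where
  "top_eigenvector A v \<longleftrightarrow> (\<exists>k. eigenvector A v k \<and> (\<forall>l. eigenvalue A l \<longrightarrow> l \<le> k))"

text \<open>\<open>s\<close> is the value chosen for the sign of \<open>0\<close>.\<close>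

definition sign_vec :: "real \<Rightarrow> real Matrix.vec \<Rightarrow> real Matrix.vec" where
  "sign_vec s = map_vec (\<lambda>x. if x = 0 then s else sgn x)"

primrec spectral_iterate ::
  "real \<Rightarrow> (real Matrix.mat \<Rightarrow> real Matrix.vec) \<Rightarrow> nat \<Rightarrow> real Matrix.mat \<Rightarrow> real Matrix.vec" where
  "spectral_iterate s v 0 Y = sign_vec s (v Y)"
| "spectral_iterate s v (Suc j) Y = sign_vec s (hollow_gram Y *\<^sub>v spectral_iterate s v j Y)"

end

theory Submission
  imports Defs "HOL-Real_Asymp.Real_Asymp"
begin

text \<open>
  Upper bound. Write \<open>T = \<parallel>\<theta>\<parallel>\<^sup>2\<close>. The hollow Gram matrix of the data is \<open>T \<eta> \<eta>\<^sup>T + E\<close>, where \<open>E\<close> consists of a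
  signal-noise term, the noise Gram matrix without its diagonal, and \<open>- T I\<close> for the deleted diagonal. If the
  form of \<open>E\<close> is at most \<open>\<epsilon> T n\<close> on unit vectors, everything is deterministic. The top eigenvector has
  nearly maximal correlation with \<open>\<eta>\<close>, so its signs are wrong in \<open>O(\<epsilon> n)\<close> places
  (\<open>top_eigenvector_signs_close\<close>), and one iteration applied to a vector with so few errors returns a vector with
  equally few (\<open>sign_step_stays_close\<close>). The form of \<open>E\<close> is small because, uniformly over unit vectors, the
  centred noise Gram matrix has a form of order \<open>n + sqrt (n p)\<close>, which the hypothesis makes
  \<open>o(n T / \<sigma>\<^sup>2)\<close>. This follows from a Chernoff bound for \<open>\<chi>\<^sup>2\<close> variables (\<open>gram_dev_tail\<close>), a union bound over a
  lattice net (\<open>card_lattice_ball\<close>) and the net argument for quadratic forms (\<open>net_controls_form\<close>). Working with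
  the operator norm rather than entries is what avoids logarithmic losses. The signal-noise term needs only a
  second moment.

  Lower bound. The maximal risk is at least the average risk when the coordinates of the signal are
  \<open>\<plusminus>\<Delta> / sqrt p\<close> with independent uniform signs and the labels are uniform. The loss, times \<open>n\<close>, dominates the number of
  pairs \<open>i \<noteq> j\<close> whose product \<open>\<eta>\<^sub>i \<eta>\<^sub>j\<close> is estimated wrongly (\<open>loss_ge_pair_errors\<close>), and for each pair the estimator
  has to tell a label vector from the one with coordinate \<open>j\<close> flipped. After averaging over the signs, the
  likelihood is a product over the \<open>p\<close> independent rows of hyperbolic cosines (\<open>mixture_eq_prod_cosh\<close>), so the
  overlap of two neighbouring likelihoods is at least a \<open>p\<close>-th power of the overlap of one row
  (\<open>mixture_affinity\<close>). With \<open>b = \<Delta>\<^sup>2 / (p \<sigma>\<^sup>2)\<close> a row loses at most \<open>min b ((n - 1) b\<^sup>2)\<close>, and for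
  \<open>\<Delta>\<^sup>2 = O(\<sigma>\<^sup>2 (1 + sqrt (p / n)))\<close> this is \<open>O(1 / p)\<close>: the first bound serves for \<open>p \<le> n\<close>, the
  second for \<open>p > n\<close> (\<open>row_overlap_power_ge\<close>). Hence the overlap, and with it the risk of every estimator, stays
  away from \<open>0\<close>.
\<close>

section \<open>Quadratic forms in finitely many coordinates\<close>

text \<open>Vectors and matrices are functions on all of \<open>nat\<close>, of which only the values below \<open>n\<close> count.
  The dimension is then an ordinary variable, and an array of random variables is already a matrix.\<close>

definition ip :: "nat \<Rightarrow> (nat \<Rightarrow> real) \<Rightarrow> (nat \<Rightarrow> real) \<Rightarrow> real" where
  "ip n x y = (\<Sum>i<n. x i * y i)"

definition mv :: "nat \<Rightarrow> (nat \<Rightarrow> nat \<Rightarrow> real) \<Rightarrow> (nat \<Rightarrow> real) \<Rightarrow> nat \<Rightarrow> real" where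
  "mv n A x i = (\<Sum>j<n. A i j * x j)"

abbreviation qf :: "nat \<Rightarrow> (nat \<Rightarrow> nat \<Rightarrow> real) \<Rightarrow> (nat \<Rightarrow> real) \<Rightarrow> real" where
  "qf n A x \<equiv> ip n x (mv n A x)"

abbreviation nsq :: "nat \<Rightarrow> (nat \<Rightarrow> real) \<Rightarrow> real" where
  "nsq n x \<equiv> ip n x x"

definition sym_on :: "nat \<Rightarrow> (nat \<Rightarrow> nat \<Rightarrow> real) \<Rightarrow> bool" where
  "sym_on n A \<longleftrightarrow> (\<forall>i<n. \<forall>j<n. A i j = A j i)"

lemma ip_commute: "ip n x y = ip n y x"
  by (simp add: ip_def mult.commute)

lemma ip_add_left: "ip n (\<lambda>i. x i + y i) z = ip n x z + ip n y z"
  and ip_diff_left: "ip n (\<lambda>i. x i - y i) z = ip n x z - ip n y z"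
  and ip_scale_left: "ip n (\<lambda>i. c * x i) z = c * ip n x z"
  by (simp_all add: ip_def sum.distrib sum_subtractf sum_distrib_left algebra_simps)

lemma ip_add_right: "ip n z (\<lambda>i. x i + y i) = ip n z x + ip n z y"
  and ip_diff_right: "ip n z (\<lambda>i. x i - y i) = ip n z x - ip n z y"
  and ip_scale_right: "ip n z (\<lambda>i. c * x i) = c * ip n z x"
  by (simp_all add: ip_def sum.distrib sum_subtractf sum_distrib_left algebra_simps)

lemma mv_add: "mv n A (\<lambda>i. x i + y i) = (\<lambda>i. mv n A x i + mv n A y i)"
  and mv_diff: "mv n A (\<lambda>i. x i - y i) = (\<lambda>i. mv n A x i - mv n A y i)"
  and mv_scale: "mv n A (\<lambda>i. c * x i) = (\<lambda>i. c * mv n A x i)"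
  by (simp_all add: mv_def sum.distrib sum_subtractf sum_distrib_left algebra_simps fun_eq_iff)

lemmas form_linear = ip_add_left ip_diff_left ip_scale_left ip_add_right ip_diff_right
  ip_scale_right mv_add mv_diff mv_scale

lemma ip_cong: "(\<And>i. i < n \<Longrightarrow> x i = x' i) \<Longrightarrow> (\<And>i. i < n \<Longrightarrow> y i = y' i) \<Longrightarrow> ip n x y = ip n x' y'"
  by (simp add: ip_def)

lemma nsq_nonneg [simp]: "nsq n x \<ge> 0"
  by (simp add: ip_def sum_nonneg)

lemma nsq_eq_0D: "nsq n x = 0 \<Longrightarrow> i < n \<Longrightarrow> x i = 0"
  by (simp add: ip_def sum_nonneg_eq_0_iff)

lemma ip_Cauchy_Schwarz: "(ip n x y)\<^sup>2 \<le> nsq n x * nsq n y"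
  using Cauchy_Schwarz_ineq_sum[of x y "{..<n}"] by (simp add: ip_def power2_eq_square)

lemma abs_ip_le: "\<bar>ip n x y\<bar> \<le> sqrt (nsq n x) * sqrt (nsq n y)"
  using real_sqrt_le_mono[OF ip_Cauchy_Schwarz[of n x y]] by (simp add: real_sqrt_mult)

lemma form_sym:
  assumes "sym_on n A" shows "ip n x (mv n A y) = ip n y (mv n A x)"
proof -
  have "ip n x (mv n A y) = (\<Sum>i<n. \<Sum>j<n. A i j * x i * y j)"
    by (simp add: ip_def mv_def sum_distrib_left algebra_simps)
  also have "\<dots> = (\<Sum>j<n. \<Sum>i<n. A i j * x i * y j)"
    by (rule sum.swap)
  also have "\<dots> = (\<Sum>j<n. \<Sum>i<n. A j i * x i * y j)"
    using assms by (intro sum.cong refl) (auto simp: sym_on_def)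
  also have "\<dots> = ip n y (mv n A x)"
    by (simp add: ip_def mv_def sum_distrib_left algebra_simps)
  finally show ?thesis .
qed

lemma nsq_mv_le: "nsq n (mv n A x) \<le> (\<Sum>i<n. nsq n (A i)) * nsq n x"
proof -
  have "nsq n (mv n A x) = (\<Sum>i<n. (ip n (A i) x)\<^sup>2)"
    by (simp add: ip_def mv_def power2_eq_square)
  also have "\<dots> \<le> (\<Sum>i<n. nsq n (A i) * nsq n x)"
    by (intro sum_mono ip_Cauchy_Schwarz)
  finally show ?thesis by (simp add: sum_distrib_right)
qed

lemma form_bounded: obtains K where "K > 0" "\<And>x. \<bar>qf n A x\<bar> \<le> K * nsq n x"
proof -
  define K where "K = sqrt (\<Sum>i<n. nsq n (A i)) + 1"
  have S: "(\<Sum>i<n. nsq n (A i)) \<ge> 0" by (intro sum_nonneg) simp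
  have "\<bar>qf n A x\<bar> \<le> K * nsq n x" for x
  proof -
    have "\<bar>qf n A x\<bar> \<le> sqrt (nsq n x) * sqrt (nsq n (mv n A x))"
      by (rule abs_ip_le)
    also have "\<dots> \<le> sqrt (nsq n x) * sqrt ((\<Sum>i<n. nsq n (A i)) * nsq n x)"
      by (intro mult_left_mono real_sqrt_le_mono nsq_mv_le) simp
    also have "\<dots> = sqrt (\<Sum>i<n. nsq n (A i)) * nsq n x"
      by (simp add: real_sqrt_mult)
    also have "\<dots> \<le> K * nsq n x"
      by (simp add: K_def algebra_simps)
    finally show ?thesis .
  qed
  moreover have "K > 0" using S by (simp add: K_def add_nonneg_pos)
  ultimately show thesis using that by blast
qed

lemma form_polarize:
  assumes "sym_on n A"
  shows "4 * ip n x (mv n A y) = qf n A (\<lambda>i. x i + y i) - qf n A (\<lambda>i. x i - y i)"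
  using form_sym[OF assms, of y x] by (simp add: form_linear)

text \<open>For a symmetric matrix, a bound on the quadratic form bounds the operator norm: polarize at the
  pair \<open>A y / k\<close> and \<open>y\<close>.\<close>

lemma form_bound_imp_norm_bound:
  assumes A: "sym_on n A" and k: "k > 0" and q: "\<And>x. \<bar>qf n A x\<bar> \<le> k * nsq n x"
  shows "nsq n (mv n A y) \<le> k\<^sup>2 * nsq n y"
proof -
  define x where "x = (\<lambda>i. (1/k) * mv n A y i)"
  define N where "N = nsq n (mv n A y)"
  have "4 * ip n x (mv n A y) \<le> k * nsq n (\<lambda>i. x i + y i) + k * nsq n (\<lambda>i. x i - y i)"
    using form_polarize[OF A, of x y] q[of "\<lambda>i. x i + y i"] q[of "\<lambda>i. x i - y i"] by linarith
  also have "\<dots> = 2 * k * (nsq n x + nsq n y)"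
    by (simp add: form_linear ip_commute[of n y x] algebra_simps)
  also have "nsq n x = N / k\<^sup>2"
    unfolding x_def N_def ip_scale_left ip_scale_right by (simp add: power2_eq_square)
  also have "ip n x (mv n A y) = N / k"
    unfolding x_def N_def ip_scale_left by simp
  finally have "4 * (N / k) \<le> 2 * k * (N / k\<^sup>2 + nsq n y)" .
  then show ?thesis unfolding N_def[symmetric] using k
    by (simp add: field_simps power2_eq_square)
qed

lemma form_bound_imp_bilinear_bound:
  assumes A: "sym_on n A" and k: "k > 0" and q: "\<And>x. \<bar>qf n A x\<bar> \<le> k * nsq n x"
  shows "\<bar>ip n x (mv n A y)\<bar> \<le> k * sqrt (nsq n x) * sqrt (nsq n y)"
proof -
  have "\<bar>ip n x (mv n A y)\<bar> \<le> sqrt (nsq n x) * sqrt (nsq n (mv n A y))"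
    by (rule abs_ip_le)
  also have "\<dots> \<le> sqrt (nsq n x) * sqrt (k\<^sup>2 * nsq n y)"
    by (intro mult_left_mono real_sqrt_le_mono form_bound_imp_norm_bound assms) simp
  finally show ?thesis using k by (simp add: real_sqrt_mult algebra_simps)
qed

text \<open>Quadratic forms are homogeneous, so bounds on the unit sphere extend to all vectors.\<close>

lemma unit_vector_multiple:
  assumes "nsq n x \<noteq> 0"
  obtains u where "nsq n u = 1" "\<And>A. qf n A x = nsq n x * qf n A u"
proof -
  have p: "nsq n x > 0" using assms nsq_nonneg[of n x] by linarith
  define c where "c = 1 / sqrt (nsq n x)"
  have c: "c * (c * nsq n x) = 1" using p by (simp add: c_def field_simps)
  have "nsq n (\<lambda>i. c * x i) = 1"
    using c by (simp add: form_linear)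
  moreover have "qf n A x = nsq n x * qf n A (\<lambda>i. c * x i)" for A
  proof -
    have "nsq n x * qf n A (\<lambda>i. c * x i) = (c * (c * nsq n x)) * qf n A x"
      by (simp add: form_linear)
    then show ?thesis by (simp add: c)
  qed
  ultimately show thesis by (rule that)
qed

lemma form_zero: assumes "nsq n x = 0" shows "qf n A x = 0"
  using abs_ip_le[of n x "mv n A x"] assms by simp

lemma form_le_from_unit_sphere:
  assumes "\<And>u. nsq n u = 1 \<Longrightarrow> qf n A u \<le> k"
  shows "qf n A x \<le> k * nsq n x"
proof (cases "nsq n x = 0")
  case True then show ?thesis by (simp add: form_zero)
next
  case False
  then obtain u where "nsq n u = 1" "qf n A x = nsq n x * qf n A u"
    by (metis unit_vector_multiple)
  with assms[of u] show ?thesis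
    by (simp add: mult_left_mono mult.commute[of k])
qed

lemma form_abs_le_from_unit_sphere:
  assumes "\<And>u. nsq n u = 1 \<Longrightarrow> \<bar>qf n A u\<bar> \<le> k"
  shows "\<bar>qf n A x\<bar> \<le> k * nsq n x"
proof (cases "nsq n x = 0")
  case True then show ?thesis by (simp add: form_zero)
next
  case False
  then obtain u where "nsq n u = 1" "qf n A x = nsq n x * qf n A u"
    by (metis unit_vector_multiple)
  with assms[of u] show ?thesis
    by (simp add: abs_mult mult_left_mono mult.commute[of k])
qed

lemma unit_vector_exists: assumes "n > 0" shows "\<exists>x. nsq n x = 1"
  by (rule exI[of _ "\<lambda>i. if i = 0 then 1 else 0"]) (use assms in \<open>simp add: ip_def if_distrib cong: if_cong\<close>)

section \<open>Rayleigh quotients and the top eigenvalue\<close>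

lemma mv_mult_mat_vec:
  assumes "A \<in> carrier_mat n n" "x \<in> carrier_vec n" "i < n"
  shows "(A *\<^sub>v x) $ i = mv n (\<lambda>i j. A $$ (i, j)) (\<lambda>j. x $ j) i"
  using assms by (simp add: mv_def scalar_prod_def atLeast0LessThan)

text \<open>Let \<open>l\<close> be the supremum of the form on the unit sphere. It is an eigenvalue, for an algebraic
  reason that avoids compactness. Otherwise \<open>P = l I - A\<close> is invertible, so \<open>nsq x\<close> is at most a
  multiple of \<open>nsq (P x)\<close>. As \<open>P\<close> is positive semidefinite, \<open>nsq (P x)\<close> is in turn at most a
  multiple of the form of \<open>P\<close> at \<open>x\<close>. So the form of \<open>A\<close> stays below \<open>l\<close> by a fixed amount on the
  whole sphere, which contradicts the choice of \<open>l\<close>.\<close>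

lemma Rayleigh_le_eigenvalue:
  fixes M :: "real Matrix.mat"
  assumes M: "M \<in> carrier_mat n n" and n: "n > 0"
    and sym: "sym_on n (\<lambda>i j. M $$ (i, j))"
    and top: "\<And>l. eigenvalue M l \<Longrightarrow> l \<le> k"
  shows "qf n (\<lambda>i j. M $$ (i, j)) x \<le> k * nsq n x"
proof -
  define A where "A = (\<lambda>i j. M $$ (i, j))"
  define S where "S = {qf n A u | u. nsq n u = 1}"
  define l where "l = Sup S"
  obtain K where K: "K > 0" "\<And>x. \<bar>qf n A x\<bar> \<le> K * nsq n x" using form_bounded[of n A] by blast
  have ne: "S \<noteq> {}" using unit_vector_exists[OF n] by (auto simp: S_def)
  have bdd: "bdd_above S"
  proof (rule bdd_aboveI[of _ K])
    fix y assume "y \<in> S"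
    then obtain u where "y = qf n A u" "nsq n u = 1" by (auto simp: S_def)
    with K(2)[of u] show "y \<le> K" by simp
  qed
  have le: "qf n A u \<le> l * nsq n u" for u
    by (rule form_le_from_unit_sphere) (auto simp: l_def S_def intro!: cSup_upper bdd[unfolded S_def])
  have "eigenvalue M l"
  proof (rule ccontr)
    assume "\<not> eigenvalue M l"
    then have det: "det (char_matrix M l) \<noteq> 0" using eigenvalue_det[OF M] by simp
    define C where "C = char_matrix M l"
    have C: "C \<in> carrier_mat n n" using M by (simp add: C_def)
    have "C \<in> Units (ring_mat TYPE(real) n ())"
      using det C unfolding C_def by (intro det_non_zero_imp_unit)
    then obtain B where B: "B \<in> carrier_mat n n" "B * C = 1\<^sub>m n"
      by (auto simp: Units_def ring_mat_def)
    define P where "P = (\<lambda>i j. (if i = j then l else 0) - A i j)"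
    have symP: "sym_on n P" using sym by (auto simp: P_def sym_on_def A_def)
    have mvP: "mv n P u i = l * u i - mv n A u i" if "i < n" for u i
    proof -
      have "mv n P u i = (\<Sum>j<n. (if j = i then l * u j else 0) - A i j * u j)"
        unfolding mv_def P_def by (intro sum.cong) (auto simp: algebra_simps)
      also have "\<dots> = l * u i - mv n A u i"
        using that by (simp add: sum_subtractf mv_def)
      finally show ?thesis .
    qed
    have qP: "qf n P u = l * nsq n u - qf n A u" for u
    proof -
      have "qf n P u = ip n u (\<lambda>i. l * u i - mv n A u i)"
        by (intro ip_cong mvP refl)
      then show ?thesis by (simp add: form_linear)
    qed
    obtain \<kappa> where kap: "\<kappa> > 0" "\<And>x. \<bar>qf n P x\<bar> \<le> \<kappa> * nsq n x" using form_bounded[of n P] by blast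
    have psd: "nsq n (mv n P u) \<le> \<kappa> * qf n P u" for u
    proof -
      define w where "w = mv n P u"
      \<comment> \<open>the form of \<open>P\<close> is nonnegative at \<open>u - P u / \<kappa>\<close>\<close>
      define c where "c = 1 / \<kappa>"
      have "0 \<le> qf n P (\<lambda>i. u i - c * w i)"
        using le by (simp add: qP)
      also have "\<dots> = qf n P u - 2 * c * nsq n w + c\<^sup>2 * qf n P w"
        using form_sym[OF symP, of u w]
        by (simp add: form_linear w_def[symmetric] power2_eq_square ip_commute algebra_simps)
      also have "\<dots> \<le> qf n P u - 2 * c * nsq n w + c\<^sup>2 * (\<kappa> * nsq n w)"
        using kap(2)[of w] by (intro add_mono mult_left_mono) auto
      also have "\<dots> = qf n P u - nsq n w / \<kappa>"
        using kap(1) by (simp add: c_def power2_eq_square field_simps)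
      finally show ?thesis using kap(1) by (simp add: w_def field_simps)
    qed
    define b where "b = (\<Sum>i<n. nsq n (\<lambda>j. B $$ (i, j))) + 1"
    have b: "b > 0" unfolding b_def by (intro add_nonneg_pos sum_nonneg) simp_all
    have inv: "nsq n u \<le> b * nsq n (mv n P u)" for u
    proof -
      define U where "U = Matrix.vec n u"
      have U: "U \<in> carrier_vec n" by (simp add: U_def)
      have CU: "(C *\<^sub>v U) $ i = - mv n P u i" if "i < n" for i
      proof -
        have "(C *\<^sub>v U) $ i = mv n (\<lambda>i j. C $$ (i, j)) (\<lambda>j. U $ j) i"
          by (rule mv_mult_mat_vec[OF C U that])
        also have "\<dots> = (\<Sum>j<n. - (P i j * u j))"
          unfolding mv_def using that M
          by (intro sum.cong) (auto simp: C_def char_matrix_def U_def P_def A_def algebra_simps)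
        finally show ?thesis by (simp add: mv_def sum_negf)
      qed
      have BCU: "U = B *\<^sub>v (C *\<^sub>v U)" using B C U
        by (metis assoc_mult_mat_vec one_mult_mat_vec)
      have "u i = mv n (\<lambda>i j. B $$ (i, j)) (\<lambda>j. (-1) * mv n P u j) i" if "i < n" for i
      proof -
        have "u i = (B *\<^sub>v (C *\<^sub>v U)) $ i" using BCU that by (metis U_def index_vec)
        also have "\<dots> = mv n (\<lambda>i j. B $$ (i, j)) (\<lambda>j. (C *\<^sub>v U) $ j) i"
          using B C U that by (intro mv_mult_mat_vec) auto
        also have "\<dots> = mv n (\<lambda>i j. B $$ (i, j)) (\<lambda>j. (-1) * mv n P u j) i"
          unfolding mv_def[of n "\<lambda>i j. B $$ (i, j)"] by (intro sum.cong) (auto simp: CU)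
        finally show ?thesis .
      qed
      then have "nsq n u = nsq n (mv n (\<lambda>i j. B $$ (i, j)) (\<lambda>j. (-1) * mv n P u j))"
        by (intro ip_cong) auto
      also have "\<dots> \<le> (\<Sum>i<n. nsq n (\<lambda>j. B $$ (i, j))) * nsq n (\<lambda>j. (-1) * mv n P u j)"
        by (rule nsq_mv_le)
      also have "\<dots> = (\<Sum>i<n. nsq n (\<lambda>j. B $$ (i, j))) * nsq n (mv n P u)"
        by (simp only: form_linear)
      also have "\<dots> \<le> b * nsq n (mv n P u)"
        by (intro mult_right_mono) (auto simp: b_def)
      finally show ?thesis .
    qed
    have "y \<le> l - 1 / (b * \<kappa>)" if "y \<in> S" for y
    proof -
      from that obtain u where u: "y = qf n A u" "nsq n u = 1" by (auto simp: S_def)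
      have "1 \<le> b * nsq n (mv n P u)" using inv[of u] u by simp
      also have "\<dots> \<le> b * (\<kappa> * qf n P u)" using b psd by (intro mult_left_mono) auto
      also have "\<dots> = b * \<kappa> * (l - y)" using u by (simp add: qP)
      finally show ?thesis using b kap(1) by (simp add: field_simps)
    qed
    then have "l \<le> l - 1 / (b * \<kappa>)" unfolding l_def[symmetric] using ne
      by (subst (1) l_def) (intro cSup_least, auto)
    then show False using mult_pos_pos[OF b kap(1)] by simp
  qed
  then have "l \<le> k" by (rule top)
  then have "l * nsq n x \<le> k * nsq n x" by (intro mult_right_mono) auto
  with le[of x] show ?thesis by (simp add: A_def)
qed

section \<open>Sign recovery from a perturbed rank-one matrix\<close>

definition entries :: "real Matrix.mat \<Rightarrow> nat \<Rightarrow> nat \<Rightarrow> real" where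
  "entries M = (\<lambda>i j. M $$ (i, j))"

definition coords :: "real Matrix.vec \<Rightarrow> nat \<Rightarrow> real" where
  "coords x = (\<lambda>j. x $ j)"

lemma labels_coords: "\<eta> \<in> labels n \<Longrightarrow> j < n \<Longrightarrow> coords \<eta> j = 1 \<or> coords \<eta> j = -1"
  by (auto simp: labels_def coords_def)

lemma nsq_signs:
  assumes "\<And>j. j < n \<Longrightarrow> e j = 1 \<or> e j = -1"
  shows "nsq n e = real n"
proof -
  have "e j * e j = 1" if "j < n" for j using assms[OF that] by auto
  then show ?thesis by (simp add: ip_def)
qed

lemma nsq_labels: "\<eta> \<in> labels n \<Longrightarrow> nsq n (coords \<eta>) = real n"
  using labels_coords by (intro nsq_signs) auto

text \<open>Each summand of the loss is \<open>1 - \<nu> a\<^sub>j b\<^sub>j\<close>, so the minimum over \<open>\<nu>\<close> is an absolute value of the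
  correlation.\<close>

lemma loss_eq:
  assumes "a \<in> labels n" "b \<in> labels n"
  shows "loss n a b = real n - \<bar>ip n (coords a) (coords b)\<bar>"
proof -
  have "(\<Sum>j<n. \<bar>a $ j - \<nu> * b $ j\<bar>) = real n - \<nu> * ip n (coords a) (coords b)"
    if "\<nu> \<in> {-1, 1}" for \<nu>
  proof -
    have "(\<Sum>j<n. \<bar>a $ j - \<nu> * b $ j\<bar>) = (\<Sum>j<n. 1 - \<nu> * (coords a j * coords b j))"
    proof (intro sum.cong refl)
      fix j assume "j \<in> {..<n}"
      then show "\<bar>a $ j - \<nu> * b $ j\<bar> = 1 - \<nu> * (coords a j * coords b j)"
        using that labels_coords[OF assms(1), of j] labels_coords[OF assms(2), of j]
        by (auto simp: coords_def)
    qed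
    then show ?thesis by (simp add: ip_def sum_subtractf sum_distrib_left)
  qed
  from this[of 1] this[of "-1"]
  have "loss n a b = min (real n + ip n (coords a) (coords b)) (real n - ip n (coords a) (coords b))"
    by (simp add: loss_def)
  then show ?thesis by (simp add: min_def abs_if)
qed

text \<open>A coordinate whose sign disagrees with that of \<open>\<alpha> e\<close> costs at least \<open>\<alpha>\<^sup>2\<close> in the squared distance
  from \<open>w\<close> to \<open>\<alpha> e\<close>. The initialization, with \<open>w\<close> the eigenvector, and the iteration, with
  \<open>w = H x\<close>, are both analysed by this count.\<close>

lemma sign_mismatch_le_distance:
  assumes e: "\<And>j. j < n \<Longrightarrow> e j = 1 \<or> e j = -1"
    and u: "\<And>j. j < n \<Longrightarrow> u j = 1 \<or> u j = -1"
    and uw: "\<And>j. j < n \<Longrightarrow> w j \<noteq> 0 \<Longrightarrow> u j = sgn (w j)"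
  shows "(real n - \<bar>ip n u e\<bar>) * \<alpha>\<^sup>2 \<le> 2 * nsq n (\<lambda>j. w j - \<alpha> * e j)"
proof -
  define \<nu> where "\<nu> = (if \<alpha> \<ge> 0 then 1 else -1 :: real)"
  have pt: "(1 - \<nu> * (u j * e j)) * \<alpha>\<^sup>2 \<le> 2 * ((w j - \<alpha> * e j) * (w j - \<alpha> * e j))" if j: "j < n" for j
  proof (cases "u j * e j = \<nu>")
    case True
    have "(1 - \<nu> * \<nu>) = 0" by (simp add: \<nu>_def)
    then show ?thesis by (simp add: True)
  next
    case False
    \<comment> \<open>a wrong sign puts \<open>w\<^sub>j\<close> and \<open>\<alpha> e\<^sub>j\<close> on opposite sides of the origin\<close>
    have le: "\<alpha> * e j * w j \<le> 0"
    proof (cases "w j = 0")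
      case w0: False
      with uw[OF j] have "u j = sgn (w j)" by simp
      with False e[OF j] w0 show ?thesis
        by (auto simp: \<nu>_def sgn_if mult_le_0_iff split: if_splits)
    qed simp
    have "u j * e j = - \<nu>" using False e[OF j] u[OF j] by (auto simp: \<nu>_def split: if_splits)
    then have "1 - \<nu> * (u j * e j) = 2" by (simp add: \<nu>_def)
    moreover have "e j * e j = 1" using e[OF j] by auto
    then have "(w j - \<alpha> * e j) * (w j - \<alpha> * e j) = (w j)\<^sup>2 - 2 * (\<alpha> * e j * w j) + \<alpha>\<^sup>2"
      by (simp add: power2_eq_square algebra_simps)
    moreover have "(w j)\<^sup>2 \<ge> 0" by simp
    ultimately have "2 * ((w j - \<alpha> * e j) * (w j - \<alpha> * e j)) \<ge> 2 * \<alpha>\<^sup>2" using le by linarith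
    then show ?thesis by (simp add: \<open>1 - \<nu> * (u j * e j) = 2\<close>)
  qed
  have "(real n - \<bar>ip n u e\<bar>) * \<alpha>\<^sup>2 \<le> (real n - \<nu> * ip n u e) * \<alpha>\<^sup>2"
    by (intro mult_right_mono) (auto simp: \<nu>_def)
  also have "\<dots> = (\<Sum>j<n. (1 - \<nu> * (u j * e j)) * \<alpha>\<^sup>2)"
    by (simp add: ip_def sum_subtractf sum_distrib_left sum_distrib_right left_diff_distrib)
  also have "\<dots> \<le> (\<Sum>j<n. 2 * ((w j - \<alpha> * e j) * (w j - \<alpha> * e j)))"
    by (intro sum_mono pt) auto
  finally show ?thesis by (simp add: ip_def sum_distrib_left)
qed

text \<open>This is the shape of the hollow Gram matrix of the data: \<open>e\<close> is the label vector, \<open>T\<close> the squared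
  length of the signal, and \<open>E\<close> collects the noise and the deleted diagonal. The bound \<open>1 / 16\<close> makes
  sure that a loss of at most \<open>8 \<epsilon> n\<close> leaves a correlation of at least \<open>n / 2\<close>.\<close>

locale perturbed_rank_one =
  fixes n :: nat and e :: "nat \<Rightarrow> real" and T \<epsilon> :: real and H E :: "nat \<Rightarrow> nat \<Rightarrow> real"
  assumes n: "n > 0"
    and e: "\<And>j. j < n \<Longrightarrow> e j = 1 \<or> e j = -1"
    and H: "\<And>i j. i < n \<Longrightarrow> j < n \<Longrightarrow> H i j = T * e i * e j + E i j"
    and T: "T > 0" and eps: "0 < \<epsilon>" "\<epsilon> \<le> 1 / 16"
    and symE: "sym_on n E"
    and E: "\<And>x. \<bar>qf n E x\<bar> \<le> \<epsilon> * T * real n * nsq n x"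
begin

lemma mv_H: "i < n \<Longrightarrow> mv n H x i = T * ip n e x * e i + mv n E x i"
  unfolding mv_def ip_def sum_distrib_left sum_distrib_right sum.distrib[symmetric]
  by (intro sum.cong) (auto simp: H algebra_simps)

lemma qf_H: "qf n H x = T * (ip n e x)\<^sup>2 + qf n E x"
proof -
  have "qf n H x = ip n x (\<lambda>i. T * ip n e x * e i + mv n E x i)"
    by (intro ip_cong mv_H refl)
  also have "\<dots> = T * (ip n e x)\<^sup>2 + qf n E x"
    by (simp only: form_linear ip_commute[of n x e] power2_eq_square mult.assoc)
  finally show ?thesis .
qed

lemma nsq_e: "nsq n e = real n"
  by (rule nsq_signs) (rule e)

text \<open>Comparing the form of \<open>H\<close> at \<open>w\<close> and at \<open>e\<close> shows that the squared correlation of \<open>w\<close> with \<open>e\<close> is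
  at least \<open>n (1 - 2 \<epsilon>) nsq w\<close>. So \<open>w\<close> is close to its projection \<open>a e\<close> on the line of \<open>e\<close>, and
  few signs can be wrong.\<close>

lemma top_eigenvector_signs_close:
  assumes w: "nsq n w \<noteq> 0" and eig: "qf n H w = k * nsq n w" and top: "\<And>x. qf n H x \<le> k * nsq n x"
    and u: "\<And>j. j < n \<Longrightarrow> u j = 1 \<or> u j = -1" "\<And>j. j < n \<Longrightarrow> w j \<noteq> 0 \<Longrightarrow> u j = sgn (w j)"
  shows "real n - \<bar>ip n u e\<bar> \<le> 8 * \<epsilon> * n"
proof -
  define W where "W = nsq n w"
  define a where "a = ip n e w / n"
  have W: "W > 0" using w nsq_nonneg[of n w] unfolding W_def by linarith
  have n': "real n > 0" using n by simp
  have "T * (real n)\<^sup>2 - \<epsilon> * T * n * n \<le> qf n H e"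
    using E[of e] by (simp add: qf_H nsq_e)
  also have "\<dots> \<le> k * n" using top[of e] by (simp add: nsq_e)
  finally have "(T * n - \<epsilon> * T * n) * n \<le> k * n"
    by (simp add: algebra_simps power2_eq_square)
  then have "T * n - \<epsilon> * T * n \<le> k" using n' by simp
  then have "(T * n - \<epsilon> * T * n) * W \<le> k * W" using W by (intro mult_right_mono) auto
  also have "\<dots> = qf n H w" using eig by (simp add: W_def)
  also have "\<dots> \<le> T * (ip n e w)\<^sup>2 + \<epsilon> * T * n * W"
    using E[of w] by (simp add: qf_H W_def)
  finally have "T * (n * W * (1 - 2 * \<epsilon>)) \<le> T * (ip n e w)\<^sup>2"
    by (simp add: algebra_simps)
  then have corr: "n * W * (1 - 2 * \<epsilon>) \<le> (ip n e w)\<^sup>2" using T by simp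
  have "nsq n (\<lambda>j. w j - a * e j) = W - 2 * a * ip n e w + a * a * n"
    by (simp add: form_linear W_def nsq_e ip_commute[of n w e] algebra_simps)
  also have "\<dots> = W - (ip n e w)\<^sup>2 / n"
    using n' by (simp add: a_def power2_eq_square field_simps)
  also have "\<dots> \<le> 2 * \<epsilon> * W"
    using corr n' by (simp add: field_simps)
  finally have dist: "nsq n (\<lambda>j. w j - a * e j) \<le> 2 * \<epsilon> * W" .
  have "W / (2 * n) * (real n - \<bar>ip n u e\<bar>) \<le> a\<^sup>2 * (real n - \<bar>ip n u e\<bar>)"
  proof (intro mult_right_mono)
    have "n * W * (1 / 2) \<le> n * W * (1 - 2 * \<epsilon>)"
      using eps W n' by (intro mult_left_mono) auto
    then have "n * W * (1 / 2) \<le> (ip n e w)\<^sup>2" using corr by linarith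
    then show "W / (2 * n) \<le> a\<^sup>2" using n'
      by (simp add: a_def power_divide field_simps power2_eq_square)
    have "\<bar>ip n u e\<bar> \<le> sqrt (nsq n u) * sqrt (nsq n e)" by (rule abs_ip_le)
    then show "0 \<le> real n - \<bar>ip n u e\<bar>" using nsq_signs[OF u(1)] nsq_e by simp
  qed
  also have "\<dots> \<le> 4 * \<epsilon> * W"
    using sign_mismatch_le_distance[where n = n and e = e and u = u and w = w and \<alpha> = a, OF e u] dist
    by (simp add: mult.commute)
  finally have "W * (real n - \<bar>ip n u e\<bar>) \<le> W * (8 * \<epsilon> * n)"
    using n' by (simp add: field_simps)
  then show ?thesis using W by (simp only: mult_le_cancel_left_pos)
qed

text \<open>Since \<open>H x\<close> is \<open>T \<langle>e, x\<rangle> e + E x\<close> and \<open>\<langle>e, x\<rangle>\<close> is at least \<open>n / 2\<close> in absolute value, the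
  rank-one term dominates and the new loss is \<open>O(\<epsilon>\<^sup>2 n)\<close>. Hence the bound \<open>8 \<epsilon> n\<close> reproduces
  itself, whatever the number of iterations.\<close>

lemma sign_step_stays_close:
  assumes x: "\<And>j. j < n \<Longrightarrow> x j = 1 \<or> x j = -1" "real n - \<bar>ip n x e\<bar> \<le> 8 * \<epsilon> * n"
    and u: "\<And>j. j < n \<Longrightarrow> u j = 1 \<or> u j = -1" "\<And>j. j < n \<Longrightarrow> mv n H x j \<noteq> 0 \<Longrightarrow> u j = sgn (mv n H x j)"
  shows "real n - \<bar>ip n u e\<bar> \<le> 8 * \<epsilon> * n"
proof -
  have n': "real n > 0" using n by simp
  define a where "a = T * ip n e x"
  define q where "q = T * n"
  have q: "q > 0" using T n' by (simp add: q_def)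
  have nonneg: "0 \<le> real n - \<bar>ip n u e\<bar>"
    using abs_ip_le[of n u e] nsq_signs[OF u(1)] nsq_e by simp
  have "8 * \<epsilon> * n \<le> 8 * (1/16) * n" using eps by (intro mult_right_mono mult_left_mono) auto
  then have "n / 2 \<le> \<bar>ip n e x\<bar>" using x(2) by (simp add: ip_commute[of n e x])
  then have "T * (n / 2) \<le> T * \<bar>ip n e x\<bar>" using T by (intro mult_left_mono) auto
  then have "q / 2 \<le> \<bar>a\<bar>" using T by (simp add: a_def abs_mult q_def)
  then have "(q / 2)\<^sup>2 \<le> \<bar>a\<bar>\<^sup>2" using q by (intro power_mono) auto
  then have "(q / 2)\<^sup>2 * (real n - \<bar>ip n u e\<bar>) \<le> a\<^sup>2 * (real n - \<bar>ip n u e\<bar>)"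
    using nonneg by (intro mult_right_mono) auto
  also have "\<dots> \<le> 2 * nsq n (\<lambda>j. mv n H x j - a * e j)"
    using sign_mismatch_le_distance[where n = n and e = e and u = u and w = "mv n H x" and \<alpha> = a, OF e u]
    by (simp add: mult.commute)
  also have "nsq n (\<lambda>j. mv n H x j - a * e j) = nsq n (mv n E x)"
    by (intro ip_cong) (auto simp: mv_H a_def)
  also have "\<dots> \<le> (\<epsilon> * T * n)\<^sup>2 * nsq n x"
    using eps T n' by (intro form_bound_imp_norm_bound symE E) auto
  also have "\<dots> = \<epsilon> * (q\<^sup>2 * (\<epsilon> * n))"
    by (simp add: nsq_signs[OF x(1)] q_def power2_eq_square)
  also have "\<dots> \<le> 1 * (q\<^sup>2 * (\<epsilon> * n))"
    using eps by (intro mult_right_mono) auto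
  finally have "q\<^sup>2 * (real n - \<bar>ip n u e\<bar>) \<le> q\<^sup>2 * (8 * \<epsilon> * n)"
    by (simp add: power_divide)
  then show ?thesis using q by simp
qed

end

lemma hollow_gram_carrier [simp]: "Y \<in> carrier_mat p n \<Longrightarrow> hollow_gram Y \<in> carrier_mat n n"
  by (auto simp: hollow_gram_def hollow_def mat_diag_def)

lemma hollow_gram_entry:
  assumes "Y \<in> carrier_mat p n" "i < n" "j < n"
  shows "hollow_gram Y $$ (i, j) = (if i = j then 0 else \<Sum>l<p. Y $$ (l, i) * Y $$ (l, j))"
  using assms by (auto simp: hollow_gram_def hollow_def mat_diag_def scalar_prod_def atLeast0LessThan)

lemma sym_hollow_gram: "Y \<in> carrier_mat p n \<Longrightarrow> sym_on n (entries (hollow_gram Y))"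
  by (auto simp: sym_on_def entries_def hollow_gram_entry mult.commute)

lemma sign_vec_labels: "s \<in> {-1, 1} \<Longrightarrow> x \<in> carrier_vec n \<Longrightarrow> sign_vec s x \<in> labels n"
  by (auto simp: labels_def sign_vec_def sgn_if)

lemma coords_sign_vec: "x \<in> carrier_vec n \<Longrightarrow> j < n \<Longrightarrow> coords x j \<noteq> 0 \<Longrightarrow> coords (sign_vec s x) j = sgn (coords x j)"
  by (auto simp: coords_def sign_vec_def)

lemma spectral_iterate_labels:
  assumes "s \<in> {-1, 1}" "Y \<in> carrier_mat p n" "top_eigenvector (hollow_gram Y) (v Y)"
  shows "spectral_iterate s v k Y \<in> labels n"
proof (cases k)
  case 0
  have "v Y \<in> carrier_vec n"
    using assms(3) hollow_gram_carrier[OF assms(2)] by (auto simp: top_eigenvector_def eigenvector_def)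
  then show ?thesis using sign_vec_labels[OF assms(1)] 0 by simp
next
  case (Suc j)
  have "hollow_gram Y *\<^sub>v spectral_iterate s v j Y \<in> carrier_vec n"
    using hollow_gram_carrier[OF assms(2)] by (metis carrier_matD(1) carrier_vecI dim_mult_mat_vec)
  then show ?thesis using sign_vec_labels[OF assms(1)] Suc by simp
qed

lemma spectral_iterate_loss:
  assumes s: "s \<in> {-1, 1}" and Y: "Y \<in> carrier_mat p n" and v: "top_eigenvector (hollow_gram Y) (v Y)"
    and \<eta>: "\<eta> \<in> labels n"
    and P: "perturbed_rank_one n (coords \<eta>) T \<epsilon> (entries (hollow_gram Y)) E"
  shows "loss n (spectral_iterate s v k Y) \<eta> \<le> 8 * \<epsilon> * n"
proof -
  interpret perturbed_rank_one n "coords \<eta>" T \<epsilon> "entries (hollow_gram Y)" E by (rule P)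
  define M where "M = hollow_gram Y"
  have M: "M \<in> carrier_mat n n" using Y by (simp add: M_def)
  have lab: "spectral_iterate s v k Y \<in> labels n" for k
    using s Y v by (rule spectral_iterate_labels)
  have "real n - \<bar>ip n (coords (spectral_iterate s v k Y)) (coords \<eta>)\<bar> \<le> 8 * \<epsilon> * n"
  proof (induction k)
    case 0
    from v obtain l where l: "eigenvector M (v Y) l" "\<And>l'. eigenvalue M l' \<Longrightarrow> l' \<le> l"
      by (auto simp: top_eigenvector_def M_def)
    have vc: "v Y \<in> carrier_vec n" and v0: "v Y \<noteq> 0\<^sub>v n" and Mv: "M *\<^sub>v v Y = l \<cdot>\<^sub>v v Y"
      using l(1) M by (auto simp: eigenvector_def)
    show ?case
    proof (rule top_eigenvector_signs_close[of "coords (v Y)" l])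
      show "nsq n (coords (v Y)) \<noteq> 0"
      proof
        assume "nsq n (coords (v Y)) = 0"
        from nsq_eq_0D[OF this] have "v Y = 0\<^sub>v n"
          using vc by (intro eq_vecI) (auto simp: coords_def)
        with v0 show False by simp
      qed
      have "qf n (entries M) (coords (v Y)) = ip n (coords (v Y)) (\<lambda>i. l * coords (v Y) i)"
      proof (intro ip_cong refl)
        fix i assume i: "i < n"
        have "mv n (entries M) (coords (v Y)) i = (M *\<^sub>v v Y) $ i"
          using mv_mult_mat_vec[OF M vc i] by (simp add: entries_def coords_def)
        then show "mv n (entries M) (coords (v Y)) i = l * coords (v Y) i"
          using i vc by (simp add: Mv coords_def)
      qed
      then show "qf n (entries (hollow_gram Y)) (coords (v Y)) = l * nsq n (coords (v Y))"
        by (simp add: form_linear M_def)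
      show "qf n (entries (hollow_gram Y)) x \<le> l * nsq n x" for x
        using Rayleigh_le_eigenvalue[OF M n _ l(2), of x] sym_hollow_gram[OF Y]
        by (simp add: M_def entries_def)
      show "coords (spectral_iterate s v 0 Y) j = 1 \<or> coords (spectral_iterate s v 0 Y) j = -1"
        if "j < n" for j by (rule labels_coords[OF lab that])
      show "coords (spectral_iterate s v 0 Y) j = sgn (coords (v Y) j)"
        if "j < n" "coords (v Y) j \<noteq> 0" for j
        using coords_sign_vec[OF vc that] by simp
    qed
  next
    case (Suc k)
    let ?x = "spectral_iterate s v k Y"
    have xc: "?x \<in> carrier_vec n" using lab[of k] by (simp add: labels_def)
    have Mx: "M *\<^sub>v ?x \<in> carrier_vec n" using M xc by simp
    have mx: "mv n (entries M) (coords ?x) j = coords (M *\<^sub>v ?x) j" if "j < n" for j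
      using mv_mult_mat_vec[OF M xc that] by (simp add: entries_def coords_def)
    show ?case
    proof (rule sign_step_stays_close[OF _ Suc.IH])
      show "coords ?x j = 1 \<or> coords ?x j = -1" if "j < n" for j
        by (rule labels_coords[OF lab that])
      show "coords (spectral_iterate s v (Suc k) Y) j = 1 \<or> coords (spectral_iterate s v (Suc k) Y) j = -1"
        if "j < n" for j by (rule labels_coords[OF lab that])
      show "coords (spectral_iterate s v (Suc k) Y) j = sgn (mv n (entries (hollow_gram Y)) (coords ?x) j)"
        if "j < n" "mv n (entries (hollow_gram Y)) (coords ?x) j \<noteq> 0" for j
      proof -
        have "coords (spectral_iterate s v (Suc k) Y) j = coords (sign_vec s (M *\<^sub>v ?x)) j"
          by (simp add: M_def)
        also have "\<dots> = sgn (coords (M *\<^sub>v ?x) j)"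
          using that(2) unfolding M_def[symmetric] mx[OF that(1)]
          by (rule coords_sign_vec[OF Mx that(1)])
        finally show ?thesis unfolding M_def[symmetric] mx[OF that(1)] .
      qed
    qed
  qed
  then show ?thesis using loss_eq[OF lab \<eta>] by simp
qed

section \<open>Gaussian noise arrays\<close>

abbreviation cells :: "nat \<Rightarrow> nat \<Rightarrow> (nat \<times> nat) set" where
  "cells p n \<equiv> {..<p} \<times> {..<n}"

abbreviation std_normal :: "real measure" where
  "std_normal \<equiv> density lborel (\<lambda>x. ennreal (std_normal_density x))"

lemma prob_space_std_normal: "prob_space std_normal"
  by (rule prob_space_normal_density) simp

interpretation noise: prob_space "noise p n" for p n
  unfolding noise_def by (intro prob_space_PiM prob_space_std_normal)

lemma sets_noise [measurable_cong]: "sets (noise p n) = sets (\<Pi>\<^sub>M ij\<in>cells p n. (borel :: real measure))"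
  unfolding noise_def by (intro sets_PiM_cong) auto

lemma space_noise: "space (noise p n) = (\<Pi>\<^sub>E ij\<in>cells p n. UNIV)"
  by (simp add: noise_def space_PiM)

lemma measurable_noise_component:
  "ij \<in> cells p n \<Longrightarrow> (\<lambda>\<xi>. \<xi> ij) \<in> borel_measurable (noise p n)"
  by (subst measurable_cong_sets[OF sets_noise refl]) (rule measurable_component_singleton)

lemma distr_noise_component:
  assumes "ij \<in> cells p n"
  shows "distr (noise p n) borel (\<lambda>\<xi>. \<xi> ij) = std_normal"
proof -
  have "distr (noise p n) borel (\<lambda>\<xi>. \<xi> ij) = distr (noise p n) std_normal (\<lambda>\<xi>. \<xi> ij)"
    by (intro distr_cong) auto
  also have "\<dots> = std_normal"
    unfolding noise_def by (rule distr_PiM_component) (use assms prob_space_std_normal in auto)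
  finally show ?thesis .
qed

lemma noise_component_distributed:
  assumes "ij \<in> cells p n"
  shows "distributed (noise p n) lborel (\<lambda>\<xi>. \<xi> ij) std_normal_density"
proof -
  have "distr (noise p n) lborel (\<lambda>\<xi>. \<xi> ij) = distr (noise p n) borel (\<lambda>\<xi>. \<xi> ij)"
    by (intro distr_cong) auto
  then show ?thesis
    using distr_noise_component[OF assms] measurable_noise_component[OF assms]
    by (simp add: distributed_def)
qed

lemma noise_components_indep: "noise.indep_vars p n (\<lambda>_. borel) (\<lambda>ij \<xi>. \<xi> ij) (cells p n)"
proof (cases "cells p n = {}")
  case True
  show ?thesis unfolding True by (simp add: noise.indep_vars_def noise.indep_sets_def)
next
  case False
  have "distr (noise p n) (\<Pi>\<^sub>M ij\<in>cells p n. borel) (\<lambda>\<xi>. \<lambda>ij\<in>cells p n. \<xi> ij) =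
      distr (noise p n) (noise p n) (\<lambda>\<xi>. \<xi>)"
    by (intro distr_cong) (auto simp: sets_noise space_noise)
  also have "\<dots> = noise p n" by simp
  also have "\<dots> = (\<Pi>\<^sub>M ij\<in>cells p n. distr (noise p n) borel (\<lambda>\<xi>. \<xi> ij))"
    unfolding noise_def[of p n] by (intro PiM_cong refl) (auto simp: distr_noise_component[unfolded noise_def])
  finally show ?thesis
    by (subst noise.indep_vars_iff_distr_eq_PiM'[OF False]) (auto intro: measurable_noise_component)
qed

text \<open>In the applications \<open>g j\<close> is a function of the whole array that reads only the cells in \<open>K j\<close>, and
  \<open>f j\<close> is the same function on the block.\<close>

lemma noise_blocks_indep:
  fixes f :: "'b \<Rightarrow> (nat \<times> nat \<Rightarrow> real) \<Rightarrow> real"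
  assumes K: "\<And>j. j \<in> L \<Longrightarrow> K j \<subseteq> cells p n" "disjoint_family_on K L"
    and f: "\<And>j. j \<in> L \<Longrightarrow> f j \<in> borel_measurable (\<Pi>\<^sub>M ij\<in>K j. borel)"
    and g: "\<And>j \<xi>. j \<in> L \<Longrightarrow> g j \<xi> = f j (restrict \<xi> (K j))"
  shows "noise.indep_vars p n (\<lambda>_. borel) g L"
proof -
  have "noise.indep_vars p n (\<lambda>_. borel) (\<lambda>j \<xi>. f j (restrict \<xi> (K j))) L"
    by (rule noise.indep_vars_compose2[OF noise.indep_vars_restrict[OF noise_components_indep K]]) (auto intro: f)
  then show ?thesis
    by (rule noise.indep_vars_cong[THEN iffD1, rotated -1]) (auto simp: g)
qed

text \<open>The sum of independent Gaussians needs positive variances, so cells with coefficient \<open>0\<close> are dropped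
  first.\<close>

lemma noise_linear_form_distributed:
  assumes J: "J \<subseteq> cells p n" and c: "(\<Sum>ij\<in>J. (c ij)\<^sup>2) > 0"
  shows "distributed (noise p n) lborel (\<lambda>\<xi>. \<Sum>ij\<in>J. c ij * \<xi> ij) (normal_density 0 (sqrt (\<Sum>ij\<in>J. (c ij)\<^sup>2)))"
proof -
  define S where "S = {ij\<in>J. c ij \<noteq> 0}"
  have fin: "finite J" using J by (rule finite_subset) simp
  have sq: "(\<Sum>ij\<in>S. (c ij)\<^sup>2) = (\<Sum>ij\<in>J. (c ij)\<^sup>2)"
    by (rule sum.mono_neutral_left) (auto simp: S_def fin)
  have lin: "(\<Sum>ij\<in>S. c ij * \<xi> ij) = (\<Sum>ij\<in>J. c ij * \<xi> ij)" for \<xi> :: "nat \<times> nat \<Rightarrow> real"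
    by (rule sum.mono_neutral_left) (auto simp: S_def fin)
  have ne: "S \<noteq> {}" using c sq by force
  have "noise.indep_vars p n (\<lambda>_. borel) (\<lambda>ij \<xi>. c ij * \<xi> ij) S"
    using J by (intro noise.indep_vars_compose2[OF noise.indep_vars_subset[OF noise_components_indep]])
      (auto simp: S_def)
  then have "distributed (noise p n) lborel (\<lambda>\<xi>. \<Sum>ij\<in>S. c ij * \<xi> ij)
      (normal_density (\<Sum>ij\<in>S. 0) (sqrt (\<Sum>ij\<in>S. \<bar>c ij\<bar>\<^sup>2)))"
  proof (rule noise.sum_indep_normal[rotated 2])
    fix ij assume ij: "ij \<in> S"
    have "distributed (noise p n) lborel (\<lambda>\<xi>. 0 + c ij * \<xi> ij) (normal_density (0 + c ij * 0) (\<bar>c ij\<bar> * 1))"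
      by (rule noise.normal_density_affine[OF noise_component_distributed]) (use ij J in \<open>auto simp: S_def\<close>)
    then show "distributed (noise p n) lborel (\<lambda>\<xi>. c ij * \<xi> ij) (normal_density 0 \<bar>c ij\<bar>)" by simp
  qed (use fin ne in \<open>auto simp: S_def\<close>)
  then show ?thesis by (simp add: sq lin)
qed

text \<open>Completing the square moves the mean from \<open>0\<close> to \<open>\<tau>\<^sup>2\<close>.\<close>

lemma normal_exp_integral:
  assumes "\<tau> > 0"
  shows "has_bochner_integral lborel (\<lambda>x. normal_density 0 \<tau> x * exp x) (exp (\<tau>\<^sup>2 / 2))"
proof -
  have "normal_density 0 \<tau> x * exp x = normal_density (\<tau>\<^sup>2) \<tau> x * exp (\<tau>\<^sup>2 / 2)" for x
  proof -
    have "- x\<^sup>2 / (2 * \<tau>\<^sup>2) + x = - (x - \<tau>\<^sup>2)\<^sup>2 / (2 * \<tau>\<^sup>2) + \<tau>\<^sup>2 / 2"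
      using assms by (simp add: field_simps power2_eq_square)
    then show ?thesis
      by (simp add: normal_density_def flip: exp_add)
  qed
  moreover have "has_bochner_integral lborel (\<lambda>x. normal_density (\<tau>\<^sup>2) \<tau> x * exp (\<tau>\<^sup>2 / 2)) (1 * exp (\<tau>\<^sup>2 / 2))"
    using assms by (intro has_bochner_integral_mult_left) (simp add: has_bochner_integral_iff)
  ultimately show ?thesis by simp
qed

text \<open>The factor \<open>exp (s x\<^sup>2)\<close> only changes the variance, from \<open>\<tau>\<^sup>2\<close> to \<open>\<tau>\<^sup>2 / (1 - 2 s \<tau>\<^sup>2)\<close>.\<close>

lemma normal_exp_square_integral:
  assumes t: "\<tau> > 0" and s: "2 * s * \<tau>\<^sup>2 < 1"
  shows "has_bochner_integral lborel (\<lambda>x. normal_density 0 \<tau> x * exp (s * x\<^sup>2)) (1 / sqrt (1 - 2 * s * \<tau>\<^sup>2))"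
proof -
  define d where "d = 1 - 2 * s * \<tau>\<^sup>2"
  have d: "d > 0" using s by (simp add: d_def)
  define \<rho> where "\<rho> = \<tau> / sqrt d"
  have \<rho>: "\<rho> > 0" "\<rho>\<^sup>2 = \<tau>\<^sup>2 / d" using t d by (simp_all add: \<rho>_def power_divide)
  have "normal_density 0 \<tau> x * exp (s * x\<^sup>2) = normal_density 0 \<rho> x * (1 / sqrt d)" for x
  proof -
    have "- x\<^sup>2 / (2 * \<tau>\<^sup>2) + s * x\<^sup>2 = - x\<^sup>2 / (2 * \<rho>\<^sup>2)"
      using t d unfolding \<rho>(2) by (simp add: field_simps d_def)
    then have "exp (- x\<^sup>2 / (2 * \<tau>\<^sup>2)) * exp (s * x\<^sup>2) = exp (- x\<^sup>2 / (2 * \<rho>\<^sup>2))"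
      by (simp flip: exp_add)
    moreover have "sqrt (2 * pi * \<rho>\<^sup>2) = sqrt (2 * pi * \<tau>\<^sup>2) / sqrt d"
      using t d by (simp add: \<rho>(2) real_sqrt_divide real_sqrt_mult)
    ultimately show ?thesis using d
      by (simp add: normal_density_def)
  qed
  moreover have "has_bochner_integral lborel (\<lambda>x. normal_density 0 \<rho> x * (1 / sqrt d)) (1 * (1 / sqrt d))"
    using \<rho> by (intro has_bochner_integral_mult_left) (simp add: has_bochner_integral_iff)
  ultimately show ?thesis by (simp add: d_def)
qed

lemma distributed_has_bochner_integral:
  fixes g :: "real \<Rightarrow> real"
  assumes D: "distributed M lborel X (normal_density \<mu> \<tau>)" and g: "g \<in> borel_measurable borel"
    and I: "has_bochner_integral lborel (\<lambda>x. normal_density \<mu> \<tau> x * g x) c"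
  shows "integrable M (\<lambda>\<omega>. g (X \<omega>))" "(\<integral>\<omega>. g (X \<omega>) \<partial>M) = c"
  using distributed_integrable[OF D, of g] distributed_integral[OF D, of g] g I
  by (auto simp: has_bochner_integral_iff)

lemma noise_exp_linear_form:
  assumes J: "J \<subseteq> cells p n"
  shows "integrable (noise p n) (\<lambda>\<xi>. exp (\<Sum>ij\<in>J. c ij * \<xi> ij))" (is ?I)
    and "(\<integral>\<xi>. exp (\<Sum>ij\<in>J. c ij * \<xi> ij) \<partial>noise p n) = exp ((\<Sum>ij\<in>J. (c ij)\<^sup>2) / 2)" (is ?E)
proof -
  have "?I \<and> ?E"
  proof (cases "(\<Sum>ij\<in>J. (c ij)\<^sup>2) = 0")
    case True
    have "finite J" using J by (rule finite_subset) simp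
    with True have "c ij = 0" if "ij \<in> J" for ij
      using that by (simp add: sum_nonneg_eq_0_iff)
    then show ?thesis by (simp add: noise.prob_space)
  next
    case False
    then have pos: "(\<Sum>ij\<in>J. (c ij)\<^sup>2) > 0" by (simp add: sum_nonneg order_le_neq_trans)
    from distributed_has_bochner_integral[OF noise_linear_form_distributed[OF J pos] _ normal_exp_integral] pos
    show ?thesis by simp
  qed
  then show ?I ?E by auto
qed

text \<open>The left side is the moment generating function of a centred \<open>\<chi>\<^sup>2\<close> variable with one degree of
  freedom, which is sub-Gaussian near the origin.\<close>

lemma chi_square_factor_bound:
  assumes "\<bar>s\<bar> \<le> 1 / 4"
  shows "1 / sqrt (1 - 2 * s) * exp (- s) \<le> exp (4 * s\<^sup>2)"
proof -
  have p: "1 - 2 * s > 0" using assms by auto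
  have "\<bar>ln (1 + (- 2 * s)) - (- 2 * s)\<bar> \<le> 2 * (- 2 * s)\<^sup>2"
    by (rule abs_ln_one_plus_x_minus_x_bound) (use assms in auto)
  then have "- (ln (1 - 2 * s) / 2) - s \<le> 4 * s\<^sup>2" by (simp add: abs_le_iff)
  then have "exp (- (ln (1 - 2 * s) / 2) - s) \<le> exp (4 * s\<^sup>2)" by simp
  moreover have "sqrt (1 - 2 * s) = exp (ln (1 - 2 * s) / 2)"
    using p by (simp add: ln_sqrt[symmetric])
  then have "1 / sqrt (1 - 2 * s) = exp (- (ln (1 - 2 * s) / 2))" by (simp add: exp_minus field_simps)
  then have "1 / sqrt (1 - 2 * s) * exp (- s) = exp (- (ln (1 - 2 * s) / 2) - s)"
    by (simp flip: exp_add)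
  ultimately show ?thesis by simp
qed

section \<open>Concentration of the noise Gram matrix at one vector\<close>

definition row_form :: "nat \<Rightarrow> (nat \<Rightarrow> real) \<Rightarrow> (nat \<times> nat \<Rightarrow> real) \<Rightarrow> nat \<Rightarrow> real" where
  "row_form n x \<xi> i = (\<Sum>k<n. x k * \<xi> (i, k))"

lemma row_form_eq_cells: "row_form n x \<xi> i = (\<Sum>ij\<in>{i} \<times> {..<n}. x (snd ij) * \<xi> ij)"
proof -
  have "(\<Sum>ij\<in>{i} \<times> {..<n}. x (snd ij) * \<xi> ij) = (\<Sum>k<n. x k * \<xi> (i, k))"
    using sum.cartesian_product[of "\<lambda>i k. x k * \<xi> (i, k)" "{..<n}" "{i}"] by (simp add: case_prod_unfold)
  then show ?thesis by (simp add: row_form_def)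
qed

lemma sum_row_squares: "(\<Sum>ij\<in>{i::nat} \<times> {..<n}. (x (snd ij))\<^sup>2) = nsq n x"
  using sum.cartesian_product[of "\<lambda>i k. (x k)\<^sup>2" "{..<n}" "{i}"]
  by (simp add: case_prod_unfold ip_def power2_eq_square)

lemma measurable_row_form [measurable]:
  assumes "i < p" shows "(\<lambda>\<xi>. row_form n x \<xi> i) \<in> borel_measurable (noise p n)"
  unfolding row_form_def
  by (intro borel_measurable_sum borel_measurable_times borel_measurable_const measurable_noise_component)
    (use assms in auto)

lemma row_forms_indep:
  assumes [measurable]: "g \<in> borel_measurable borel"
  shows "noise.indep_vars p n (\<lambda>_. borel) (\<lambda>i \<xi>. g (row_form n x \<xi> i) :: real) {..<p}"
proof (rule noise_blocks_indep[where K = "\<lambda>i. {i} \<times> {..<n}"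
      and f = "\<lambda>i y. g (\<Sum>k<n. x k * y (i, k))"])
  fix i :: nat
  let ?M = "\<Pi>\<^sub>M ij\<in>{i} \<times> {..<n}. (borel :: real measure)"
  have [measurable]: "(\<lambda>y. y (i, k)) \<in> borel_measurable ?M" if "k \<in> {..<n}" for k
    using that by (intro measurable_component_singleton) auto
  show "(\<lambda>y. g (\<Sum>k<n. x k * y (i, k))) \<in> borel_measurable ?M"
    by measurable
qed (auto simp: row_form_def disjoint_family_on_def)

text \<open>The Gram matrix \<open>\<xi>\<^sup>T \<xi>\<close> of the noise minus its mean \<open>p I\<close>.\<close>

definition gram_dev :: "nat \<Rightarrow> nat \<Rightarrow> (nat \<times> nat \<Rightarrow> real) \<Rightarrow> nat \<Rightarrow> nat \<Rightarrow> real" where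
  "gram_dev p n \<xi> j k = (\<Sum>i<p. \<xi> (i, j) * \<xi> (i, k)) - (if j = k then real p else 0)"

lemma sym_gram_dev: "sym_on n (gram_dev p n \<xi>)"
  by (auto simp: sym_on_def gram_dev_def mult.commute)

lemma qf_gram_dev: "qf n (gram_dev p n \<xi>) x = (\<Sum>i<p. (row_form n x \<xi> i)\<^sup>2) - real p * nsq n x"
proof -
  have "mv n (gram_dev p n \<xi>) x j = (\<Sum>i<p. \<xi> (i, j) * row_form n x \<xi> i) - real p * x j" if "j < n" for j
  proof -
    have "mv n (gram_dev p n \<xi>) x j = (\<Sum>k<n. \<Sum>i<p. \<xi> (i, j) * (x k * \<xi> (i, k))) - (\<Sum>k<n. if k = j then real p * x j else 0)"
      unfolding mv_def gram_dev_def sum_subtractf[symmetric]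
      by (intro sum.cong refl) (auto simp: sum_distrib_left sum_distrib_right algebra_simps)
    also have "(\<Sum>k<n. \<Sum>i<p. \<xi> (i, j) * (x k * \<xi> (i, k))) = (\<Sum>i<p. \<xi> (i, j) * row_form n x \<xi> i)"
      unfolding row_form_def sum_distrib_left by (rule sum.swap)
    finally show ?thesis using that by simp
  qed
  then have "qf n (gram_dev p n \<xi>) x = ip n x (\<lambda>j. (\<Sum>i<p. \<xi> (i, j) * row_form n x \<xi> i) - real p * x j)"
    by (intro ip_cong) auto
  also have "\<dots> = ip n x (\<lambda>j. \<Sum>i<p. \<xi> (i, j) * row_form n x \<xi> i) - real p * nsq n x"
    by (simp only: form_linear)
  also have "ip n x (\<lambda>j. \<Sum>i<p. \<xi> (i, j) * row_form n x \<xi> i) = (\<Sum>j<n. \<Sum>i<p. x j * \<xi> (i, j) * row_form n x \<xi> i)"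
    by (simp add: ip_def sum_distrib_left mult.assoc)
  also have "\<dots> = (\<Sum>i<p. \<Sum>j<n. x j * \<xi> (i, j) * row_form n x \<xi> i)" by (rule sum.swap)
  also have "\<dots> = (\<Sum>i<p. (row_form n x \<xi> i)\<^sup>2)"
    by (simp add: power2_eq_square row_form_def sum_distrib_right)
  finally show ?thesis .
qed

text \<open>The form at \<open>x\<close> is a sum over the \<open>p\<close> rows of independent centred squares of Gaussians with variance
  \<open>nsq x\<close>.\<close>

lemma gram_dev_mgf:
  assumes x: "nsq n x \<le> 1" and s: "\<bar>s\<bar> \<le> 1 / 4"
  shows "integrable (noise p n) (\<lambda>\<xi>. exp (s * qf n (gram_dev p n \<xi>) x))" (is ?I)
    and "(\<integral>\<xi>. exp (s * qf n (gram_dev p n \<xi>) x) \<partial>noise p n) \<le> exp (4 * real p * s\<^sup>2)" (is ?E)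
proof -
  have "?I \<and> ?E"
  proof (cases "nsq n x = 0")
    case True
    then show ?thesis by (simp add: form_zero noise.prob_space)
  next
    case False
    define t where "t = nsq n x"
    have t: "t > 0" "t \<le> 1" using False x nsq_nonneg[of n x] unfolding t_def by linarith+
    have st: "\<bar>s * t\<bar> \<le> 1 / 4" using t s mult_mono[of "\<bar>s\<bar>" "1/4" "\<bar>t\<bar>" 1] by (simp add: abs_mult)
    define g where "g = (\<lambda>y::real. exp (s * y\<^sup>2 - s * t))"
    have g [measurable]: "g \<in> borel_measurable borel" unfolding g_def by measurable
    have prod: "exp (s * qf n (gram_dev p n \<xi>) x) = (\<Prod>i<p. g (row_form n x \<xi> i))" for \<xi>
      unfolding qf_gram_dev g_def
      by (simp add: exp_sum[symmetric] sum_subtractf sum_distrib_left right_diff_distrib t_def algebra_simps)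
    have D: "distributed (noise p n) lborel (\<lambda>\<xi>. row_form n x \<xi> i) (normal_density 0 (sqrt t))" if "i < p" for i
    proof -
      have "{i} \<times> {..<n} \<subseteq> cells p n" using that by auto
      from noise_linear_form_distributed[OF this, of "\<lambda>ij. x (snd ij)"] t show ?thesis
        unfolding row_form_eq_cells by (simp add: sum_row_squares t_def)
    qed
    have I: "has_bochner_integral lborel (\<lambda>y. normal_density 0 (sqrt t) y * g y) (1 / sqrt (1 - 2 * (s * t)) * exp (- (s * t)))"
    proof -
      have "has_bochner_integral lborel (\<lambda>y. normal_density 0 (sqrt t) y * exp (s * y\<^sup>2)) (1 / sqrt (1 - 2 * s * (sqrt t)\<^sup>2))"
        by (rule normal_exp_square_integral) (use t st in \<open>auto simp: abs_le_iff\<close>)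
      then have "has_bochner_integral lborel (\<lambda>y. normal_density 0 (sqrt t) y * exp (s * y\<^sup>2) * exp (- (s * t))) (1 / sqrt (1 - 2 * s * (sqrt t)\<^sup>2) * exp (- (s * t)))"
        by (rule has_bochner_integral_mult_left)
      moreover have "normal_density 0 (sqrt t) y * exp (s * y\<^sup>2) * exp (- (s * t)) = normal_density 0 (sqrt t) y * g y" for y
        by (simp add: g_def exp_diff exp_minus field_simps)
      ultimately have "has_bochner_integral lborel (\<lambda>y. normal_density 0 (sqrt t) y * g y)
          (1 / sqrt (1 - 2 * s * (sqrt t)\<^sup>2) * exp (- (s * t)))" by (simp only:)
      moreover have "2 * s * (sqrt t)\<^sup>2 = 2 * (s * t)" using t by simp
      ultimately show ?thesis by (simp only:)
    qed
    have gi: "integrable (noise p n) (\<lambda>\<xi>. g (row_form n x \<xi> i))"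
      "(\<integral>\<xi>. g (row_form n x \<xi> i) \<partial>noise p n) = 1 / sqrt (1 - 2 * (s * t)) * exp (- (s * t))" if "i < p" for i
      using distributed_has_bochner_integral[OF D[OF that] g I] by auto
    have ind: "noise.indep_vars p n (\<lambda>_. borel) (\<lambda>i \<xi>. g (row_form n x \<xi> i)) {..<p}"
      by (rule row_forms_indep) measurable
    have "integrable (noise p n) (\<lambda>\<xi>. exp (s * qf n (gram_dev p n \<xi>) x))"
      unfolding prod by (rule noise.indep_vars_integrable[OF _ ind]) (auto intro: gi)
    moreover have "(\<integral>\<xi>. exp (s * qf n (gram_dev p n \<xi>) x) \<partial>noise p n) = (\<Prod>i<p. \<integral>\<xi>. g (row_form n x \<xi> i) \<partial>noise p n)"
      unfolding prod by (rule noise.indep_vars_lebesgue_integral[OF _ ind]) (auto intro: gi)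
    moreover have "\<dots> = (1 / sqrt (1 - 2 * (s * t)) * exp (- (s * t))) ^ p"
      by (simp add: gi)
    moreover have "\<dots> \<le> (exp (4 * s\<^sup>2)) ^ p"
    proof (rule power_mono)
      have "1 / sqrt (1 - 2 * (s * t)) * exp (- (s * t)) \<le> exp (4 * (s * t)\<^sup>2)"
        by (rule chi_square_factor_bound[OF st])
      also have "\<dots> \<le> exp (4 * s\<^sup>2)"
        using t by (simp add: power_mult_distrib mult_left_le power_le_one)
      finally show "1 / sqrt (1 - 2 * (s * t)) * exp (- (s * t)) \<le> exp (4 * s\<^sup>2)" .
    qed (use st in \<open>auto simp: abs_le_iff\<close>)
    moreover have "(exp (4 * s\<^sup>2)) ^ p = exp (4 * real p * s\<^sup>2)"
      by (simp add: exp_of_nat_mult[symmetric] algebra_simps)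
    ultimately show ?thesis by simp
  qed
  then show ?I ?E by auto
qed

lemma measurable_gram_dev_form:
  "(\<lambda>\<xi>. qf n (gram_dev p n \<xi>) x) \<in> borel_measurable (noise p n)"
  unfolding qf_gram_dev
  by (intro borel_measurable_diff borel_measurable_sum borel_measurable_power borel_measurable_const)
    (simp add: measurable_row_form)

lemma gram_dev_form_events:
  "{\<xi> \<in> space (noise p n). c \<le> qf n (gram_dev p n \<xi>) x} \<in> sets (noise p n)"
  "{\<xi> \<in> space (noise p n). c \<le> - qf n (gram_dev p n \<xi>) x} \<in> sets (noise p n)"
  "{\<xi> \<in> space (noise p n). c \<le> \<bar>qf n (gram_dev p n \<xi>) x\<bar>} \<in> sets (noise p n)"
  by (intro borel_measurable_le borel_measurable_const borel_measurable_uminus borel_measurable_abs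
      measurable_gram_dev_form)+

lemma noise_Chernoff:
  assumes f: "integrable (noise p n) (\<lambda>\<xi>. exp (s * f \<xi>))" and s: "s > 0"
    and b: "(\<integral>\<xi>. exp (s * f \<xi>) \<partial>noise p n) \<le> b"
  shows "noise.prob p n {\<xi> \<in> space (noise p n). f \<xi> \<ge> u} \<le> exp (- s * u) * b"
proof -
  have "set_integrable (noise p n) (space (noise p n)) (\<lambda>\<xi>. exp (s * f \<xi>))"
    unfolding set_integrable_def using f by (simp cong: Bochner_Integration.integrable_cong)
  then have "noise.prob p n {\<xi> \<in> space (noise p n). f \<xi> \<ge> u} \<le>
      exp (- s * u) * (\<integral>\<xi>\<in>space (noise p n). exp (s * f \<xi>) \<partial>noise p n)"
    by (intro noise.Chernoff_ineq_ge[OF s]) auto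
  also have "(\<integral>\<xi>\<in>space (noise p n). exp (s * f \<xi>) \<partial>noise p n) = (\<integral>\<xi>. exp (s * f \<xi>) \<partial>noise p n)"
    by (rule set_integral_space[OF f])
  also have "exp (- s * u) * \<dots> \<le> exp (- s * u) * b"
    using b by (intro mult_left_mono) auto
  finally show ?thesis .
qed

text \<open>Chernoff's bound with \<open>s = n / (4 m)\<close>: the variance term \<open>4 p s\<^sup>2\<close> is at most \<open>n / 4\<close>, whereas
  \<open>s\<close> times the threshold is \<open>77 n / 4\<close>. The constant \<open>77\<close> makes the difference \<open>19 n\<close>, just enough
  to pay for a net of \<open>exp (18 n)\<close> points.\<close>

lemma gram_dev_tail:
  fixes p n :: nat
  assumes x: "nsq n x \<le> 1" and n: "n > 0"
  defines "m \<equiv> real n + sqrt (real n * real p)"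
  shows "noise.prob p n {\<xi> \<in> space (noise p n). \<bar>qf n (gram_dev p n \<xi>) x\<bar> \<ge> 77 * m} \<le> 2 * exp (- 19 * real n)"
proof -
  define s where "s = real n / (4 * m)"
  have m: "m \<ge> n" "m > 0" using n by (auto simp: m_def add_pos_nonneg)
  have s: "s > 0" "s \<le> 1 / 4" using m n by (auto simp: s_def field_simps)
  have "real n * real p \<le> m\<^sup>2"
  proof -
    have "real n * real p = (sqrt (real n * real p))\<^sup>2" by simp
    also have "\<dots> \<le> m\<^sup>2" by (intro power_mono) (auto simp: m_def)
    finally show ?thesis .
  qed
  then have "real n * (real n * real p) \<le> real n * m\<^sup>2" by (intro mult_left_mono) auto
  then have ps: "4 * real p * s\<^sup>2 \<le> real n / 4"
    using m by (simp add: s_def power2_eq_square field_simps)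
  have su: "s * (77 * m) = 77 / 4 * real n" using m by (simp add: s_def field_simps)
  have half: "exp (- s * (77 * m)) * exp (4 * real p * s\<^sup>2) \<le> exp (- 19 * real n)"
  proof -
    have "- s * (77 * m) + 4 * real p * s\<^sup>2 \<le> - 19 * real n"
      using ps su by linarith
    then show ?thesis unfolding exp_add[symmetric] by simp
  qed
  let ?up = "{\<xi> \<in> space (noise p n). qf n (gram_dev p n \<xi>) x \<ge> 77 * m}"
  let ?down = "{\<xi> \<in> space (noise p n). - qf n (gram_dev p n \<xi>) x \<ge> 77 * m}"
  have "noise.prob p n ?up \<le> exp (- s * (77 * m)) * exp (4 * real p * s\<^sup>2)"
    using gram_dev_mgf[OF x, of s p] s by (intro noise_Chernoff) auto
  then have up: "noise.prob p n ?up \<le> exp (- 19 * real n)" using half by linarith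
  have "noise.prob p n ?down \<le> exp (- s * (77 * m)) * exp (4 * real p * s\<^sup>2)"
    using gram_dev_mgf[OF x, of "- s" p] s by (intro noise_Chernoff) auto
  then have down: "noise.prob p n ?down \<le> exp (- 19 * real n)" using half by linarith
  have eq: "{\<xi> \<in> space (noise p n). \<bar>qf n (gram_dev p n \<xi>) x\<bar> \<ge> 77 * m} = ?up \<union> ?down"
    by (auto simp: abs_if split: if_splits)
  have "noise.prob p n {\<xi> \<in> space (noise p n). \<bar>qf n (gram_dev p n \<xi>) x\<bar> \<ge> 77 * m}
     \<le> noise.prob p n ?up + noise.prob p n ?down"
    unfolding eq by (intro measure_Un_le gram_dev_form_events)
  also have "\<dots> \<le> exp (- 19 * real n) + exp (- 19 * real n)"
    by (rule add_mono[OF up down])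
  finally show ?thesis by (simp only: mult_2)
qed

section \<open>Uniform concentration over a lattice net\<close>

text \<open>Integer vectors that land in the unit ball when multiplied by \<open>1 / (4 sqrt n)\<close>. These multiples form
  a net of mesh \<open>1 / 4\<close> whose size can be counted without volumes.\<close>

definition lattice_ball :: "nat \<Rightarrow> (nat \<Rightarrow> int) set" where
  "lattice_ball n = {z \<in> {..<n} \<rightarrow>\<^sub>E {- (16 * int n)..16 * int n}. (\<Sum>i<n. (z i)\<^sup>2) \<le> 16 * int n}"

definition net_point :: "nat \<Rightarrow> (nat \<Rightarrow> int) \<Rightarrow> nat \<Rightarrow> real" where
  "net_point n z i = real_of_int (z i) / (4 * sqrt (real n))"

lemma finite_lattice_ball: "finite (lattice_ball n)"
proof (rule finite_subset)
  show "lattice_ball n \<subseteq> {..<n} \<rightarrow>\<^sub>E {- (16 * int n)..16 * int n}" unfolding lattice_ball_def by blast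
qed (intro finite_PiE, simp_all)

lemma sum_half_powers_le: "(\<Sum>k = - int N..int N. (1/2::real) ^ nat \<bar>k\<bar>) \<le> 4"
proof -
  have "(\<Sum>k = - int N..int N. (1/2::real) ^ nat \<bar>k\<bar>) \<le> 3 - 2 * (1/2) ^ N"
  proof (induction N)
    case (Suc N)
    have "{- int (Suc N)..int (Suc N)} = insert (- int (Suc N)) (insert (int (Suc N)) {- int N..int N})"
      by auto
    then have "(\<Sum>k = - int (Suc N)..int (Suc N). (1/2::real) ^ nat \<bar>k\<bar>) = 2 * (1/2) ^ Suc N + (\<Sum>k = - int N..int N. (1/2::real) ^ nat \<bar>k\<bar>)"
      by (simp add: nat_add_distrib)
    with Suc show ?case by simp
  qed simp
  then show ?thesis using zero_le_power[of "1/2::real" N] by linarith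
qed

text \<open>Give \<open>z\<close> the weight \<open>\<Prod>\<^sub>i 2\<^bsup>-|z\<^sub>i|\<^esup>\<close>. Integers satisfy \<open>|z\<^sub>i| \<le> z\<^sub>i\<^sup>2\<close>, so every point of the ball weighs at
  least \<open>2\<^bsup>-16 n\<^esup>\<close>, while the total weight factorizes and is at most \<open>4\<^sup>n\<close>.\<close>

lemma card_lattice_ball: "real (card (lattice_ball n)) \<le> exp (18 * real n)"
proof -
  define h where "h = (\<lambda>k::int. (1/2::real) ^ nat \<bar>k\<bar>)"
  have "real (card (lattice_ball n)) * (1/2) ^ (16 * n) = (\<Sum>z\<in>lattice_ball n. (1/2::real) ^ (16 * n))"
    by simp
  also have "\<dots> \<le> (\<Sum>z\<in>lattice_ball n. \<Prod>i<n. h (z i))"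
  proof (rule sum_mono)
    fix z assume z: "z \<in> lattice_ball n"
    have "(\<Sum>i<n. \<bar>z i\<bar>) \<le> (\<Sum>i<n. (z i)\<^sup>2)"
    proof (rule sum_mono)
      fix i
      show "\<bar>z i\<bar> \<le> (z i)\<^sup>2"
        by (cases "z i = 0") (use self_le_power[of "\<bar>z i\<bar>" 2] in auto)
    qed
    also have "\<dots> \<le> 16 * int n" using z by (simp add: lattice_ball_def)
    finally have "(\<Sum>i<n. \<bar>z i\<bar>) \<le> 16 * int n" .
    moreover have "int (\<Sum>i<n. nat \<bar>z i\<bar>) = (\<Sum>i<n. \<bar>z i\<bar>)" by simp
    ultimately have "(\<Sum>i<n. nat \<bar>z i\<bar>) \<le> 16 * n" by linarith
    then have "(1/2::real) ^ (16 * n) \<le> (1/2) ^ (\<Sum>i<n. nat \<bar>z i\<bar>)"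
      by (intro power_decreasing) auto
    then show "(1/2::real) ^ (16 * n) \<le> (\<Prod>i<n. h (z i))" by (simp add: h_def power_sum)
  qed
  also have "\<dots> \<le> (\<Sum>z\<in>{..<n} \<rightarrow>\<^sub>E {- (16 * int n)..16 * int n}. \<Prod>i<n. h (z i))"
  proof (rule sum_mono2)
    show "finite ({..<n} \<rightarrow>\<^sub>E {- (16 * int n)..16 * int n})" by (intro finite_PiE) simp_all
    show "lattice_ball n \<subseteq> {..<n} \<rightarrow>\<^sub>E {- (16 * int n)..16 * int n}" unfolding lattice_ball_def by blast
    show "0 \<le> (\<Prod>i<n. h (z i))" for z unfolding h_def by (intro prod_nonneg) simp
  qed
  also have "\<dots> = (\<Prod>i<n. \<Sum>k = - (16 * int n)..16 * int n. h k)"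
    by (rule prod_sum_PiE[symmetric]) auto
  also have "\<dots> = (\<Sum>k = - (16 * int n)..16 * int n. h k) ^ n" by simp
  also have "\<dots> \<le> 4 ^ n"
    using sum_half_powers_le[of "16 * n"] by (intro power_mono) (auto simp: h_def intro!: sum_nonneg)
  finally have "real (card (lattice_ball n)) \<le> 4 ^ n * 2 ^ (16 * n)"
    by (simp add: power_divide field_simps)
  also have "\<dots> = 2 ^ (18 * n)"
  proof -
    have "(4::real) ^ n = 2 ^ (2 * n)" by (simp add: power_mult)
    then show ?thesis by (simp flip: power_add)
  qed
  also have "\<dots> \<le> exp 1 ^ (18 * n)"
    using exp_ge_add_one_self[of 1] by (intro power_mono) auto
  also have "\<dots> = exp (18 * real n)" by (simp flip: exp_of_nat_mult)
  finally show ?thesis .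
qed

lemma nsq_net_point: "n > 0 \<Longrightarrow> z \<in> lattice_ball n \<Longrightarrow> nsq n (net_point n z) \<le> 1"
proof -
  assume n: "n > 0" and z: "z \<in> lattice_ball n"
  have "real_of_int (\<Sum>i<n. (z i)\<^sup>2) \<le> real_of_int (16 * int n)"
    using z by (subst of_int_le_iff) (simp add: lattice_ball_def)
  then have "(\<Sum>i<n. (real_of_int (z i))\<^sup>2) / (16 * real n) \<le> 1"
    using n by simp
  moreover have "nsq n (net_point n z) = (\<Sum>i<n. (real_of_int (z i))\<^sup>2) / (16 * real n)"
    unfolding ip_def net_point_def sum_divide_distrib
    by (intro sum.cong) (simp_all add: power2_eq_square)
  ultimately show "nsq n (net_point n z) \<le> 1" by simp
qed

lemma net_approximates:
  assumes n: "n > 0" and x: "nsq n x = 1"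
  obtains z where "z \<in> lattice_ball n" "nsq n (\<lambda>i. x i - net_point n z i) \<le> 1 / 16"
proof -
  define c where "c = 4 * sqrt (real n)"
  have c: "c > 0" "c * c = 16 * real n" using n by (simp_all add: c_def)
  \<comment> \<open>rounding toward \<open>0\<close> keeps the norm from growing\<close>
  define r where "r = (\<lambda>y::real. if y \<ge> 0 then \<lfloor>y\<rfloor> else \<lceil>y\<rceil>)"
  have r1: "\<bar>real_of_int (r y)\<bar> \<le> \<bar>y\<bar>" for y
    using of_int_floor_le[of y] le_of_int_ceiling[of y] by (auto simp: r_def)
  have r2: "\<bar>y - real_of_int (r y)\<bar> \<le> 1" for y
    unfolding r_def by (cases "y \<ge> 0") (simp_all, linarith+)
  define z where "z = (\<lambda>i\<in>{..<n}. r (c * x i))"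
  have sq: "(\<Sum>i<n. (z i)\<^sup>2) \<le> 16 * int n"
  proof -
    have "real_of_int (\<Sum>i<n. (z i)\<^sup>2) = (\<Sum>i<n. \<bar>real_of_int (r (c * x i))\<bar>\<^sup>2)"
      by (simp add: z_def)
    also have "\<dots> \<le> (\<Sum>i<n. \<bar>c * x i\<bar>\<^sup>2)"
      by (intro sum_mono power_mono r1) auto
    also have "\<dots> = c * c * nsq n x"
      by (simp add: ip_def sum_distrib_left power2_eq_square algebra_simps)
    finally have "real_of_int (\<Sum>i<n. (z i)\<^sup>2) \<le> real_of_int (16 * int n)" by (simp add: x c)
    then show ?thesis by (simp only: of_int_le_iff)
  qed
  have "z i \<in> {- (16 * int n)..16 * int n}" if "i < n" for i
  proof -
    have "\<bar>z i\<bar> \<le> (z i)\<^sup>2"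
      by (cases "z i = 0") (use self_le_power[of "\<bar>z i\<bar>" 2] in auto)
    also have "\<dots> \<le> (\<Sum>i<n. (z i)\<^sup>2)" using that by (intro member_le_sum) auto
    finally show ?thesis using sq by auto
  qed
  then have "z \<in> {..<n} \<rightarrow>\<^sub>E {- (16 * int n)..16 * int n}"
    by (intro PiE_I) (simp_all add: z_def)
  then have "z \<in> lattice_ball n" using sq unfolding lattice_ball_def by blast
  moreover have "nsq n (\<lambda>i. x i - net_point n z i) \<le> 1 / 16"
  proof -
    have "nsq n (\<lambda>i. x i - net_point n z i) = (\<Sum>i<n. \<bar>c * x i - real_of_int (r (c * x i))\<bar>\<^sup>2 / (c * c))"
      unfolding ip_def
    proof (intro sum.cong refl)
      fix i assume "i \<in> {..<n}"
      then have "x i - net_point n z i = (c * x i - real_of_int (r (c * x i))) / c"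
        using c(1) by (simp add: net_point_def c_def[symmetric] z_def diff_divide_distrib)
      then show "(x i - net_point n z i) * (x i - net_point n z i) = \<bar>c * x i - real_of_int (r (c * x i))\<bar>\<^sup>2 / (c * c)"
        by (simp add: power2_eq_square)
    qed
    also have "\<dots> \<le> (\<Sum>i<n. 1 / (c * c))"
      using c(1) by (intro sum_mono divide_right_mono) (auto simp: abs_square_le_1 r2)
    finally show ?thesis using n by (simp add: c)
  qed
  ultimately show thesis by (rule that)
qed

text \<open>Let \<open>m\<close> be the supremum of the form on the unit sphere. Moving a unit vector to its net point changes
  the form by at most \<open>2 m / 4 + m / 16\<close>, so \<open>m \<le> b + 9 m / 16\<close>.\<close>

lemma net_controls_form:
  assumes n: "n > 0" and A: "sym_on n A" and b: "\<And>z. z \<in> lattice_ball n \<Longrightarrow> \<bar>qf n A (net_point n z)\<bar> \<le> b"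
  shows "\<bar>qf n A x\<bar> \<le> 3 * b * nsq n x"
proof -
  define S where "S = {\<bar>qf n A u\<bar> | u. nsq n u = 1}"
  obtain K where K: "K > 0" "\<And>x. \<bar>qf n A x\<bar> \<le> K * nsq n x" using form_bounded[of n A] by blast
  have bdd: "bdd_above S"
  proof (rule bdd_aboveI[of _ K])
    fix y assume "y \<in> S"
    then obtain u where "y = \<bar>qf n A u\<bar>" "nsq n u = 1" by (auto simp: S_def)
    with K(2)[of u] show "y \<le> K" by simp
  qed
  have ne: "S \<noteq> {}" using unit_vector_exists[OF n] by (auto simp: S_def)
  define m where "m = Sup S"
  have le: "\<bar>qf n A u\<bar> \<le> m * nsq n u" for u
    by (rule form_abs_le_from_unit_sphere) (auto simp: m_def S_def intro!: cSup_upper bdd[unfolded S_def])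
  obtain u0 where u0: "nsq n u0 = 1" using unit_vector_exists[OF n] by blast
  have m0: "m \<ge> 0" using le[of u0] u0 by simp
  show ?thesis
  proof (cases "m = 0")
    case True
    obtain z where "z \<in> lattice_ball n" using net_approximates[OF n u0] by blast
    then have "b \<ge> 0" using b[of z] by linarith
    then show ?thesis using le[of x] True by (simp add: order_trans[OF _ mult_nonneg_nonneg])
  next
    case False
    then have mp: "m > 0" using m0 by simp
    have "y \<le> b + 9 / 16 * m" if "y \<in> S" for y
    proof -
      from that obtain u where u: "y = \<bar>qf n A u\<bar>" "nsq n u = 1" by (auto simp: S_def)
      from net_approximates[OF n u(2)] obtain z where z: "z \<in> lattice_ball n"
        "nsq n (\<lambda>i. u i - net_point n z i) \<le> 1 / 16" by blast
      define r where "r = (\<lambda>i. u i - net_point n z i)"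
      define v where "v = net_point n z"
      have "u = (\<lambda>i. v i + r i)" by (simp add: r_def v_def)
      then have split: "qf n A u = qf n A v + 2 * ip n r (mv n A v) + qf n A r"
        using form_sym[OF A, of v r] by (simp add: form_linear)
      have "\<bar>ip n r (mv n A v)\<bar> \<le> m * sqrt (nsq n r) * sqrt (nsq n v)"
        by (rule form_bound_imp_bilinear_bound[OF A mp le])
      also have "\<dots> \<le> m * sqrt (1 / 16) * sqrt 1"
        using z nsq_net_point[OF n z(1)] mp by (intro mult_mono real_sqrt_le_mono) (auto simp: r_def v_def)
      finally have cross: "\<bar>ip n r (mv n A v)\<bar> \<le> m / 4" by (simp add: real_sqrt_divide)
      have "\<bar>qf n A r\<bar> \<le> m * (1 / 16)"
        using le[of r] mult_left_mono[OF z(2)[folded r_def] m0] by linarith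
      moreover have "\<bar>qf n A v\<bar> \<le> b" using b z by (simp add: v_def)
      ultimately show ?thesis using cross unfolding u(1) split by linarith
    qed
    then have "m \<le> b + 9 / 16 * m" unfolding m_def[symmetric] using ne
      by (subst (1) m_def) (intro cSup_least, auto)
    then have "m \<le> 3 * b" using mp by linarith
    then have "m * nsq n x \<le> 3 * b * nsq n x" by (intro mult_right_mono) auto
    with le[of x] show ?thesis by linarith
  qed
qed

text \<open>The event is indexed by the net, which makes it a finite union of measurable events.\<close>

definition gram_dev_large :: "nat \<Rightarrow> nat \<Rightarrow> (nat \<times> nat \<Rightarrow> real) set" where
  "gram_dev_large p n = {\<xi> \<in> space (noise p n). \<exists>z\<in>lattice_ball n.
     77 * (real n + sqrt (real n * real p)) \<le> \<bar>qf n (gram_dev p n \<xi>) (net_point n z)\<bar>}"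

lemma gram_dev_large_event [measurable]: "gram_dev_large p n \<in> sets (noise p n)"
proof -
  have "gram_dev_large p n = (\<Union>z\<in>lattice_ball n. {\<xi> \<in> space (noise p n).
     77 * (real n + sqrt (real n * real p)) \<le> \<bar>qf n (gram_dev p n \<xi>) (net_point n z)\<bar>})"
    by (auto simp: gram_dev_large_def)
  also have "\<dots> \<in> sets (noise p n)"
    by (intro sets.finite_UN finite_lattice_ball gram_dev_form_events)
  finally show ?thesis .
qed

lemma prob_gram_dev_large:
  assumes n: "n > 0"
  shows "noise.prob p n (gram_dev_large p n) \<le> 2 * exp (- real n)"
proof -
  let ?B = "\<lambda>z. {\<xi> \<in> space (noise p n). \<bar>qf n (gram_dev p n \<xi>) (net_point n z)\<bar> \<ge> 77 * (real n + sqrt (real n * real p))}"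
  have eq: "gram_dev_large p n = (\<Union>z\<in>lattice_ball n. ?B z)" by (auto simp: gram_dev_large_def)
  have "noise.prob p n (gram_dev_large p n) \<le> (\<Sum>z\<in>lattice_ball n. noise.prob p n (?B z))"
    unfolding eq by (rule measure_UNION_le[OF finite_lattice_ball gram_dev_form_events(3)])
  also have "\<dots> \<le> (\<Sum>z\<in>lattice_ball n. 2 * exp (- 19 * real n))"
    by (intro sum_mono gram_dev_tail nsq_net_point n)
  also have "\<dots> = real (card (lattice_ball n)) * (2 * exp (- 19 * real n))" by simp
  also have "\<dots> \<le> exp (18 * real n) * (2 * exp (- 19 * real n))"
    by (intro mult_right_mono card_lattice_ball) simp
  also have "\<dots> = 2 * exp (- real n)" by (simp flip: exp_add)
  finally show ?thesis .
qed

lemma gram_dev_form_le: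
  assumes "n > 0" "\<xi> \<in> space (noise p n)" "\<xi> \<notin> gram_dev_large p n"
  shows "\<bar>qf n (gram_dev p n \<xi>) x\<bar> \<le> 231 * (real n + sqrt (real n * real p)) * nsq n x"
proof -
  have "\<bar>qf n (gram_dev p n \<xi>) (net_point n z)\<bar> \<le> 77 * (real n + sqrt (real n * real p))" if "z \<in> lattice_ball n" for z
  proof -
    have "\<not> 77 * (real n + sqrt (real n * real p)) \<le> \<bar>qf n (gram_dev p n \<xi>) (net_point n z)\<bar>"
      using assms(2,3) that unfolding gram_dev_large_def by blast
    then show ?thesis by linarith
  qed
  from net_controls_form[OF assms(1) sym_gram_dev this, of x] show ?thesis by simp
qed

section \<open>Measurability of the estimators and risk\<close>

lemma space_mat_borel: "space (mat_borel p n) = carrier_mat p n"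
  by (simp add: mat_borel_def)

lemma measurable_mat_entry:
  assumes "i < p" "j < n"
  shows "(\<lambda>M. M $$ (i, j)) \<in> borel_measurable (mat_borel p n)"
proof -
  have "(\<lambda>M. \<lambda>ij\<in>cells p n. M $$ ij) \<in> mat_borel p n \<rightarrow>\<^sub>M (\<Pi>\<^sub>M ij\<in>cells p n. (borel :: real measure))"
    unfolding mat_borel_def by (rule measurable_vimage_algebra1) (auto simp: space_PiM)
  from measurable_component_singleton[of "(i, j)" "cells p n" "\<lambda>_. borel"] assms
  have "(\<lambda>y. y (i, j)) \<in> borel_measurable (\<Pi>\<^sub>M ij\<in>cells p n. (borel :: real measure))" by simp
  from measurable_compose[OF \<open>(\<lambda>M. \<lambda>ij\<in>cells p n. M $$ ij) \<in> _\<close> this] assms show ?thesis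
    by simp
qed

lemma finite_labels: "finite (labels n)"
proof (rule finite_subset)
  show "labels n \<subseteq> Matrix.vec n ` ({..<n} \<rightarrow>\<^sub>E {-1, 1})"
  proof
    fix \<eta> assume "\<eta> \<in> labels n"
    then have "\<eta> = Matrix.vec n (\<lambda>j\<in>{..<n}. \<eta> $ j)" "(\<lambda>j\<in>{..<n}. \<eta> $ j) \<in> {..<n} \<rightarrow>\<^sub>E {-1, 1}"
      by (auto simp: labels_def intro!: eq_vecI)
    then show "\<eta> \<in> Matrix.vec n ` ({..<n} \<rightarrow>\<^sub>E {-1, 1})" by blast
  qed
qed (intro finite_imageI finite_PiE, simp_all)

text \<open>There are finitely many labels, and the preimage of each is cut out by sign conditions on polynomials
  in the entries.\<close>

lemma sign_step_measurable:
  assumes s: "s \<in> {-1, 1}" and u: "u \<in> labels n"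
  shows "(\<lambda>Y. sign_vec s (hollow_gram Y *\<^sub>v u)) \<in> mat_borel p n \<rightarrow>\<^sub>M count_space (labels n)"
proof (subst measurable_count_space_eq2[OF finite_labels], intro conjI ballI)
  have uc: "u \<in> carrier_vec n" using u by (simp add: labels_def)
  show "(\<lambda>Y. sign_vec s (hollow_gram Y *\<^sub>v u)) \<in> space (mat_borel p n) \<rightarrow> labels n"
  proof (rule Pi_I)
    fix Y assume "Y \<in> space (mat_borel p n)"
    then have "hollow_gram Y \<in> carrier_mat n n" by (simp add: space_mat_borel)
    then have "hollow_gram Y *\<^sub>v u \<in> carrier_vec n" using uc by simp
    then show "sign_vec s (hollow_gram Y *\<^sub>v u) \<in> labels n" by (rule sign_vec_labels[OF s])
  qed
  fix a assume a: "a \<in> labels n"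
  define q where "q = (\<lambda>j Y. \<Sum>k<n. (if j = k then 0 else \<Sum>l<p. Y $$ (l, j) * Y $$ (l, k)) * u $ k)"
  have q: "(hollow_gram Y *\<^sub>v u) $ j = q j Y" if "Y \<in> carrier_mat p n" "j < n" for Y j
  proof -
    have "(hollow_gram Y *\<^sub>v u) $ j = mv n (\<lambda>i j. hollow_gram Y $$ (i, j)) (\<lambda>j. u $ j) j"
      using that by (intro mv_mult_mat_vec uc) auto
    also have "\<dots> = q j Y"
      unfolding mv_def q_def using that by (intro sum.cong refl) (simp add: hollow_gram_entry)
    finally show ?thesis .
  qed
  have [measurable]: "q j \<in> borel_measurable (mat_borel p n)" if "j < n" for j
    unfolding q_def
  proof (intro borel_measurable_sum borel_measurable_times borel_measurable_const)
    fix k assume "k \<in> {..<n}"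
    then show "(\<lambda>Y. if j = k then 0 else \<Sum>l<p. Y $$ (l, j) * Y $$ (l, k)) \<in> borel_measurable (mat_borel p n)"
      using that by (cases "j = k") (auto intro!: borel_measurable_sum borel_measurable_times measurable_mat_entry)
  qed
  have "(\<lambda>Y. sign_vec s (hollow_gram Y *\<^sub>v u)) -` {a} \<inter> space (mat_borel p n) =
      {Y \<in> space (mat_borel p n). \<forall>j\<in>{..<n}. (if q j Y = 0 then s else sgn (q j Y)) = a $ j}"
  proof (rule Set.set_eqI)
    fix Y
    show "Y \<in> (\<lambda>Y. sign_vec s (hollow_gram Y *\<^sub>v u)) -` {a} \<inter> space (mat_borel p n) \<longleftrightarrow>
      Y \<in> {Y \<in> space (mat_borel p n). \<forall>j\<in>{..<n}. (if q j Y = 0 then s else sgn (q j Y)) = a $ j}"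
    proof (cases "Y \<in> carrier_mat p n")
      case True
      then have "hollow_gram Y \<in> carrier_mat n n" by simp
      then have d: "hollow_gram Y *\<^sub>v u \<in> carrier_vec n" using uc by simp
      define w where "w = hollow_gram Y *\<^sub>v u"
      have w: "dim_vec w = n" "dim_vec a = n" using d a unfolding w_def[symmetric] by (auto simp: labels_def)
      have "sign_vec s w = a \<longleftrightarrow> (\<forall>j<n. sign_vec s w $ j = a $ j)"
        using w by (auto simp: sign_vec_def vec_eq_iff)
      also have "\<dots> \<longleftrightarrow> (\<forall>j<n. (if q j Y = 0 then s else sgn (q j Y)) = a $ j)"
        using w q[OF True] by (simp add: sign_vec_def w_def[symmetric])
      finally show ?thesis using True by (simp add: space_mat_borel Ball_def w_def)
    qed (simp add: space_mat_borel)
  qed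
  also have "\<dots> \<in> sets (mat_borel p n)"
  proof (rule sets.sets_Collect_finite_All)
    fix j assume "j \<in> {..<n}"
    then have [measurable]: "q j \<in> borel_measurable (mat_borel p n)" by simp
    show "{Y \<in> space (mat_borel p n). (if q j Y = 0 then s else sgn (q j Y)) = a $ j} \<in> sets (mat_borel p n)"
      by measurable
  qed simp
  finally show "(\<lambda>Y. sign_vec s (hollow_gram Y *\<^sub>v u)) -` {a} \<inter> space (mat_borel p n) \<in> sets (mat_borel p n)" .
qed

lemma spectral_iterate_estimator:
  assumes s: "s \<in> {-1, 1}" and "spectral_iterate s v 0 \<in> estimators p n"
  shows "spectral_iterate s v k \<in> estimators p n"
proof (induction k)
  case (Suc k)
  have "(\<lambda>Y. sign_vec s (hollow_gram Y *\<^sub>v spectral_iterate s v k Y)) \<in> mat_borel p n \<rightarrow>\<^sub>M count_space (labels n)"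
    by (rule measurable_compose_countable'[of "labels n" "\<lambda>u Y. sign_vec s (hollow_gram Y *\<^sub>v u)",
          OF sign_step_measurable[OF s] Suc.IH[unfolded estimators_def]])
      (simp_all add: finite_labels countable_finite)
  then show ?case by (simp add: estimators_def)
qed (rule assms)

lemma estimator_labels: "est \<in> estimators p n \<Longrightarrow> Y \<in> carrier_mat p n \<Longrightarrow> est Y \<in> labels n"
  using measurable_space[of est "mat_borel p n" "count_space (labels n)" Y]
  by (simp add: estimators_def space_mat_borel)

lemma observation_carrier [simp]: "observation p n \<sigma> \<theta> \<eta> \<xi> \<in> carrier_mat p n"
  by (simp add: observation_def)

lemma risk_eq_noise:
  assumes "est \<in> estimators p n"
  shows "risk p n \<sigma> est \<theta> \<eta> = (1 / real n) * (\<integral>\<xi>. loss n (est (observation p n \<sigma> \<theta> \<eta> \<xi>)) \<eta> \<partial>noise p n)"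
proof -
  have "(\<lambda>Y. loss n (est Y) \<eta>) \<in> borel_measurable (mat_borel p n)"
    using assms unfolding estimators_def by (rule measurable_compose) simp
  then show ?thesis
    unfolding risk_def data_law_def by (subst integral_distr[OF observation_measurable]) auto
qed

lemma loss_nonneg:
  assumes "a \<in> labels n" "b \<in> labels n" shows "0 \<le> loss n a b"
  using abs_ip_le[of n "coords a" "coords b"] by (simp add: loss_eq assms nsq_labels)

lemma loss_le: "a \<in> labels n \<Longrightarrow> b \<in> labels n \<Longrightarrow> loss n a b \<le> real n"
  by (simp add: loss_eq)

section \<open>Risk of the spectral estimator\<close>

text \<open>The correlation \<open>\<langle>\<theta>, \<xi>\<^sub>k\<rangle>\<close> of the signal with column \<open>k\<close> of the noise.\<close>

definition col_form :: "nat \<Rightarrow> real Matrix.vec \<Rightarrow> (nat \<times> nat \<Rightarrow> real) \<Rightarrow> nat \<Rightarrow> real" where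
  "col_form p \<theta> \<xi> k = (\<Sum>i<p. \<theta> $ i * \<xi> (i, k))"

lemma vec_norm2_sq: "\<theta> \<in> carrier_vec p \<Longrightarrow> (vec_norm2 \<theta>)\<^sup>2 = nsq p (coords \<theta>)"
  by (simp add: vec_norm2_def L2_set_def sum_nonneg ip_def coords_def power2_eq_square)

lemma col_form_second_moment:
  assumes k: "k < n" and T: "nsq p (coords \<theta>) > 0"
  shows "integrable (noise p n) (\<lambda>\<xi>. (col_form p \<theta> \<xi> k)\<^sup>2)"
    "(\<integral>\<xi>. (col_form p \<theta> \<xi> k)\<^sup>2 \<partial>noise p n) = nsq p (coords \<theta>)"
proof -
  define T where "T = nsq p (coords \<theta>)"
  have J: "{..<p} \<times> {k} \<subseteq> cells p n" using k by auto
  have c: "col_form p \<theta> \<xi> k = (\<Sum>ij\<in>{..<p} \<times> {k}. \<theta> $ fst ij * \<xi> ij)" for \<xi>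
    using sum.cartesian_product[of "\<lambda>i k. \<theta> $ i * \<xi> (i, k)" "{k}" "{..<p}"]
    by (simp add: case_prod_unfold col_form_def)
  have q: "(\<Sum>ij\<in>{..<p} \<times> {k}. (\<theta> $ fst ij)\<^sup>2) = T"
    using sum.cartesian_product[of "\<lambda>i k. (\<theta> $ i)\<^sup>2" "{k}" "{..<p}"]
    by (simp add: case_prod_unfold T_def ip_def coords_def power2_eq_square)
  have T': "T > 0" "sqrt T > 0" using T by (simp_all add: T_def)
  have D: "distributed (noise p n) lborel (\<lambda>\<xi>. col_form p \<theta> \<xi> k) (normal_density 0 (sqrt T))"
    unfolding c using noise_linear_form_distributed[OF J, of "\<lambda>ij. \<theta> $ fst ij"] q T' by simp
  show "integrable (noise p n) (\<lambda>\<xi>. (col_form p \<theta> \<xi> k)\<^sup>2)"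
    using integrable_normal_moment[OF T'(2), of 0 2]
    by (subst distributed_integrable[OF D, symmetric]) simp_all
  have "noise.variance p n (\<lambda>\<xi>. col_form p \<theta> \<xi> k) = (sqrt T)\<^sup>2"
    by (rule noise.normal_distributed_variance[OF T'(2) D])
  then show "(\<integral>\<xi>. (col_form p \<theta> \<xi> k)\<^sup>2 \<partial>noise p n) = nsq p (coords \<theta>)"
    using noise.normal_distributed_expectation[OF T'(2) D] T' by (simp add: T_def)
qed

definition col_form_large :: "nat \<Rightarrow> nat \<Rightarrow> real Matrix.vec \<Rightarrow> real \<Rightarrow> (nat \<times> nat \<Rightarrow> real) set" where
  "col_form_large p n \<theta> \<delta> = {\<xi> \<in> space (noise p n).
     real n * nsq p (coords \<theta>) / \<delta> \<le> (\<Sum>k<n. (col_form p \<theta> \<xi> k)\<^sup>2)}"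

text \<open>Markov's inequality is enough, because only an arbitrarily small \<open>\<delta>\<close> is asked for.\<close>

lemma prob_col_form_large:
  assumes n: "n > 0" and T: "nsq p (coords \<theta>) > 0" and d: "\<delta> > 0"
  shows "col_form_large p n \<theta> \<delta> \<in> sets (noise p n)"
    "noise.prob p n (col_form_large p n \<theta> \<delta>) \<le> \<delta>"
proof -
  have int: "integrable (noise p n) (\<lambda>\<xi>. \<Sum>k<n. (col_form p \<theta> \<xi> k)\<^sup>2)"
    using col_form_second_moment(1)[OF _ T] by (intro Bochner_Integration.integrable_sum) simp
  show "col_form_large p n \<theta> \<delta> \<in> sets (noise p n)"
    unfolding col_form_large_def
    by (rule borel_measurable_le[OF borel_measurable_const borel_measurable_integrable[OF int]])
  have "noise.prob p n (col_form_large p n \<theta> \<delta>) \<le>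
      (\<integral>\<xi>. (\<Sum>k<n. (col_form p \<theta> \<xi> k)\<^sup>2) \<partial>noise p n) / (real n * nsq p (coords \<theta>) / \<delta>)"
    unfolding col_form_large_def
    by (rule integral_Markov_inequality_measure[OF int sets.top]) (use n T d in \<open>auto simp: sum_nonneg\<close>)
  also have "(\<integral>\<xi>. (\<Sum>k<n. (col_form p \<theta> \<xi> k)\<^sup>2) \<partial>noise p n) = real n * nsq p (coords \<theta>)"
    using col_form_second_moment[OF _ T] by (subst Bochner_Integration.integral_sum) auto
  also have "\<dots> / (real n * nsq p (coords \<theta>) / \<delta>) = \<delta>" using n T by simp
  finally show "noise.prob p n (col_form_large p n \<theta> \<delta>) \<le> \<delta>" .
qed

text \<open>What remains of the hollow Gram matrix after \<open>T \<eta> \<eta>\<^sup>T\<close> is subtracted. The hollow matrix vanishes on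
  the diagonal, where \<open>\<eta>\<^sub>j\<^sup>2 = 1\<close>, so the diagonal of the remainder is \<open>- T\<close>.\<close>

definition gram_error :: "nat \<Rightarrow> real \<Rightarrow> real Matrix.vec \<Rightarrow> real Matrix.vec \<Rightarrow> (nat \<times> nat \<Rightarrow> real) \<Rightarrow> nat \<Rightarrow> nat \<Rightarrow> real" where
  "gram_error p \<sigma> \<theta> \<eta> \<xi> j k =
     (if j = k then - nsq p (coords \<theta>)
      else \<sigma> * (\<eta> $ j * col_form p \<theta> \<xi> k + col_form p \<theta> \<xi> j * \<eta> $ k) + \<sigma>\<^sup>2 * (\<Sum>i<p. \<xi> (i, j) * \<xi> (i, k)))"

lemma hollow_gram_observation:
  assumes \<eta>: "\<eta> \<in> labels n" and jk: "j < n" "k < n"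
  shows "hollow_gram (observation p n \<sigma> \<theta> \<eta> \<xi>) $$ (j, k) =
    nsq p (coords \<theta>) * coords \<eta> j * coords \<eta> k + gram_error p \<sigma> \<theta> \<eta> \<xi> j k"
proof (cases "j = k")
  case True
  have "coords \<eta> j * coords \<eta> j = 1" using labels_coords[OF \<eta> jk(1)] by auto
  then show ?thesis using True jk
    by (simp add: hollow_gram_entry[OF observation_carrier] gram_error_def mult.assoc)
next
  case False
  have "hollow_gram (observation p n \<sigma> \<theta> \<eta> \<xi>) $$ (j, k) =
      (\<Sum>i<p. (\<theta> $ i * \<eta> $ j + \<sigma> * \<xi> (i, j)) * (\<theta> $ i * \<eta> $ k + \<sigma> * \<xi> (i, k)))"
    using False jk by (simp add: hollow_gram_entry[OF observation_carrier]) (simp add: observation_def)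
  also have "\<dots> = nsq p (coords \<theta>) * coords \<eta> j * coords \<eta> k + gram_error p \<sigma> \<theta> \<eta> \<xi> j k"
    using False by (simp add: gram_error_def ip_def coords_def col_form_def sum.distrib sum_distrib_left
        sum_distrib_right power2_eq_square algebra_simps)
  finally show ?thesis .
qed

lemma sym_gram_error: "sym_on n (gram_error p \<sigma> \<theta> \<eta> \<xi>)"
  by (auto simp: sym_on_def gram_error_def mult.commute add.commute)

text \<open>The off-diagonal part is written as a full matrix minus its diagonal. The full matrix splits into the
  rank-two signal-noise term and the noise Gram matrix, whose mean \<open>p I\<close> cancels.\<close>

lemma qf_gram_error:
  fixes p n \<sigma> \<theta> \<eta> \<xi>
  defines "g \<equiv> col_form p \<theta> \<xi>" and "B \<equiv> gram_dev p n \<xi>"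
  shows "qf n (gram_error p \<sigma> \<theta> \<eta> \<xi>) x = 2 * \<sigma> * ip n (coords \<eta>) x * ip n g x + \<sigma>\<^sup>2 * qf n B x
    - (\<Sum>j<n. (2 * \<sigma> * coords \<eta> j * g j + \<sigma>\<^sup>2 * B j j + nsq p (coords \<theta>)) * (x j)\<^sup>2)"
proof -
  define d where "d = (\<lambda>j. 2 * \<sigma> * coords \<eta> j * g j + \<sigma>\<^sup>2 * B j j + nsq p (coords \<theta>))"
  have "mv n (gram_error p \<sigma> \<theta> \<eta> \<xi>) x j =
      (\<sigma> * ip n g x) * coords \<eta> j + (\<sigma> * ip n (coords \<eta>) x) * g j + \<sigma>\<^sup>2 * mv n B x j - d j * x j" if "j < n" for j
  proof -
    have "mv n (gram_error p \<sigma> \<theta> \<eta> \<xi>) x j = (\<Sum>k<n. \<sigma> * coords \<eta> j * (g k * x k) + \<sigma> * g j * (coords \<eta> k * x k)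
        + \<sigma>\<^sup>2 * (B j k * x k) - (if k = j then d j * x j else 0))"
      unfolding mv_def
      by (intro sum.cong refl) (auto simp: gram_error_def d_def g_def B_def gram_dev_def coords_def algebra_simps)
    also have "\<dots> = \<sigma> * coords \<eta> j * ip n g x + \<sigma> * g j * ip n (coords \<eta>) x + \<sigma>\<^sup>2 * mv n B x j - d j * x j"
      using that by (simp add: sum.distrib sum_subtractf sum_distrib_left[symmetric] ip_def mv_def)
    finally show ?thesis by (simp add: algebra_simps)
  qed
  then have "qf n (gram_error p \<sigma> \<theta> \<eta> \<xi>) x =
      ip n x (\<lambda>j. (\<sigma> * ip n g x) * coords \<eta> j + (\<sigma> * ip n (coords \<eta>) x) * g j + \<sigma>\<^sup>2 * mv n B x j - d j * x j)"
    by (intro ip_cong) auto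
  also have "\<dots> = 2 * \<sigma> * ip n (coords \<eta>) x * ip n g x + \<sigma>\<^sup>2 * qf n B x - ip n x (\<lambda>j. d j * x j)"
    by (simp only: form_linear) (simp add: ip_commute[of n x g] ip_commute[of n x "coords \<eta>"])
  also have "ip n x (\<lambda>j. d j * x j) = (\<Sum>j<n. d j * (x j)\<^sup>2)"
    by (simp add: ip_def power2_eq_square mult.left_commute)
  finally show ?thesis by (simp only: d_def)
qed

text \<open>The diagonal that is subtracted obeys the same bounds as the full matrix, since each diagonal entry of
  the noise Gram matrix is a value of its form at a unit vector. This doubles both noise terms.\<close>

lemma gram_error_form_le:
  assumes n: "n > 0" and \<eta>: "\<eta> \<in> labels n" and \<sigma>: "\<sigma> > 0"
    and U: "\<And>x. \<bar>qf n (gram_dev p n \<xi>) x\<bar> \<le> U * nsq n x"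
    and G: "nsq n (col_form p \<theta> \<xi>) \<le> G\<^sup>2" "G \<ge> 0"
  shows "\<bar>qf n (gram_error p \<sigma> \<theta> \<eta> \<xi>) x\<bar> \<le> (4 * \<sigma> * sqrt n * G + 2 * \<sigma>\<^sup>2 * U + nsq p (coords \<theta>)) * nsq n x"
proof -
  define g where "g = col_form p \<theta> \<xi>"
  define B where "B = gram_dev p n \<xi>"
  define T where "T = nsq p (coords \<theta>)"
  define N where "N = nsq n x"
  have N: "N \<ge> 0" by (simp add: N_def)
  have sg: "sqrt (nsq n g) \<le> G" using real_sqrt_le_mono[OF G(1)] G(2) by (simp add: g_def)
  have T: "T \<ge> 0" by (simp add: T_def)
  have diag: "\<bar>B j j\<bar> \<le> U" if "j < n" for j
  proof -
    define e where "e = (\<lambda>k. if k = j then 1 else 0 :: real)"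
    have pick: "ip n e y = y j" for y using that by (simp add: ip_def e_def if_distrib[of "\<lambda>c. c * _"] cong: if_cong)
    have "mv n B e j = B j j" using that by (simp add: mv_def e_def if_distrib cong: if_cong)
    then have "qf n B e = B j j" "nsq n e = 1" by (simp_all add: pick) (simp add: e_def)
    with U[of e] show ?thesis by (simp add: B_def)
  qed
  have gj: "\<bar>g j\<bar> \<le> G" if "j < n" for j
  proof -
    have "(g j)\<^sup>2 \<le> (\<Sum>i<n. (g i)\<^sup>2)" using that by (intro member_le_sum) auto
    also have "\<dots> \<le> G\<^sup>2" using G(1) by (simp add: g_def ip_def power2_eq_square)
    finally show ?thesis using G(2) by (simp add: abs_le_square_iff[symmetric])
  qed
  have "\<bar>ip n (coords \<eta>) x\<bar> * \<bar>ip n g x\<bar> \<le> (sqrt n * sqrt N) * (G * sqrt N)"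
  proof (rule mult_mono)
    show "\<bar>ip n (coords \<eta>) x\<bar> \<le> sqrt n * sqrt N"
      using abs_ip_le[of n "coords \<eta>" x] by (simp add: nsq_labels[OF \<eta>] N_def)
    have "\<bar>ip n g x\<bar> \<le> sqrt (nsq n g) * sqrt N" unfolding N_def by (rule abs_ip_le)
    also have "\<dots> \<le> G * sqrt N" using sg N by (intro mult_right_mono) auto
    finally show "\<bar>ip n g x\<bar> \<le> G * sqrt N" .
  qed (use N in auto)
  also have "\<dots> = sqrt n * G * N"
  proof -
    have "(sqrt n * sqrt N) * (G * sqrt N) = sqrt n * G * (sqrt N * sqrt N)" by (simp only: mult_ac)
    also have "sqrt N * sqrt N = N" using N by simp
    finally show ?thesis .
  qed
  finally have "2 * \<sigma> * (\<bar>ip n (coords \<eta>) x\<bar> * \<bar>ip n g x\<bar>) \<le> 2 * \<sigma> * (sqrt n * G * N)"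
    using \<sigma> by (intro mult_left_mono) auto
  then have t1: "\<bar>2 * \<sigma> * ip n (coords \<eta>) x * ip n g x\<bar> \<le> 2 * \<sigma> * (sqrt n * G * N)"
    using \<sigma> by (simp add: abs_mult)
  have t2: "\<bar>\<sigma>\<^sup>2 * qf n B x\<bar> \<le> \<sigma>\<^sup>2 * (U * N)"
    unfolding abs_mult using U[of x] by (simp add: B_def N_def mult_left_mono)
  define d where "d = (\<lambda>j. 2 * \<sigma> * coords \<eta> j * g j + \<sigma>\<^sup>2 * B j j + T)"
  have dj: "\<bar>d j\<bar> \<le> 2 * \<sigma> * (sqrt n * G) + \<sigma>\<^sup>2 * U + T" if "j < n" for j
  proof -
    have "\<bar>2 * \<sigma> * coords \<eta> j * g j\<bar> = 2 * \<sigma> * \<bar>g j\<bar>"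
      using labels_coords[OF \<eta> that] \<sigma> by (auto simp: abs_mult)
    also have "\<dots> \<le> 2 * \<sigma> * (sqrt n * G)"
    proof (intro mult_left_mono)
      have "1 * G \<le> sqrt n * G" using n G(2) by (intro mult_right_mono) auto
      then show "\<bar>g j\<bar> \<le> sqrt n * G" using gj[OF that] by linarith
    qed (use \<sigma> in auto)
    finally have "\<bar>2 * \<sigma> * coords \<eta> j * g j\<bar> \<le> 2 * \<sigma> * (sqrt n * G)" .
    moreover have "\<bar>\<sigma>\<^sup>2 * B j j\<bar> \<le> \<sigma>\<^sup>2 * U"
      unfolding abs_mult using diag[OF that] by (simp add: mult_left_mono)
    ultimately show ?thesis unfolding d_def using T by linarith
  qed
  have "\<bar>\<Sum>j<n. d j * (x j)\<^sup>2\<bar> \<le> (\<Sum>j<n. \<bar>d j * (x j)\<^sup>2\<bar>)" by (rule sum_abs)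
  also have "\<dots> \<le> (\<Sum>j<n. (2 * \<sigma> * (sqrt n * G) + \<sigma>\<^sup>2 * U + T) * (x j)\<^sup>2)"
    by (intro sum_mono) (auto simp: abs_mult intro!: mult_right_mono dj)
  also have "\<dots> = (2 * \<sigma> * (sqrt n * G) + \<sigma>\<^sup>2 * U + T) * N"
    by (simp add: N_def ip_def sum_distrib_left power2_eq_square)
  finally have t3: "\<bar>\<Sum>j<n. d j * (x j)\<^sup>2\<bar> \<le> (2 * \<sigma> * (sqrt n * G) + \<sigma>\<^sup>2 * U + T) * N" .
  have "qf n (gram_error p \<sigma> \<theta> \<eta> \<xi>) x = 2 * \<sigma> * ip n (coords \<eta>) x * ip n g x + \<sigma>\<^sup>2 * qf n B x
    - (\<Sum>j<n. d j * (x j)\<^sup>2)"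
    unfolding d_def g_def B_def T_def by (rule qf_gram_error)
  then have "\<bar>qf n (gram_error p \<sigma> \<theta> \<eta> \<xi>) x\<bar> \<le>
      2 * \<sigma> * (sqrt n * G * N) + \<sigma>\<^sup>2 * (U * N) + (2 * \<sigma> * (sqrt n * G) + \<sigma>\<^sup>2 * U + T) * N"
    using t1 t2 t3 by linarith
  also have "\<dots> = (4 * \<sigma> * sqrt n * G + 2 * \<sigma>\<^sup>2 * U + T) * N" by (simp add: algebra_simps)
  finally show ?thesis by (simp add: N_def T_def)
qed

text \<open>Off an event of probability at most \<open>\<delta> + 2 exp (- n)\<close>, the signal-noise term, the noise Gram term and the
  deleted diagonal are each at most \<open>\<epsilon> T n / 3\<close>. This requirement produces the constants
  \<open>144 = (3 * 4)\<^sup>2\<close> and \<open>1386 = 3 * 2 * 231\<close>. On the exceptional event the loss is at most \<open>n\<close>.\<close>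

lemma spectral_risk_le:
  fixes p n :: nat
  assumes s: "s \<in> {-1, 1}" and v: "\<And>Y. Y \<in> carrier_mat p n \<Longrightarrow> top_eigenvector (hollow_gram Y) (v Y)"
    and v0: "spectral_iterate s v 0 \<in> estimators p n"
    and n: "n > 0" and \<sigma>: "\<sigma> > 0" and \<theta>: "\<theta> \<in> carrier_vec p" and \<eta>: "\<eta> \<in> labels n"
    and eps: "0 < \<epsilon>" "\<epsilon> \<le> 1 / 16" and d: "\<delta> > 0"
    and T: "T = (vec_norm2 \<theta>)\<^sup>2" "T > 0"
    and snr: "\<sigma>\<^sup>2 * (1 + sqrt (real p / real n)) \<le> \<epsilon> / 1386 * T" "\<sigma>\<^sup>2 \<le> \<delta> * \<epsilon>\<^sup>2 / 144 * T"
    and large: "3 \<le> \<epsilon> * real n"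
  shows "risk p n \<sigma> (spectral_iterate s v k) \<theta> \<eta> \<le> 8 * \<epsilon> + (\<delta> + 2 * exp (- real n))"
proof -
  have T_eq: "nsq p (coords \<theta>) = T" using vec_norm2_sq[OF \<theta>] T by simp
  define bad where "bad = gram_dev_large p n \<union> col_form_large p n \<theta> \<delta>"
  have badm: "bad \<in> sets (noise p n)"
    unfolding bad_def using prob_col_form_large(1)[OF n _ d, of p \<theta>] T T_eq gram_dev_large_event by auto
  have badp: "noise.prob p n bad \<le> \<delta> + 2 * exp (- real n)"
  proof -
    have "noise.prob p n bad \<le> noise.prob p n (gram_dev_large p n) + noise.prob p n (col_form_large p n \<theta> \<delta>)"
      unfolding bad_def using prob_col_form_large(1)[OF n _ d, of p \<theta>] T T_eq gram_dev_large_event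
      by (intro measure_Un_le) auto
    then show ?thesis using prob_gram_dev_large[OF n, of p] prob_col_form_large(2)[OF n _ d, of p \<theta>] T T_eq
      by simp
  qed
  define est where "est = spectral_iterate s v k"
  have est: "est \<in> estimators p n" unfolding est_def by (rule spectral_iterate_estimator[OF s v0])
  have good: "loss n (est (observation p n \<sigma> \<theta> \<eta> \<xi>)) \<eta> \<le> 8 * \<epsilon> * n"
    if \<xi>: "\<xi> \<in> space (noise p n)" "\<xi> \<notin> bad" for \<xi>
  proof -
    define G where "G = sqrt (real n * T / \<delta>)"
    define U where "U = 231 * (real n + sqrt (real n * real p))"
    have G: "G \<ge> 0" "G\<^sup>2 = real n * T / \<delta>" using T d by (simp_all add: G_def)
    have g: "nsq n (col_form p \<theta> \<xi>) \<le> G\<^sup>2"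
    proof -
      have "\<not> real n * T / \<delta> \<le> (\<Sum>k<n. (col_form p \<theta> \<xi> k)\<^sup>2)"
        using \<xi> by (simp add: bad_def col_form_large_def T_eq)
      then show ?thesis unfolding G(2) by (simp add: ip_def power2_eq_square)
    qed
    have gU: "\<bar>qf n (gram_dev p n \<xi>) x\<bar> \<le> U * nsq n x" for x
      unfolding U_def using \<xi> by (intro gram_dev_form_le[OF n]) (auto simp: bad_def)
    have b1: "4 * \<sigma> * sqrt n * G \<le> \<epsilon> / 3 * T * n"
    proof -
      have "\<sigma>\<^sup>2 * (16 * T / \<delta>) \<le> \<delta> * \<epsilon>\<^sup>2 / 144 * T * (16 * T / \<delta>)"
        using snr(2) T d by (intro mult_right_mono) auto
      also have "\<dots> = (\<epsilon> / 3 * T)\<^sup>2" using d by (simp add: power2_eq_square field_simps)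
      finally have "\<sigma>\<^sup>2 * (16 * T / \<delta>) * n\<^sup>2 \<le> (\<epsilon> / 3 * T)\<^sup>2 * n\<^sup>2" by (intro mult_right_mono) auto
      moreover have "(4 * \<sigma> * sqrt n * G)\<^sup>2 = \<sigma>\<^sup>2 * (16 * T / \<delta>) * n\<^sup>2"
        by (simp add: power_mult_distrib G(2)) (simp add: power2_eq_square)
      moreover have "(\<epsilon> / 3 * T * n)\<^sup>2 = (\<epsilon> / 3 * T)\<^sup>2 * n\<^sup>2" unfolding of_nat_power by (rule power_mult_distrib)
      ultimately have "(4 * \<sigma> * sqrt n * G)\<^sup>2 \<le> (\<epsilon> / 3 * T * n)\<^sup>2" by linarith
      then show ?thesis by (rule power2_le_imp_le) (use eps T in auto)
    qed
    have b2: "2 * \<sigma>\<^sup>2 * U \<le> \<epsilon> / 3 * T * n"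
    proof -
      have "sqrt (real n * real p) = real n * sqrt (real p / real n)"
      proof -
        have "real n * real p = (real n)\<^sup>2 * (real p / real n)" using n by (simp add: power2_eq_square)
        then show ?thesis by (simp only: real_sqrt_mult real_sqrt_abs abs_of_nat)
      qed
      then have "2 * \<sigma>\<^sup>2 * U = 462 * (\<sigma>\<^sup>2 * (1 + sqrt (real p / real n))) * n"
        by (simp add: U_def algebra_simps)
      also have "\<dots> \<le> 462 * (\<epsilon> / 1386 * T) * n"
        using snr(1) by (intro mult_right_mono mult_left_mono) auto
      also have "\<dots> = \<epsilon> / 3 * T * n" by simp
      finally show ?thesis .
    qed
    have b3: "T \<le> \<epsilon> / 3 * T * n" using large T mult_left_mono[of 3 "\<epsilon> * n" T] by (simp add: algebra_simps)
    have "perturbed_rank_one n (coords \<eta>) T \<epsilon> (entries (hollow_gram (observation p n \<sigma> \<theta> \<eta> \<xi>))) (gram_error p \<sigma> \<theta> \<eta> \<xi>)"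
    proof
      show "\<bar>qf n (gram_error p \<sigma> \<theta> \<eta> \<xi>) x\<bar> \<le> \<epsilon> * T * real n * nsq n x" for x
      proof -
        have "\<bar>qf n (gram_error p \<sigma> \<theta> \<eta> \<xi>) x\<bar> \<le> (4 * \<sigma> * sqrt n * G + 2 * \<sigma>\<^sup>2 * U + T) * nsq n x"
          using gram_error_form_le[OF n \<eta> \<sigma> gU g G(1), of x] by (simp add: T_eq)
        also have "\<dots> \<le> (\<epsilon> / 3 * T * n + \<epsilon> / 3 * T * n + \<epsilon> / 3 * T * n) * nsq n x"
          using b1 b2 b3 by (intro mult_right_mono add_mono) auto
        also have "\<epsilon> / 3 * T * n + \<epsilon> / 3 * T * n + \<epsilon> / 3 * T * n = \<epsilon> * T * real n"
          by (simp add: field_simps)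
        finally show ?thesis .
      qed
    qed (use n T eps labels_coords[OF \<eta>] hollow_gram_observation[OF \<eta>] sym_gram_error T_eq in \<open>auto simp: entries_def\<close>)
    then show ?thesis unfolding est_def
      by (intro spectral_iterate_loss[OF s observation_carrier _ \<eta>] v observation_carrier)
  qed
  have "(\<integral>\<xi>. loss n (est (observation p n \<sigma> \<theta> \<eta> \<xi>)) \<eta> \<partial>noise p n) \<le>
      (\<integral>\<xi>. 8 * \<epsilon> * n + real n * indicator bad \<xi> \<partial>noise p n)"
  proof (rule integral_mono')
    show "integrable (noise p n) (\<lambda>\<xi>. 8 * \<epsilon> * n + real n * indicator bad \<xi>)"
      using badm by (intro Bochner_Integration.integrable_add integrable_mult_right integrable_real_indicator)
        (auto simp: noise.emeasure_eq_measure)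
    fix \<xi> assume \<xi>: "\<xi> \<in> space (noise p n)"
    show "0 \<le> 8 * \<epsilon> * n + real n * indicator bad \<xi>" using eps by (simp add: indicator_def)
    show "loss n (est (observation p n \<sigma> \<theta> \<eta> \<xi>)) \<eta> \<le> 8 * \<epsilon> * n + real n * indicator bad \<xi>"
    proof (cases "\<xi> \<in> bad")
      case True
      have "loss n (est (observation p n \<sigma> \<theta> \<eta> \<xi>)) \<eta> \<le> n"
        by (intro loss_le estimator_labels[OF est] \<eta> observation_carrier)
      then show ?thesis using True eps by (simp add: add_increasing)
    qed (use good \<xi> in auto)
  qed
  also have "\<dots> = 8 * \<epsilon> * n + n * noise.prob p n bad"
    using badm by (subst Bochner_Integration.integral_add) (auto simp: noise.emeasure_eq_measure noise.prob_space)
  also have "\<dots> \<le> n * (8 * \<epsilon> + (\<delta> + 2 * exp (- real n)))"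
    using mult_left_mono[OF badp, of n] by (simp add: algebra_simps)
  finally have "(\<integral>\<xi>. loss n (est (observation p n \<sigma> \<theta> \<eta> \<xi>)) \<eta> \<partial>noise p n) \<le> n * (8 * \<epsilon> + (\<delta> + 2 * exp (- real n)))" .
  then show ?thesis
    unfolding est_def[symmetric] risk_eq_noise[OF est] using n by (simp add: field_simps)
qed

text \<open>The signals of the lower bound have all coordinates equal up to sign and norm exactly \<open>\<Delta>\<close>. A uniform
  choice of signs hides their direction and needs no truncation.\<close>

definition sign_vector_signal :: "nat \<Rightarrow> real \<Rightarrow> (nat \<Rightarrow> real) \<Rightarrow> real Matrix.vec" where
  "sign_vector_signal p \<Delta> \<epsilon> = Matrix.vec p (\<lambda>i. \<Delta> / sqrt (real p) * \<epsilon> i)"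

lemma norm_sign_vector_signal:
  assumes p: "p > 0" and "\<Delta> > 0" and e: "\<And>i. i < p \<Longrightarrow> \<epsilon> i \<in> {-1, 1}"
  shows "vec_norm2 (sign_vector_signal p \<Delta> \<epsilon>) = \<Delta>"
proof -
  have "(sign_vector_signal p \<Delta> \<epsilon> $ i)\<^sup>2 = \<Delta>\<^sup>2 / p" if "i < p" for i
    using e[OF that] that by (auto simp: sign_vector_signal_def power_divide)
  then have "(\<Sum>i<p. (sign_vector_signal p \<Delta> \<epsilon> $ i)\<^sup>2) = \<Delta>\<^sup>2"
    using p by simp
  then show ?thesis using \<open>\<Delta> > 0\<close>
    by (simp add: vec_norm2_def L2_set_def sign_vector_signal_def)
qed

lemma sign_vector_signal_params:
  assumes "p > 0" "\<Delta> > 0" "\<And>i. i < p \<Longrightarrow> \<epsilon> i \<in> {-1, 1}" "\<eta> \<in> labels n"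
  shows "(sign_vector_signal p \<Delta> \<epsilon>, \<eta>) \<in> params p n \<Delta>"
  using norm_sign_vector_signal[OF assms(1-3)] assms(4)
  by (simp add: params_def) (simp add: sign_vector_signal_def)

lemma risk_nonneg:
  assumes "est \<in> estimators p n" "\<eta> \<in> labels n"
  shows "0 \<le> risk p n \<sigma> est \<theta> \<eta>"
  unfolding risk_eq_noise[OF assms(1)]
  by (intro mult_nonneg_nonneg integral_nonneg_AE AE_I2 loss_nonneg estimator_labels[OF assms(1)] assms(2)) simp_all

text \<open>A supremum over the empty set would be \<open>-\<infinity>\<close>; an admissible parameter excludes this.\<close>

lemma max_risk_nonneg:
  assumes p: "p > 0" and D: "\<Delta> > 0" and est: "est \<in> estimators p n"
  shows "0 \<le> max_risk p n \<sigma> \<Delta> est"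
proof -
  define \<eta> where "\<eta> = Matrix.vec n (\<lambda>_. 1 :: real)"
  have \<eta>: "\<eta> \<in> labels n" by (simp add: labels_def \<eta>_def)
  let ?\<theta> = "sign_vector_signal p \<Delta> (\<lambda>_. 1)"
  have "ereal 0 \<le> ereal (risk p n \<sigma> est ?\<theta> \<eta>)" using risk_nonneg[OF est \<eta>] by simp
  also have "\<dots> \<le> max_risk p n \<sigma> \<Delta> est"
    unfolding max_risk_def
    using sign_vector_signal_params[OF p D _ \<eta>, of "\<lambda>_. 1"] by (intro SUP_upper2[of "(?\<theta>, \<eta>)"]) auto
  finally show ?thesis by (simp add: zero_ereal_def)
qed

lemma spectral_almost_full_recovery:
  fixes p :: "nat \<Rightarrow> nat" and \<sigma> \<Delta> :: "nat \<Rightarrow> real" and k :: "nat \<Rightarrow> nat"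
  assumes p: "\<And>n. n \<ge> 2 \<Longrightarrow> p n \<ge> 1"
    and \<sigma>: "\<And>n. n \<ge> 2 \<Longrightarrow> \<sigma> n > 0"
    and \<Delta>: "\<And>n. n \<ge> 2 \<Longrightarrow> \<Delta> n > 0"
    and snr: "(\<lambda>n. (\<sigma> n)\<^sup>2 * (1 + sqrt (real (p n) / real n))) \<in> o(\<lambda>n. (\<Delta> n)\<^sup>2)"
    and s: "s \<in> {-1, 1}"
    and v: "\<forall>n\<ge>2. \<forall>Y\<in>carrier_mat (p n) n. top_eigenvector (hollow_gram Y) (v n Y)"
    and v0: "\<forall>n\<ge>2. spectral_iterate s (v n) 0 \<in> estimators (p n) n"
  shows "achieves_almost_full_recovery p \<sigma> \<Delta> (\<lambda>n. spectral_iterate s (v n) (k n))"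
proof -
  define est where "est = (\<lambda>n. spectral_iterate s (v n) (k n))"
  have est: "est n \<in> estimators (p n) n" if "n \<ge> 2" for n
    unfolding est_def using v0 that by (simp only: spectral_iterate_estimator[OF s])
  have small: "eventually (\<lambda>n. max_risk (p n) n (\<sigma> n) (\<Delta> n) (est n) \<le> ereal e) sequentially" if e: "0 < e" "e \<le> 1" for e :: real
  proof -
    \<comment> \<open>the three parts \<open>8 \<epsilon>\<close>, \<open>\<delta>\<close> and \<open>2 exp (- n)\<close> of the risk bound are each at most \<open>e / 4\<close>\<close>
    define \<epsilon> where "\<epsilon> = e / 32"
    define \<delta> where "\<delta> = e / 4"
    define c where "c = min (\<epsilon> / 1386) (\<delta> * \<epsilon>\<^sup>2 / 144)"
    have eps: "0 < \<epsilon>" "\<epsilon> \<le> 1 / 16" and \<delta>: "\<delta> > 0" and c: "c > 0"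
      using e by (simp_all add: \<epsilon>_def \<delta>_def c_def)
    have "eventually (\<lambda>n. norm ((\<sigma> n)\<^sup>2 * (1 + sqrt (real (p n) / real n))) \<le> c * norm ((\<Delta> n)\<^sup>2)) sequentially"
      using landau_o.smallD[OF snr c] .
    moreover have "eventually (\<lambda>n. 3 / \<epsilon> \<le> real n) sequentially"
      by real_asymp
    moreover have "eventually (\<lambda>n. 2 * exp (- real n) \<le> \<delta>) sequentially"
    proof -
      have "((\<lambda>n. 2 * exp (- real n)) \<longlongrightarrow> 0) sequentially" by real_asymp
      from order_tendstoD(2)[OF this \<delta>] show ?thesis by (rule eventually_mono) simp
    qed
    ultimately show ?thesis
      using eventually_ge_at_top[of "2::nat"]
    proof eventually_elim
      case (elim n)
      have n: "n \<ge> 2" "n > 0" using elim by auto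
      have bound: "(\<sigma> n)\<^sup>2 * (1 + sqrt (real (p n) / real n)) \<le> c * (\<Delta> n)\<^sup>2" using elim(1) by simp
      show ?case unfolding max_risk_def
      proof (rule SUP_least, clarify)
        fix \<theta> \<eta> assume par: "(\<theta>, \<eta>) \<in> params (p n) n (\<Delta> n)"
        then have \<theta>: "\<theta> \<in> carrier_vec (p n)" "\<Delta> n \<le> vec_norm2 \<theta>" and \<eta>: "\<eta> \<in> labels n"
          by (auto simp: params_def)
        define T where "T = (vec_norm2 \<theta>)\<^sup>2"
        have DT: "(\<Delta> n)\<^sup>2 \<le> T" unfolding T_def using \<theta>(2) \<Delta>[OF n(1)] by (intro power_mono) auto
        have T: "T > 0" using DT \<Delta>[OF n(1)] by (meson order_less_le_trans zero_less_power)
        have snrT: "(\<sigma> n)\<^sup>2 * (1 + sqrt (real (p n) / real n)) \<le> c * T"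
          using bound mult_left_mono[OF DT, of c] c by linarith
        have "c * T \<le> \<epsilon> / 1386 * T" and "c * T \<le> \<delta> * \<epsilon>\<^sup>2 / 144 * T"
          unfolding c_def using T by (intro mult_right_mono, simp_all)+
        moreover have "(\<sigma> n)\<^sup>2 * 1 \<le> (\<sigma> n)\<^sup>2 * (1 + sqrt (real (p n) / real n))"
          by (intro mult_left_mono) auto
        ultimately have h: "(\<sigma> n)\<^sup>2 * (1 + sqrt (real (p n) / real n)) \<le> \<epsilon> / 1386 * T"
          "(\<sigma> n)\<^sup>2 \<le> \<delta> * \<epsilon>\<^sup>2 / 144 * T" using snrT by linarith+
        have "3 \<le> \<epsilon> * real n" using elim(2) eps by (simp add: field_simps)
        from spectral_risk_le[OF s _ _ n(2) \<sigma>[OF n(1)] \<theta>(1) \<eta> eps \<delta> T_def T h this, of "v n" "k n"]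
        have "risk (p n) n (\<sigma> n) (est n) \<theta> \<eta> \<le> 8 * \<epsilon> + (\<delta> + 2 * exp (- real n))"
          using v v0 n(1) unfolding est_def by blast
        also have "\<dots> \<le> e" using elim(3) e by (simp add: \<epsilon>_def \<delta>_def)
        finally show "ereal (risk (p n) n (\<sigma> n) (est n) \<theta> \<eta>) \<le> ereal e" by simp
      qed
    qed
  qed
  have "(\<lambda>n. max_risk (p n) n (\<sigma> n) (\<Delta> n) (est n)) \<longlonglongrightarrow> 0"
  proof (rule order_tendstoI)
    fix a :: ereal assume a: "a < 0"
    show "eventually (\<lambda>n. a < max_risk (p n) n (\<sigma> n) (\<Delta> n) (est n)) sequentially"
      using eventually_ge_at_top[of "2::nat"]
    proof eventually_elim
      case (elim n)
      then have "0 \<le> max_risk (p n) n (\<sigma> n) (\<Delta> n) (est n)"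
        using p[OF elim] \<Delta>[OF elim] est[OF elim] by (intro max_risk_nonneg) auto
      with a show ?case by (rule order_less_le_trans)
    qed
  next
    fix a :: ereal assume a: "0 < a"
    then obtain r where r: "0 < ereal r" "ereal r < a" using ereal_dense2 by blast
    define e where "e = min r 1"
    have "eventually (\<lambda>n. max_risk (p n) n (\<sigma> n) (\<Delta> n) (est n) \<le> ereal e) sequentially"
      using r by (intro small) (auto simp: e_def)
    then show "eventually (\<lambda>n. max_risk (p n) n (\<sigma> n) (\<Delta> n) (est n) < a) sequentially"
    proof (rule eventually_mono)
      fix n assume "max_risk (p n) n (\<sigma> n) (\<Delta> n) (est n) \<le> ereal e"
      also have "ereal e \<le> ereal r" by (simp add: e_def)
      also have "\<dots> < a" by (rule r)
      finally show "max_risk (p n) n (\<sigma> n) (\<Delta> n) (est n) < a" .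
    qed
  qed
  with est show ?thesis unfolding achieves_almost_full_recovery_def est_def by blast
qed

section \<open>Likelihood of a shifted noise array\<close>

text \<open>The density of the noise shifted by \<open>m\<close> with respect to the noise itself.\<close>

definition tilt :: "nat \<Rightarrow> nat \<Rightarrow> (nat \<times> nat \<Rightarrow> real) \<Rightarrow> (nat \<times> nat \<Rightarrow> real) \<Rightarrow> real" where
  "tilt p n m \<xi> = exp ((\<Sum>ij\<in>cells p n. m ij * \<xi> ij) - (\<Sum>ij\<in>cells p n. (m ij)\<^sup>2) / 2)"

lemma tilt_measurable [measurable]: "tilt p n m \<in> borel_measurable (noise p n)"
proof -
  have "(\<lambda>\<xi>. \<Sum>ij\<in>cells p n. m ij * \<xi> ij) \<in> borel_measurable (noise p n)"
    by (intro borel_measurable_sum borel_measurable_times borel_measurable_const measurable_noise_component)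
  then show ?thesis unfolding tilt_def[abs_def] by measurable
qed

lemma tilt_integral:
  shows "integrable (noise p n) (tilt p n m)" "(\<integral>\<xi>. tilt p n m \<xi> \<partial>noise p n) = 1"
proof -
  have t: "tilt p n m \<xi> = exp (\<Sum>ij\<in>cells p n. m ij * \<xi> ij) * exp (- ((\<Sum>ij\<in>cells p n. (m ij)\<^sup>2) / 2))" for \<xi>
    unfolding tilt_def exp_add[symmetric] by simp
  show "integrable (noise p n) (tilt p n m)"
    unfolding t[abs_def] by (intro integrable_mult_left noise_exp_linear_form) simp
  show "(\<integral>\<xi>. tilt p n m \<xi> \<partial>noise p n) = 1"
    unfolding t by (simp add: noise_exp_linear_form exp_minus)
qed

text \<open>Both sides are the product of the laws \<open>N(m\<^sub>i\<^sub>j, 1)\<close>.\<close>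

lemma distr_shifted_noise:
  assumes "p > 0" "n > 0"
  shows "distr (noise p n) (noise p n) (\<lambda>\<xi>. \<lambda>ij\<in>cells p n. \<xi> ij + m ij) = density (noise p n) (\<lambda>\<xi>. ennreal (tilt p n m \<xi>))"
proof -
  have False: "cells p n \<noteq> {}" using assms by auto
  define M where "M = (\<lambda>ij. density lborel (\<lambda>x. ennreal (normal_density (m ij) 1 x)))"
  have prob_M: "prob_space (M ij)" for ij unfolding M_def by (rule prob_space_normal_density) simp
  interpret M: product_prob_space M by (rule product_prob_spaceI) (rule prob_M)
  interpret S: product_prob_space "\<lambda>ij::nat \<times> nat. std_normal"
    by (rule product_prob_spaceI) (rule prob_space_std_normal)
  have setsM: "sets (Pi\<^sub>M (cells p n) M) = sets (noise p n)"
    unfolding sets_noise by (intro sets_PiM_cong) (auto simp: M_def)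
  define X where "X = (\<lambda>ij \<xi>. \<xi> ij + m ij :: real)"
  have Xm: "X ij \<in> borel_measurable (noise p n)" if "ij \<in> cells p n" for ij
    unfolding X_def using measurable_noise_component[OF that] by measurable
  have ind: "noise.indep_vars p n (\<lambda>_. borel) X (cells p n)"
    unfolding X_def by (intro noise.indep_vars_compose2[OF noise_components_indep]) measurable
  have "noise.indep_vars p n (\<lambda>_. borel) X (cells p n) \<longleftrightarrow>
      distr (noise p n) (\<Pi>\<^sub>M ij\<in>cells p n. borel) (\<lambda>\<xi>. \<lambda>ij\<in>cells p n. X ij \<xi>) =
      (\<Pi>\<^sub>M ij\<in>cells p n. distr (noise p n) borel (X ij))"
    by (rule noise.indep_vars_iff_distr_eq_PiM'[OF False]) (rule Xm)
  with ind have "distr (noise p n) (\<Pi>\<^sub>M ij\<in>cells p n. borel) (\<lambda>\<xi>. \<lambda>ij\<in>cells p n. X ij \<xi>) =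
      (\<Pi>\<^sub>M ij\<in>cells p n. distr (noise p n) borel (X ij))"
    by (rule iffD1[rotated])
  also have "\<dots> = Pi\<^sub>M (cells p n) M"
  proof (intro PiM_cong refl)
    fix ij assume ij: "ij \<in> cells p n"
    have "distributed (noise p n) lborel (\<lambda>\<xi>. m ij + 1 * \<xi> ij) (normal_density (m ij + 1 * 0) (\<bar>1\<bar> * 1))"
      by (rule noise.normal_density_affine[OF noise_component_distributed[OF ij]]) auto
    then have "distr (noise p n) lborel (X ij) = M ij"
      by (simp add: distributed_def X_def M_def add.commute)
    moreover have "distr (noise p n) lborel (X ij) = distr (noise p n) borel (X ij)"
      by (intro distr_cong) auto
    ultimately show "distr (noise p n) borel (X ij) = M ij" by simp
  qed
  finally have 1: "distr (noise p n) (noise p n) (\<lambda>\<xi>. \<lambda>ij\<in>cells p n. X ij \<xi>) = Pi\<^sub>M (cells p n) M"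
    by (subst distr_cong[OF refl sets_noise refl])
  have "density (noise p n) (\<lambda>\<xi>. ennreal (tilt p n m \<xi>)) = Pi\<^sub>M (cells p n) M"
  proof (rule M.PiM_eqI)
    fix A assume A: "\<And>ij. ij \<in> cells p n \<Longrightarrow> A ij \<in> sets (M ij)"
    define h where "h = (\<lambda>ij x. ennreal (exp (m ij * x - (m ij)\<^sup>2 / 2)) * indicator (A ij) x)"
    have hm: "h ij \<in> borel_measurable std_normal" if "ij \<in> cells p n" for ij
      using A[OF that] unfolding h_def M_def by (intro borel_measurable_times_ennreal) simp_all
    have PA: "Pi\<^sub>E (cells p n) A \<in> sets (noise p n)"
      unfolding setsM[symmetric] using A by (intro sets_PiM_I_finite) auto
    have "emeasure (density (noise p n) (\<lambda>\<xi>. ennreal (tilt p n m \<xi>))) (Pi\<^sub>E (cells p n) A) =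
        (\<integral>\<^sup>+\<xi>. ennreal (tilt p n m \<xi>) * indicator (Pi\<^sub>E (cells p n) A) \<xi> \<partial>noise p n)"
      by (rule emeasure_density[OF _ PA]) measurable
    also have "\<dots> = (\<integral>\<^sup>+\<xi>. (\<Prod>ij\<in>cells p n. h ij (\<xi> ij)) \<partial>noise p n)"
    proof (rule nn_integral_cong)
      fix \<xi> assume "\<xi> \<in> space (noise p n)"
      then have ext: "\<xi> \<in> extensional (cells p n)" by (simp add: space_noise PiE_def)
      have "tilt p n m \<xi> = (\<Prod>ij\<in>cells p n. exp (m ij * \<xi> ij - (m ij)\<^sup>2 / 2))"
        by (simp only: tilt_def sum_divide_distrib sum_subtractf[symmetric]) (simp only: exp_sum finite_cartesian_product finite_lessThan)
      then have t: "ennreal (tilt p n m \<xi>) = (\<Prod>ij\<in>cells p n. ennreal (exp (m ij * \<xi> ij - (m ij)\<^sup>2 / 2)))"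
        by (simp only: prod_ennreal exp_ge_zero)
      have i: "indicator (Pi\<^sub>E (cells p n) A) \<xi> = (\<Prod>ij\<in>cells p n. indicator (A ij) (\<xi> ij) :: ennreal)"
      proof (cases "\<forall>ij\<in>cells p n. \<xi> ij \<in> A ij")
        case True
        then have "\<xi> \<in> Pi\<^sub>E (cells p n) A" using ext by (auto simp: PiE_def)
        moreover have "(\<Prod>ij\<in>cells p n. indicator (A ij) (\<xi> ij) :: ennreal) = 1"
          by (intro prod.neutral ballI) (simp only: True[rule_format] indicator_simps)
        ultimately show ?thesis by simp
      next
        case f: False
        then obtain ij where ij: "ij \<in> cells p n" "\<xi> ij \<notin> A ij" by blast
        have "(\<Prod>ij\<in>cells p n. indicator (A ij) (\<xi> ij) :: ennreal) = 0"
          by (rule prod_zero[OF _ bexI[OF _ ij(1)]]) (simp_all add: ij(2))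
        moreover have "\<xi> \<notin> Pi\<^sub>E (cells p n) A" using f by (auto simp: PiE_def)
        ultimately show ?thesis by simp
      qed
      show "ennreal (tilt p n m \<xi>) * indicator (Pi\<^sub>E (cells p n) A) \<xi> = (\<Prod>ij\<in>cells p n. h ij (\<xi> ij))"
        unfolding h_def t i by (rule prod.distrib[symmetric])
    qed
    also have "\<dots> = (\<Prod>ij\<in>cells p n. integral\<^sup>N std_normal (h ij))"
      unfolding noise_def by (rule S.product_nn_integral_prod) (simp, rule hm)
    also have "\<dots> = (\<Prod>ij\<in>cells p n. emeasure (M ij) (A ij))"
    proof (rule prod.cong[OF refl])
      fix ij assume ij: "ij \<in> cells p n"
      have Aij: "A ij \<in> sets borel" using A[OF ij] by (simp add: M_def)
      have "integral\<^sup>N std_normal (h ij) = (\<integral>\<^sup>+x. ennreal (std_normal_density x) * h ij x \<partial>lborel)"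
        using hm[OF ij] by (intro nn_integral_density) simp_all
      also have "\<dots> = (\<integral>\<^sup>+x. ennreal (normal_density (m ij) 1 x) * indicator (A ij) x \<partial>lborel)"
      proof (rule nn_integral_cong)
        fix x :: real
        have "- x\<^sup>2 / 2 + (m ij * x - (m ij)\<^sup>2 / 2) = - (x - m ij)\<^sup>2 / 2"
          by (simp add: power2_eq_square field_simps)
        then have "exp (- x\<^sup>2 / 2) * exp (m ij * x - (m ij)\<^sup>2 / 2) = exp (- (x - m ij)\<^sup>2 / 2)"
          by (simp flip: exp_add)
        then have "std_normal_density x * exp (m ij * x - (m ij)\<^sup>2 / 2) = normal_density (m ij) 1 x"
          by (simp add: normal_density_def)
        then show "ennreal (std_normal_density x) * h ij x = ennreal (normal_density (m ij) 1 x) * indicator (A ij) x"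
          by (simp add: h_def mult.assoc[symmetric] ennreal_mult[symmetric])
      qed
      also have "\<dots> = emeasure (M ij) (A ij)"
        unfolding M_def using Aij by (intro emeasure_density[symmetric]) simp_all
      finally show "integral\<^sup>N std_normal (h ij) = emeasure (M ij) (A ij)" .
    qed
    finally show "emeasure (density (noise p n) (\<lambda>\<xi>. ennreal (tilt p n m \<xi>))) (Pi\<^sub>E (cells p n) A) =
      (\<Prod>ij\<in>cells p n. emeasure (M ij) (A ij))" .
  qed (simp_all add: setsM)
  with 1 show ?thesis by (simp add: X_def)
qed

lemma integral_shifted_noise:
  fixes f :: "(nat \<times> nat \<Rightarrow> real) \<Rightarrow> real"
  assumes pn: "p > 0" "n > 0" and f: "f \<in> borel_measurable (noise p n)"
  shows "(\<integral>\<xi>. f (\<lambda>ij\<in>cells p n. \<xi> ij + m ij) \<partial>noise p n) = (\<integral>\<xi>. tilt p n m \<xi> * f \<xi> \<partial>noise p n)"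
proof -
  have sm: "(\<lambda>\<xi>. \<lambda>ij\<in>cells p n. \<xi> ij + m ij) \<in> noise p n \<rightarrow>\<^sub>M noise p n"
    by (subst measurable_cong_sets[OF refl sets_noise])
      (intro measurable_restrict borel_measurable_add borel_measurable_const measurable_noise_component)
  have "(\<integral>\<xi>. f (\<lambda>ij\<in>cells p n. \<xi> ij + m ij) \<partial>noise p n) =
      (\<integral>\<xi>. f \<xi> \<partial>distr (noise p n) (noise p n) (\<lambda>\<xi>. \<lambda>ij\<in>cells p n. \<xi> ij + m ij))"
    by (rule integral_distr[OF sm f, symmetric])
  also have "\<dots> = (\<integral>\<xi>. tilt p n m \<xi> * f \<xi> \<partial>noise p n)"
    unfolding distr_shifted_noise[OF pn]
    by (rule integral_real_density) (use f in \<open>auto simp: tilt_def[of p n m] intro: AE_I2\<close>)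
  finally show ?thesis .
qed

section \<open>Overlap of the likelihoods of one row\<close>

text \<open>Up to a common factor, \<open>cosh (x + y)\<close> and \<open>cosh (x - y)\<close> are the likelihoods of one row under two labels
  that differ in one coordinate. Their geometric mean does not separate \<open>x\<close> from \<open>y\<close>, but this lower
  bound for it does, up to a difference of two products. With \<open>X = (1 - 1 / c\<^sup>2) (1 - 1 / d\<^sup>2)\<close> the bound
  is \<open>c d (1 - X)\<close>, and the product of the two likelihoods is \<open>c\<^sup>2 d\<^sup>2 (1 - X)\<close>.\<close>

lemma cosh_geometric_bound:
  fixes x y :: real
  defines "c \<equiv> cosh x" and "d \<equiv> cosh y"
  shows "0 \<le> c * d - (c - 1 / c) * (d - 1 / d)"
    and "(c * d - (c - 1 / c) * (d - 1 / d))\<^sup>2 \<le> cosh (x + y) * cosh (x - y)"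
proof -
  have c: "c \<ge> 1" "d \<ge> 1" by (simp_all add: c_def d_def cosh_real_ge_1)
  define X where "X = (1 - 1 / c\<^sup>2) * (1 - 1 / d\<^sup>2)"
  have b: "0 \<le> 1 - 1 / c\<^sup>2" "1 - 1 / c\<^sup>2 \<le> 1" "0 \<le> 1 - 1 / d\<^sup>2" "1 - 1 / d\<^sup>2 \<le> 1"
    using c by (simp_all add: divide_le_eq one_le_power)
  have X: "0 \<le> X" "X \<le> 1" unfolding X_def using b by (auto intro: mult_le_one)
  have R: "c * d - (c - 1 / c) * (d - 1 / d) = c * d * (1 - X)"
    using c by (simp add: X_def field_simps power2_eq_square)
  show "0 \<le> c * d - (c - 1 / c) * (d - 1 / d)"
    unfolding R using c X by simp
  have "(c * d * (1 - X))\<^sup>2 = (c * d)\<^sup>2 * ((1 - X) * (1 - X))" by (simp add: power2_eq_square)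
  also have "\<dots> \<le> (c * d)\<^sup>2 * ((1 - X) * 1)"
    using X by (intro mult_left_mono) auto
  also have "\<dots> = c\<^sup>2 + d\<^sup>2 - 1"
    using c by (simp add: X_def field_simps power2_eq_square)
  also have "\<dots> = cosh (x + y) * cosh (x - y)"
  proof -
    have "cosh (x + y) * cosh (x - y) = c\<^sup>2 * d\<^sup>2 - (sinh x)\<^sup>2 * (sinh y)\<^sup>2"
      by (simp add: cosh_add cosh_diff c_def d_def power2_eq_square algebra_simps)
    also have "\<dots> = c\<^sup>2 + d\<^sup>2 - 1"
      by (simp add: sinh_square_eq c_def d_def algebra_simps)
    finally show ?thesis by simp
  qed
  finally show "(c * d - (c - 1 / c) * (d - 1 / d))\<^sup>2 \<le> cosh (x + y) * cosh (x - y)" unfolding R .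
qed

lemma borel_measurable_cosh [measurable]: "(cosh :: real \<Rightarrow> real) \<in> borel_measurable borel"
  by (intro borel_measurable_continuous_onI continuous_intros)

lemma noise_cosh_linear_form:
  fixes c :: "nat \<times> nat \<Rightarrow> real" and p n :: nat
  assumes J: "J \<subseteq> cells p n"
  defines "S \<equiv> \<lambda>\<xi>. \<Sum>ij\<in>J. c ij * \<xi> ij" and "C \<equiv> exp ((\<Sum>ij\<in>J. (c ij)\<^sup>2) / 2)"
  shows "integrable (noise p n) (\<lambda>\<xi>. cosh (S \<xi>))" "(\<integral>\<xi>. cosh (S \<xi>) \<partial>noise p n) = C"
    and "integrable (noise p n) (\<lambda>\<xi>. 1 / cosh (S \<xi>))"
    and "(\<integral>\<xi>. cosh (S \<xi>) - 1 / cosh (S \<xi>) \<partial>noise p n) \<le> C - 1 / C"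
    and "0 \<le> (\<integral>\<xi>. cosh (S \<xi>) - 1 / cosh (S \<xi>) \<partial>noise p n)"
proof -
  have pos: "integrable (noise p n) (\<lambda>\<xi>. exp (S \<xi>))" "(\<integral>\<xi>. exp (S \<xi>) \<partial>noise p n) = C"
    unfolding S_def C_def by (rule noise_exp_linear_form[OF J])+
  have S': "- S \<xi> = (\<Sum>ij\<in>J. - c ij * \<xi> ij)" for \<xi> by (simp add: S_def sum_negf)
  have neg: "integrable (noise p n) (\<lambda>\<xi>. exp (- S \<xi>))" "(\<integral>\<xi>. exp (- S \<xi>) \<partial>noise p n) = C"
    unfolding S' C_def using noise_exp_linear_form[OF J, of "\<lambda>ij. - c ij"] by simp_all
  have cosh: "cosh (S \<xi>) = (exp (S \<xi>) + exp (- S \<xi>)) / 2" for \<xi> by (simp add: cosh_field_def)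
  show I: "integrable (noise p n) (\<lambda>\<xi>. cosh (S \<xi>))" unfolding cosh using pos neg by simp
  show E: "(\<integral>\<xi>. cosh (S \<xi>) \<partial>noise p n) = C" unfolding cosh using pos neg by simp
  have ge1: "1 \<le> cosh (S \<xi>)" for \<xi> by (rule cosh_real_ge_1)
  have C: "C > 0" by (simp add: C_def)
  show I': "integrable (noise p n) (\<lambda>\<xi>. 1 / cosh (S \<xi>))"
  proof (rule noise.integrable_const_bound[where B = 1])
    have [measurable]: "(\<lambda>\<xi>. cosh (S \<xi>)) \<in> borel_measurable (noise p n)" using I by simp
    show "(\<lambda>\<xi>. 1 / cosh (S \<xi>)) \<in> borel_measurable (noise p n)" by measurable
    show "AE \<xi> in noise p n. norm (1 / cosh (S \<xi>)) \<le> 1" using ge1 by (intro AE_I2) (simp add: divide_le_eq)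
  qed
  \<comment> \<open>Jensen's inequality for \<open>1/x\<close>, by its tangent at the mean\<close>
  have "1 / C = (\<integral>\<xi>. 2 / C - cosh (S \<xi>) / C\<^sup>2 \<partial>noise p n)"
    using I E C by (simp add: noise.prob_space power2_eq_square)
  also have "\<dots> \<le> (\<integral>\<xi>. 1 / cosh (S \<xi>) \<partial>noise p n)"
  proof (rule integral_mono)
    show "integrable (noise p n) (\<lambda>\<xi>. 2 / C - cosh (S \<xi>) / C\<^sup>2)" using I by simp
    fix \<xi>
    have "0 \<le> (cosh (S \<xi>) - C)\<^sup>2 / (cosh (S \<xi>) * C\<^sup>2)" using ge1[of \<xi>] by simp
    also have "\<dots> = 1 / cosh (S \<xi>) - (2 / C - cosh (S \<xi>) / C\<^sup>2)"
      using ge1[of \<xi>] C by (simp add: field_simps power2_eq_square)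
    finally show "2 / C - cosh (S \<xi>) / C\<^sup>2 \<le> 1 / cosh (S \<xi>)" by simp
  qed (rule I')
  finally show "(\<integral>\<xi>. cosh (S \<xi>) - 1 / cosh (S \<xi>) \<partial>noise p n) \<le> C - 1 / C"
    using I I' E by simp
  have "1 / cosh (S \<xi>) \<le> cosh (S \<xi>)" for \<xi>
    using ge1[of \<xi>] mult_mono[of 1 "cosh (S \<xi>)" 1 "cosh (S \<xi>)"] by (simp add: divide_le_eq)
  then show "0 \<le> (\<integral>\<xi>. cosh (S \<xi>) - 1 / cosh (S \<xi>) \<partial>noise p n)"
    by (intro integral_nonneg_AE AE_I2) simp
qed

text \<open>A lower bound for the Bhattacharyya affinity of one row under two labels that differ in one
  coordinate, where \<open>b\<close> is the squared signal-to-noise ratio of one row.\<close>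

definition row_overlap :: "real \<Rightarrow> nat \<Rightarrow> real" where
  "row_overlap b n = 1 - (1 - exp (- b)) * (1 - exp (- (b * (real n - 1))))"

text \<open>The bound for the geometric mean of two likelihoods, at the part \<open>s\<close> of the correlation of row \<open>i\<close> with
  the label that does not involve coordinate \<open>j\<close> and the part \<open>t\<close> that does.\<close>

definition affinity_row :: "real \<Rightarrow> nat \<Rightarrow> (nat \<Rightarrow> real) \<Rightarrow> nat \<Rightarrow> (nat \<times> nat \<Rightarrow> real) \<Rightarrow> nat \<Rightarrow> real" where
  "affinity_row a n e j \<xi> i =
     (let c = cosh (\<Sum>k\<in>{..<n} - {j}. a * e k * \<xi> (i, k)); d = cosh (a * e j * \<xi> (i, j))
      in exp (- (real n * a\<^sup>2 / 2)) * (c * d - (c - 1 / c) * (d - 1 / d)))"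

text \<open>The two parts of the row read disjoint cells, so expectations of products factorize.\<close>

lemma affinity_row_integral:
  assumes i: "i < p" and j: "j < n" and e: "\<And>k. k < n \<Longrightarrow> e k = 1 \<or> e k = -1"
  shows "integrable (noise p n) (\<lambda>\<xi>. affinity_row a n e j \<xi> i)"
    and "row_overlap (a\<^sup>2) n \<le> (\<integral>\<xi>. affinity_row a n e j \<xi> i \<partial>noise p n)"
proof -
  define J where "J = {i} \<times> ({..<n} - {j})"
  have J: "J \<subseteq> cells p n" "{(i, j)} \<subseteq> cells p n" "J \<inter> {(i, j)} = {}" using i j by (auto simp: J_def)
  define w where "w = (\<lambda>ij::nat \<times> nat. a * e (snd ij))"
  define c where "c = (\<lambda>\<xi>. cosh (\<Sum>ij\<in>J. w ij * \<xi> ij))"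
  define d where "d = (\<lambda>\<xi>. cosh (\<Sum>ij\<in>{(i, j)}. w ij * \<xi> ij))"
  define C where "C = exp ((\<Sum>ij\<in>J. (w ij)\<^sup>2) / 2)"
  define D where "D = exp ((\<Sum>ij\<in>{(i, j)}. (w ij)\<^sup>2) / 2)"
  have sq: "(a * e k)\<^sup>2 = a\<^sup>2" if "k < n" for k using e[OF that] by (auto simp: power_mult_distrib)
  have CD: "C = exp ((real n - 1) * a\<^sup>2 / 2)" "D = exp (a\<^sup>2 / 2)"
  proof -
    have "(\<Sum>ij\<in>J. (w ij)\<^sup>2) = (\<Sum>ij\<in>J. a\<^sup>2)"
      by (intro sum.cong) (auto simp: w_def J_def sq)
    also have "\<dots> = (real n - 1) * a\<^sup>2" using j by (simp add: J_def card_cartesian_product of_nat_diff)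
    finally show "C = exp ((real n - 1) * a\<^sup>2 / 2)" by (simp add: C_def)
    show "D = exp (a\<^sup>2 / 2)" using sq[OF j] by (simp add: D_def w_def)
  qed
  have cm: "(\<Sum>k\<in>{..<n} - {j}. a * e k * \<xi> (i, k)) = (\<Sum>ij\<in>J. w ij * \<xi> ij)" for \<xi>
    using sum.cartesian_product[of "\<lambda>i k. a * e k * \<xi> (i, k)" "{..<n} - {j}" "{i}"]
    by (simp add: case_prod_unfold J_def w_def)
  have row: "affinity_row a n e j \<xi> i =
      exp (- (real n * a\<^sup>2 / 2)) * (c \<xi> * d \<xi> - (c \<xi> - 1 / c \<xi>) * (d \<xi> - 1 / d \<xi>))" for \<xi>
    unfolding affinity_row_def Let_def cm c_def d_def by (simp add: w_def)
  have cosh_eq: "cosh (\<Sum>ij\<in>J. w ij * \<xi> ij) = c \<xi>" "cosh (\<Sum>ij\<in>{(i, j)}. w ij * \<xi> ij) = d \<xi>" for \<xi>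
    unfolding c_def d_def by (rule refl)+
  note Ic = noise_cosh_linear_form[OF J(1), of w, unfolded cosh_eq, folded C_def]
  note Id = noise_cosh_linear_form[OF J(2), of w, unfolded cosh_eq, folded D_def]
  have indep: "noise.indep_vars p n (\<lambda>_. borel) (\<lambda>t \<xi>. if t then f (\<Sum>ij\<in>J. w ij * \<xi> ij) else f (\<Sum>ij\<in>{(i, j)}. w ij * \<xi> ij)) (UNIV :: bool set)"
    if [measurable]: "f \<in> borel_measurable borel" for f :: "real \<Rightarrow> real"
  proof (rule noise_blocks_indep[where K = "\<lambda>t. if t then J else {(i, j)}"
        and f = "\<lambda>t \<xi>. f (\<Sum>ij\<in>(if t then J else {(i, j)}). w ij * \<xi> ij)"])
    fix t :: bool
    let ?K = "if t then J else {(i, j)}"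
    let ?M = "\<Pi>\<^sub>M ij\<in>?K. (borel :: real measure)"
    have [measurable]: "(\<lambda>\<xi>. \<xi> ij) \<in> borel_measurable ?M" if "ij \<in> ?K" for ij
      using that by (rule measurable_component_singleton)
    have "(\<lambda>\<xi>. \<Sum>ij\<in>?K. w ij * \<xi> ij) \<in> borel_measurable ?M"
      by (intro borel_measurable_sum borel_measurable_times borel_measurable_const) measurable
    then show "(\<lambda>\<xi>. f (\<Sum>ij\<in>?K. w ij * \<xi> ij)) \<in> borel_measurable ?M"
      by measurable
  qed (use J in \<open>auto simp: disjoint_family_on_def\<close>)
  have prod2: "(\<Prod>t\<in>UNIV. if t then x else y) = x * y" for x y :: real
    by (simp add: UNIV_bool)
  have cd: "integrable (noise p n) (\<lambda>\<xi>. c \<xi> * d \<xi>)" "(\<integral>\<xi>. c \<xi> * d \<xi> \<partial>noise p n) = C * D"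
  proof -
    have ind: "noise.indep_vars p n (\<lambda>_. borel) (\<lambda>t \<xi>. if t then c \<xi> else d \<xi>) (UNIV :: bool set)"
      unfolding c_def d_def by (rule indep) measurable
    have int: "integrable (noise p n) (\<lambda>\<xi>. if t then c \<xi> else d \<xi>)" for t
      using Ic(1) Id(1) by (cases t) simp_all
    show "integrable (noise p n) (\<lambda>\<xi>. c \<xi> * d \<xi>)"
      using noise.indep_vars_integrable[OF finite ind int] by (simp only: prod2)
    have "(\<integral>\<xi>. c \<xi> * d \<xi> \<partial>noise p n) = (\<Prod>t\<in>UNIV. \<integral>\<xi>. (if t then c \<xi> else d \<xi>) \<partial>noise p n)"
      using noise.indep_vars_lebesgue_integral[OF finite ind int] by (simp only: prod2)
    then show "(\<integral>\<xi>. c \<xi> * d \<xi> \<partial>noise p n) = C * D" using Ic(2) Id(2) by (simp add: UNIV_bool)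
  qed
  have cd': "integrable (noise p n) (\<lambda>\<xi>. (c \<xi> - 1 / c \<xi>) * (d \<xi> - 1 / d \<xi>))"
    "(\<integral>\<xi>. (c \<xi> - 1 / c \<xi>) * (d \<xi> - 1 / d \<xi>) \<partial>noise p n) \<le> (C - 1 / C) * (D - 1 / D)"
  proof -
    have "noise.indep_vars p n (\<lambda>_. borel) (\<lambda>t \<xi>. if t then (\<lambda>x. cosh x - 1 / cosh x) (\<Sum>ij\<in>J. w ij * \<xi> ij)
        else (\<lambda>x. cosh x - 1 / cosh x) (\<Sum>ij\<in>{(i, j)}. w ij * \<xi> ij)) (UNIV :: bool set)"
      by (rule indep) measurable
    then have ind: "noise.indep_vars p n (\<lambda>_. borel) (\<lambda>t \<xi>. if t then c \<xi> - 1 / c \<xi> else d \<xi> - 1 / d \<xi>) (UNIV :: bool set)"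
      unfolding c_def d_def .
    have int: "integrable (noise p n) (\<lambda>\<xi>. if t then c \<xi> - 1 / c \<xi> else d \<xi> - 1 / d \<xi>)" for t
      using Ic(1,3) Id(1,3) by (cases t) simp_all
    show "integrable (noise p n) (\<lambda>\<xi>. (c \<xi> - 1 / c \<xi>) * (d \<xi> - 1 / d \<xi>))"
      using noise.indep_vars_integrable[OF finite ind int] by (simp only: prod2)
    have "(\<integral>\<xi>. (c \<xi> - 1 / c \<xi>) * (d \<xi> - 1 / d \<xi>) \<partial>noise p n) = (\<Prod>t\<in>UNIV. \<integral>\<xi>. (if t then c \<xi> - 1 / c \<xi> else d \<xi> - 1 / d \<xi>) \<partial>noise p n)"
      using noise.indep_vars_lebesgue_integral[OF finite ind int] by (simp only: prod2)
    also have "\<dots> = (\<integral>\<xi>. c \<xi> - 1 / c \<xi> \<partial>noise p n) * (\<integral>\<xi>. d \<xi> - 1 / d \<xi> \<partial>noise p n)" by (simp add: UNIV_bool)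
    also have "\<dots> \<le> (C - 1 / C) * (D - 1 / D)"
      using Ic(4,5) Id(4,5) by (intro mult_mono) linarith+
    finally show "(\<integral>\<xi>. (c \<xi> - 1 / c \<xi>) * (d \<xi> - 1 / d \<xi>) \<partial>noise p n) \<le> (C - 1 / C) * (D - 1 / D)" .
  qed
  show "integrable (noise p n) (\<lambda>\<xi>. affinity_row a n e j \<xi> i)"
    unfolding row using cd(1) cd'(1) by simp
  have N: "exp (- (real n * a\<^sup>2 / 2)) * (C * D) = 1"
    unfolding CD exp_add[symmetric] by (simp add: field_simps)
  have C0: "C > 0" "D > 0" by (simp_all add: CD)
  have "C * C = exp (a\<^sup>2 * (real n - 1))" "D * D = exp (a\<^sup>2)"
    unfolding CD exp_add[symmetric] by (simp_all add: field_simps)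
  then have inv: "exp (- (a\<^sup>2 * (real n - 1))) = 1 / (C * C)" "exp (- a\<^sup>2) = 1 / (D * D)"
    by (simp_all add: exp_minus inverse_eq_divide)
  have "row_overlap (a\<^sup>2) n = exp (- (real n * a\<^sup>2 / 2)) * (C * D) * (1 - (1 - 1 / (C * C)) * (1 - 1 / (D * D)))"
    unfolding row_overlap_def N inv by simp
  also have "\<dots> = exp (- (real n * a\<^sup>2 / 2)) * (C * D - (C - 1 / C) * (D - 1 / D))"
    using C0 by (simp add: field_simps)
  also have "\<dots> \<le> exp (- (real n * a\<^sup>2 / 2)) * ((\<integral>\<xi>. c \<xi> * d \<xi> \<partial>noise p n) - (\<integral>\<xi>. (c \<xi> - 1 / c \<xi>) * (d \<xi> - 1 / d \<xi>) \<partial>noise p n))"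
    using cd(2) cd'(2) by (intro mult_left_mono) auto
  also have "\<dots> = (\<integral>\<xi>. affinity_row a n e j \<xi> i \<partial>noise p n)"
    unfolding row using cd(1) cd'(1) by simp
  finally show "row_overlap (a\<^sup>2) n \<le> (\<integral>\<xi>. affinity_row a n e j \<xi> i \<partial>noise p n)" .
qed

section \<open>Likelihood ratios averaged over random signals\<close>

definition sign_patterns :: "nat \<Rightarrow> (nat \<Rightarrow> real) set" where
  "sign_patterns p = {..<p} \<rightarrow>\<^sub>E {-1, 1}"

lemma sign_patternsD: "\<epsilon> \<in> sign_patterns p \<Longrightarrow> i < p \<Longrightarrow> \<epsilon> i \<in> {-1, 1}"
  by (auto simp: sign_patterns_def dest: PiE_mem)

lemma finite_sign_patterns: "finite (sign_patterns p)"
  unfolding sign_patterns_def by (intro finite_PiE) simp_all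

lemma card_sign_patterns: "card (sign_patterns p) = 2 ^ p"
  by (simp add: sign_patterns_def card_PiE numeral_2_eq_2)

text \<open>The likelihood of the label \<open>e\<close>, averaged over the signs of the signal.\<close>

definition mixture :: "nat \<Rightarrow> nat \<Rightarrow> real \<Rightarrow> (nat \<Rightarrow> real) \<Rightarrow> (nat \<times> nat \<Rightarrow> real) \<Rightarrow> real" where
  "mixture p n a e \<xi> = (\<Sum>\<epsilon>\<in>sign_patterns p. tilt p n (\<lambda>(i, k). a * \<epsilon> i * e k) \<xi>) / 2 ^ p"

text \<open>Every row has its own sign, so the average factorizes, and averaging an exponential over a sign gives
  a hyperbolic cosine.\<close>

lemma mixture_eq_prod_cosh:
  assumes e: "\<And>k. k < n \<Longrightarrow> e k = 1 \<or> e k = -1"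
  shows "mixture p n a e \<xi> = (\<Prod>i<p. exp (- (real n * a\<^sup>2 / 2)) * cosh (a * row_form n e \<xi> i))"
proof -
  define g where "g = (\<lambda>i s. exp (s * (a * row_form n e \<xi> i) - real n * a\<^sup>2 / 2))"
  have t: "tilt p n (\<lambda>(i, k). a * \<epsilon> i * e k) \<xi> = (\<Prod>i<p. g i (\<epsilon> i))" if \<epsilon>: "\<epsilon> \<in> sign_patterns p" for \<epsilon>
  proof -
    have "(\<Sum>ij\<in>cells p n. (case ij of (i, k) \<Rightarrow> a * \<epsilon> i * e k) * \<xi> ij) = (\<Sum>i<p. \<epsilon> i * (a * row_form n e \<xi> i))"
    proof -
      have "(\<Sum>ij\<in>cells p n. (case ij of (i, k) \<Rightarrow> a * \<epsilon> i * e k) * \<xi> ij) = (\<Sum>i<p. \<Sum>k<n. a * \<epsilon> i * e k * \<xi> (i, k))"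
        by (simp add: sum.cartesian_product case_prod_unfold)
      then show ?thesis by (simp add: row_form_def sum_distrib_left mult_ac)
    qed
    moreover have "(\<Sum>ij\<in>cells p n. (case ij of (i, k) \<Rightarrow> a * \<epsilon> i * e k)\<^sup>2) / 2 = (\<Sum>i<p. real n * a\<^sup>2 / 2)"
    proof -
      have "(\<Sum>ij\<in>cells p n. (case ij of (i, k) \<Rightarrow> a * \<epsilon> i * e k)\<^sup>2) = (\<Sum>ij\<in>cells p n. a\<^sup>2)"
      proof (intro sum.cong refl, clarsimp)
        fix i k assume "i < p" "k < n"
        then show "(a * \<epsilon> i * e k)\<^sup>2 = a\<^sup>2"
          using sign_patternsD[OF \<epsilon>, of i] e[of k] by (auto simp: power_mult_distrib)
      qed
      then show ?thesis by (simp add: card_cartesian_product)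
    qed
    ultimately have "tilt p n (\<lambda>(i, k). a * \<epsilon> i * e k) \<xi> = exp (\<Sum>i<p. \<epsilon> i * (a * row_form n e \<xi> i) - real n * a\<^sup>2 / 2)"
      unfolding tilt_def by (simp only: sum_subtractf)
    then show ?thesis by (simp add: g_def exp_sum)
  qed
  have "mixture p n a e \<xi> = (\<Sum>\<epsilon>\<in>sign_patterns p. \<Prod>i<p. g i (\<epsilon> i)) / 2 ^ p"
    unfolding mixture_def by (simp add: t cong: sum.cong)
  also have "\<dots> = (\<Prod>i<p. \<Sum>s\<in>{-1, 1}. g i s) / 2 ^ p"
    unfolding sign_patterns_def by (subst prod_sum_PiE) auto
  also have "\<dots> = (\<Prod>i<p. (\<Sum>s\<in>{-1, 1}. g i s) / 2)"
    by (simp add: prod_dividef)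
  also have "\<dots> = (\<Prod>i<p. exp (- (real n * a\<^sup>2 / 2)) * cosh (a * row_form n e \<xi> i))"
  proof (intro prod.cong refl)
    fix i
    have g: "g i s = exp (- (real n * a\<^sup>2 / 2)) * exp (s * (a * row_form n e \<xi> i))" for s
      by (simp add: g_def flip: exp_add)
    show "(\<Sum>s\<in>{-1, 1}. g i s) / 2 = exp (- (real n * a\<^sup>2 / 2)) * cosh (a * row_form n e \<xi> i)"
      unfolding g by (simp add: cosh_field_def algebra_simps)
  qed
  finally show ?thesis .
qed

lemma mixture_integrable: "integrable (noise p n) (mixture p n a e)"
  unfolding mixture_def[abs_def] by (intro integrable_divide Bochner_Integration.integrable_sum tilt_integral)

lemma mixture_integral: "(\<integral>\<xi>. mixture p n a e \<xi> \<partial>noise p n) = 1"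
  unfolding mixture_def
  by (simp add: Bochner_Integration.integral_sum tilt_integral card_sign_patterns)

lemma mixture_nonneg: "0 \<le> mixture p n a e \<xi>"
  unfolding mixture_def tilt_def by (intro divide_nonneg_nonneg sum_nonneg) simp_all

lemma integrable_mixture_times:
  assumes [measurable]: "f \<in> borel_measurable (noise p n)" and f: "\<And>\<xi>. 0 \<le> f \<xi> \<and> f \<xi> \<le> (1::real)"
  shows "integrable (noise p n) (\<lambda>\<xi>. mixture p n a e \<xi> * f \<xi>)"
proof (rule Bochner_Integration.integrable_bound[OF mixture_integrable[of p n a e]])
  show "AE \<xi> in noise p n. norm (mixture p n a e \<xi> * f \<xi>) \<le> norm (mixture p n a e \<xi>)"
    using f mixture_nonneg[of p n a e] by (intro AE_I2) (simp add: abs_mult mult_left_le)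
  have [measurable]: "mixture p n a e \<in> borel_measurable (noise p n)" using mixture_integrable by blast
  show "(\<lambda>\<xi>. mixture p n a e \<xi> * f \<xi>) \<in> borel_measurable (noise p n)" by measurable
qed

definition flip :: "nat \<Rightarrow> (nat \<Rightarrow> real) \<Rightarrow> nat \<Rightarrow> real" where
  "flip j e = e(j := - e j)"

lemma row_overlap_nonneg: "0 \<le> b \<Longrightarrow> 1 \<le> n \<Longrightarrow> 0 \<le> row_overlap b n"
  unfolding row_overlap_def diff_ge_0_iff_ge by (intro mult_le_one) simp_all

text \<open>The rows are independent, so the overlap of the two mixtures is a power of the overlap of one row.\<close>

lemma mixture_affinity:
  fixes p n j :: nat and a :: real and e :: "nat \<Rightarrow> real"
  assumes e: "\<And>k. k < n \<Longrightarrow> e k = 1 \<or> e k = -1" and j: "j < n"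
  defines "R \<equiv> \<lambda>\<xi>. \<Prod>i<p. affinity_row a n e j \<xi> i"
  shows "0 \<le> R \<xi>" "(R \<xi>)\<^sup>2 \<le> mixture p n a e \<xi> * mixture p n a (flip j e) \<xi>"
    and "integrable (noise p n) R" and "row_overlap (a\<^sup>2) n ^ p \<le> (\<integral>\<xi>. R \<xi> \<partial>noise p n)"
proof -
  define N where "N = exp (- (real n * a\<^sup>2 / 2))"
  have N: "N > 0" by (simp add: N_def)
  define s where "s = (\<lambda>i \<xi>. \<Sum>k\<in>{..<n} - {j}. a * e k * \<xi> (i::nat, k))"
  define t where "t = (\<lambda>i \<xi>. a * e j * \<xi> (i::nat, j))"
  have row: "affinity_row a n e j \<xi> i = N * (cosh (s i \<xi>) * cosh (t i \<xi>)
      - (cosh (s i \<xi>) - 1 / cosh (s i \<xi>)) * (cosh (t i \<xi>) - 1 / cosh (t i \<xi>)))" for \<xi> i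
    by (simp add: affinity_row_def Let_def N_def s_def t_def)
  have pos: "0 \<le> affinity_row a n e j \<xi> i" for \<xi> i
    unfolding row using N cosh_geometric_bound(1) by (intro mult_nonneg_nonneg) simp_all
  show "0 \<le> R \<xi>" unfolding R_def using pos by (intro prod_nonneg) simp
  have f: "flip j e k = 1 \<or> flip j e k = -1" if "k < n" for k using e[OF that] by (auto simp: flip_def)
  have r1: "a * row_form n e \<xi> i = s i \<xi> + t i \<xi>" for i
  proof -
    have "a * row_form n e \<xi> i = (\<Sum>k<n. a * e k * \<xi> (i, k))" by (simp add: row_form_def sum_distrib_left mult.assoc)
    then show ?thesis using j by (simp add: s_def t_def sum.remove[of "{..<n}" j])
  qed
  have r2: "a * row_form n (flip j e) \<xi> i = s i \<xi> - t i \<xi>" for i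
  proof -
    have "a * row_form n (flip j e) \<xi> i = (\<Sum>k<n. a * flip j e k * \<xi> (i, k))" by (simp add: row_form_def sum_distrib_left mult.assoc)
    also have "\<dots> = a * flip j e j * \<xi> (i, j) + (\<Sum>k\<in>{..<n} - {j}. a * flip j e k * \<xi> (i, k))"
      using j by (intro sum.remove) auto
    also have "(\<Sum>k\<in>{..<n} - {j}. a * flip j e k * \<xi> (i, k)) = s i \<xi>"
      unfolding s_def by (intro sum.cong) (auto simp: flip_def)
    also have "flip j e j = - e j" by (simp add: flip_def)
    finally show ?thesis by (simp add: t_def)
  qed
  have "(R \<xi>)\<^sup>2 = (\<Prod>i<p. (affinity_row a n e j \<xi> i)\<^sup>2)" by (simp add: R_def prod_power_distrib)
  also have "\<dots> \<le> (\<Prod>i<p. (N * cosh (s i \<xi> + t i \<xi>)) * (N * cosh (s i \<xi> - t i \<xi>)))"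
  proof (intro prod_mono conjI)
    fix i
    have "(affinity_row a n e j \<xi> i)\<^sup>2 \<le> N\<^sup>2 * (cosh (s i \<xi> + t i \<xi>) * cosh (s i \<xi> - t i \<xi>))"
      unfolding row power_mult_distrib by (intro mult_left_mono cosh_geometric_bound(2)) simp
    then show "(affinity_row a n e j \<xi> i)\<^sup>2 \<le> (N * cosh (s i \<xi> + t i \<xi>)) * (N * cosh (s i \<xi> - t i \<xi>))"
      by (simp add: power2_eq_square mult_ac)
  qed simp
  also have "\<dots> = mixture p n a e \<xi> * mixture p n a (flip j e) \<xi>"
  proof -
    have "mixture p n a e \<xi> = (\<Prod>i<p. N * cosh (s i \<xi> + t i \<xi>))"
      by (subst mixture_eq_prod_cosh) (use e r1 in \<open>auto simp: N_def\<close>)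
    moreover have "mixture p n a (flip j e) \<xi> = (\<Prod>i<p. N * cosh (s i \<xi> - t i \<xi>))"
      by (subst mixture_eq_prod_cosh) (use f r2 in \<open>auto simp: N_def\<close>)
    ultimately show ?thesis by (simp only: prod.distrib)
  qed
  finally show "(R \<xi>)\<^sup>2 \<le> mixture p n a e \<xi> * mixture p n a (flip j e) \<xi>" .
  have ind: "noise.indep_vars p n (\<lambda>_. borel) (\<lambda>i \<xi>. affinity_row a n e j \<xi> i) {..<p}"
  proof (rule noise_blocks_indep[where K = "\<lambda>i. {i} \<times> {..<n}" and f = "\<lambda>i \<xi>. affinity_row a n e j \<xi> i"])
    fix i :: nat
    let ?M = "\<Pi>\<^sub>M ij\<in>{i} \<times> {..<n}. (borel :: real measure)"
    have c: "(\<lambda>y. y (i, k)) \<in> borel_measurable ?M" if "k < n" for k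
      using that by (intro measurable_component_singleton) auto
    have [measurable]: "s i \<in> borel_measurable ?M" "t i \<in> borel_measurable ?M"
      unfolding s_def t_def
      by (intro borel_measurable_sum borel_measurable_times borel_measurable_const c, use j in simp)+
    show "(\<lambda>\<xi>. affinity_row a n e j \<xi> i) \<in> borel_measurable ?M"
      unfolding row by measurable
    show "affinity_row a n e j \<xi> i = affinity_row a n e j (restrict \<xi> ({i} \<times> {..<n})) i" for \<xi>
    proof -
      have "(\<Sum>k\<in>{..<n} - {j}. a * e k * restrict \<xi> ({i} \<times> {..<n}) (i, k)) = (\<Sum>k\<in>{..<n} - {j}. a * e k * \<xi> (i, k))"
        by (intro sum.cong) auto
      then show ?thesis using j by (simp add: affinity_row_def)
    qed
  qed (auto simp: disjoint_family_on_def)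
  show "integrable (noise p n) R"
    unfolding R_def by (rule noise.indep_vars_integrable[OF _ ind]) (use affinity_row_integral(1)[OF _ j e] in auto)
  have "row_overlap (a\<^sup>2) n ^ p = (\<Prod>i<p. row_overlap (a\<^sup>2) n)" by simp
  also have "\<dots> \<le> (\<Prod>i<p. \<integral>\<xi>. affinity_row a n e j \<xi> i \<partial>noise p n)"
  proof (intro prod_mono conjI)
    fix i assume "i \<in> {..<p}"
    then show "row_overlap (a\<^sup>2) n \<le> (\<integral>\<xi>. affinity_row a n e j \<xi> i \<partial>noise p n)"
      using affinity_row_integral(2)[OF _ j e] by simp
    show "0 \<le> row_overlap (a\<^sup>2) n" using j by (intro row_overlap_nonneg) auto
  qed
  also have "\<dots> = (\<integral>\<xi>. R \<xi> \<partial>noise p n)"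
    unfolding R_def by (rule noise.indep_vars_lebesgue_integral[OF _ ind, symmetric]) (use affinity_row_integral(1)[OF _ j e] in auto)
  finally show "row_overlap (a\<^sup>2) n ^ p \<le> (\<integral>\<xi>. R \<xi> \<partial>noise p n)" .
qed

text \<open>A tangent to the bound of \<open>min l l'\<close> by the geometric mean: it is linear in \<open>r\<close>, \<open>l\<close> and \<open>l'\<close>, so it can
  be integrated directly.\<close>

lemma two_point_pointwise:
  fixes l l' r t f :: real
  assumes "0 \<le> l" "0 \<le> l'" "0 \<le> r" "r\<^sup>2 \<le> l * l'" "0 \<le> t" "0 \<le> f" "f \<le> 1"
  shows "2 * t * r - t\<^sup>2 * (l + l') \<le> l * f + l' * (1 - f)"
proof -
  have aux: "2 * t * r \<le> x + t\<^sup>2 * y" if "0 \<le> x" "0 \<le> y" "r\<^sup>2 \<le> x * y" for x y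
  proof (rule power2_le_imp_le)
    have "(2 * t * r)\<^sup>2 = 4 * t\<^sup>2 * r\<^sup>2" by (simp add: power_mult_distrib)
    also have "\<dots> \<le> 4 * t\<^sup>2 * (x * y)" using that by (intro mult_left_mono) auto
    also have "\<dots> \<le> (x + t\<^sup>2 * y)\<^sup>2"
      using zero_le_power2[of "x - t\<^sup>2 * y"] by (simp add: power2_eq_square algebra_simps)
    finally show "(2 * t * r)\<^sup>2 \<le> (x + t\<^sup>2 * y)\<^sup>2" .
  qed (use that in simp)
  have t0: "0 \<le> t\<^sup>2 * l" "0 \<le> t\<^sup>2 * l'" using assms by auto
  have dist: "t\<^sup>2 * (l + l') = t\<^sup>2 * l + t\<^sup>2 * l'" by (rule distrib_left)
  have m1: "2 * t * r - t\<^sup>2 * (l + l') \<le> l"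
    using aux[OF assms(1,2,4)] t0 dist by linarith
  have m2: "2 * t * r - t\<^sup>2 * (l + l') \<le> l'"
    using aux[OF assms(2,1)] assms(4) t0 dist by (simp add: mult.commute[of l' l])
  define m where "m = 2 * t * r - t\<^sup>2 * (l + l')"
  have "m * f + m * (1 - f) \<le> l * f + l' * (1 - f)"
    using m1 m2 assms by (intro add_mono mult_right_mono) (auto simp: m_def)
  then show ?thesis by (simp add: m_def algebra_simps)
qed

text \<open>The right side is the sum of the two error probabilities of a test \<open>f\<close> between \<open>e\<close> and its flip. With the
  optimal \<open>t = A / 2\<close> the pointwise bound integrates to \<open>A\<^sup>2 / 2\<close>.\<close>

lemma two_point_bound:
  assumes e: "\<And>k. k < n \<Longrightarrow> e k = 1 \<or> e k = -1" and j: "j < n"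
    and fm: "f \<in> borel_measurable (noise p n)" and f: "\<And>\<xi>. 0 \<le> f \<xi> \<and> f \<xi> \<le> (1::real)"
  shows "(row_overlap (a\<^sup>2) n ^ p)\<^sup>2 / 2 \<le>
    (\<integral>\<xi>. mixture p n a e \<xi> * f \<xi> \<partial>noise p n) + (\<integral>\<xi>. mixture p n a (flip j e) \<xi> * (1 - f \<xi>) \<partial>noise p n)"
proof -
  define R where "R = (\<lambda>\<xi>. \<Prod>i<p. affinity_row a n e j \<xi> i)"
  define A where "A = row_overlap (a\<^sup>2) n ^ p"
  define t where "t = A / 2"
  have R: "0 \<le> R \<xi>" "(R \<xi>)\<^sup>2 \<le> mixture p n a e \<xi> * mixture p n a (flip j e) \<xi>"
    "integrable (noise p n) R" "A \<le> (\<integral>\<xi>. R \<xi> \<partial>noise p n)" for \<xi>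
    unfolding R_def A_def by (rule mixture_affinity[OF e j]; simp)+
  have A0: "A \<ge> 0" using j by (simp add: A_def row_overlap_nonneg)
  have I1: "integrable (noise p n) (\<lambda>\<xi>. mixture p n a e \<xi> * f \<xi>)"
    by (rule integrable_mixture_times[OF fm f])
  have I2: "integrable (noise p n) (\<lambda>\<xi>. mixture p n a (flip j e) \<xi> * (1 - f \<xi>))"
    using fm f by (intro integrable_mixture_times) (auto intro: borel_measurable_diff)
  have "A\<^sup>2 / 2 = 2 * t * A - t\<^sup>2 * 2" by (simp add: t_def power2_eq_square)
  also have "\<dots> \<le> 2 * t * (\<integral>\<xi>. R \<xi> \<partial>noise p n) - t\<^sup>2 * 2"
    using R(4) A0 by (simp add: t_def mult_left_mono)
  also have "\<dots> = (\<integral>\<xi>. 2 * t * R \<xi> - t\<^sup>2 * (mixture p n a e \<xi> + mixture p n a (flip j e) \<xi>) \<partial>noise p n)"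
    using R(3) by (simp add: mixture_integrable mixture_integral)
  also have "\<dots> \<le> (\<integral>\<xi>. mixture p n a e \<xi> * f \<xi> + mixture p n a (flip j e) \<xi> * (1 - f \<xi>) \<partial>noise p n)"
    using R(1,2) R(3) A0 I1 I2 f
    by (intro integral_mono Bochner_Integration.integrable_add Bochner_Integration.integrable_diff integrable_mult_right
        two_point_pointwise mixture_nonneg mixture_integrable) (auto simp: t_def)
  also have "\<dots> = (\<integral>\<xi>. mixture p n a e \<xi> * f \<xi> \<partial>noise p n) + (\<integral>\<xi>. mixture p n a (flip j e) \<xi> * (1 - f \<xi>) \<partial>noise p n)"
    using I1 I2 by simp
  finally show ?thesis by (simp add: A_def)
qed

section \<open>Lower bound on the risk of every estimator\<close>

definition flip_label :: "nat \<Rightarrow> real Matrix.vec \<Rightarrow> real Matrix.vec" where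
  "flip_label j \<eta> = Matrix.vec (dim_vec \<eta>) (\<lambda>k. if k = j then - (\<eta> $ k) else \<eta> $ k)"

lemma flip_label_labels:
  assumes "\<eta> \<in> labels n" shows "flip_label j \<eta> \<in> labels n"
proof -
  have "flip_label j \<eta> $ k \<in> {-1, 1}" if "k < n" for k
    using labels_coords[OF assms that] that assms
    by (cases "k = j") (auto simp: flip_label_def coords_def labels_def)
  then show ?thesis using assms by (simp add: labels_def) (simp add: flip_label_def)
qed

lemma flip_label_involution: "flip_label j (flip_label j \<eta>) = \<eta>"
  by (auto simp: flip_label_def intro!: eq_vecI)

lemma sum_flip_label: "(\<Sum>\<eta>\<in>labels n. f (flip_label j \<eta>)) = (\<Sum>\<eta>\<in>labels n. f \<eta>)"
  by (rule sum.reindex_bij_witness[of _ "flip_label j" "flip_label j"])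
    (auto simp: flip_label_labels flip_label_involution)

text \<open>Products of two labels do not see a global change of sign, unlike the labels themselves.\<close>

definition pair_error :: "nat \<Rightarrow> nat \<Rightarrow> real Matrix.vec \<Rightarrow> real Matrix.vec \<Rightarrow> real" where
  "pair_error i j a b = (if a $ i * a $ j = b $ i * b $ j then 0 else 1)"

lemma pair_error_range: "0 \<le> pair_error i j a b \<and> pair_error i j a b \<le> 1"
  by (simp add: pair_error_def)

text \<open>The bound \<open>n - |x| \<ge> (n\<^sup>2 - x\<^sup>2) / (2 n)\<close> removes the minimum over the global sign, and
  \<open>n\<^sup>2 - x\<^sup>2\<close> expands into a sum over pairs.\<close>

lemma loss_ge_pair_errors:
  assumes a: "a \<in> labels n" and b: "b \<in> labels n" and n: "n > 0"
  shows "(\<Sum>i<n. \<Sum>j\<in>{..<n} - {i}. pair_error i j a b) \<le> real n * loss n a b"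
proof -
  define x where "x = ip n (coords a) (coords b)"
  define c where "c = (\<lambda>i. coords a i * coords b i)"
  have x: "\<bar>x\<bar> \<le> n" unfolding x_def using abs_ip_le[of n "coords a" "coords b"] by (simp add: nsq_labels a b)
  have pe: "2 * pair_error i j a b = 1 - c i * c j" if "i < n" "j < n" for i j
    using labels_coords[OF a that(1)] labels_coords[OF a that(2)] labels_coords[OF b that(1)] labels_coords[OF b that(2)]
    by (auto simp: pair_error_def c_def coords_def)
  have "2 * (\<Sum>i<n. \<Sum>j\<in>{..<n} - {i}. pair_error i j a b) \<le> 2 * (\<Sum>i<n. \<Sum>j<n. pair_error i j a b)"
    by (intro mult_left_mono sum_mono sum_mono2) (auto simp: pair_error_range)
  also have "\<dots> = (\<Sum>i<n. \<Sum>j<n. 1 - c i * c j)"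
    unfolding sum_distrib_left by (intro sum.cong refl pe) auto
  also have "\<dots> = (real n)\<^sup>2 - x\<^sup>2"
    by (simp add: sum_subtractf x_def ip_def c_def power2_eq_square sum_product)
  also have "\<dots> = (real n - \<bar>x\<bar>) * (real n + \<bar>x\<bar>)"
    by (simp add: algebra_simps power2_eq_square flip: abs_mult)
  also have "\<dots> \<le> (real n - \<bar>x\<bar>) * (2 * real n)"
    using x by (intro mult_left_mono) auto
  finally show ?thesis unfolding loss_eq[OF a b] by (simp add: x_def algebra_simps)
qed

text \<open>The zero signal erases \<open>\<eta>'\<close>: an observation is a rescaled shifted noise array.\<close>

lemma observation_sign_vector_signal:
  assumes p: "p > 0" and \<sigma>: "\<sigma> > 0"
  shows "observation p n \<sigma> (sign_vector_signal p \<Delta> \<epsilon>) \<eta> \<xi> =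
    observation p n \<sigma> (0\<^sub>v p) \<eta>' (\<lambda>ij\<in>cells p n. \<xi> ij + (case ij of (i, k) \<Rightarrow> \<Delta> / (sqrt (real p) * \<sigma>) * \<epsilon> i * coords \<eta> k))"
  using p \<sigma> by (intro eq_matI) (auto simp: observation_def sign_vector_signal_def coords_def field_simps)

text \<open>After the change of measure the estimator is applied to the same pure noise for all signals and labels;
  only the weight depends on them. This is what makes different labels comparable.\<close>

lemma average_pair_error:
  fixes p n :: nat and \<sigma> \<Delta> :: real
  assumes p: "p > 0" and n: "n > 0" and \<sigma>: "\<sigma> > 0" and est: "est \<in> estimators p n"
    and \<eta>: "\<eta> \<in> labels n"
  defines "a \<equiv> \<Delta> / (sqrt (real p) * \<sigma>)"
  shows "(\<Sum>\<epsilon>\<in>sign_patterns p. \<integral>\<xi>. pair_error i j (est (observation p n \<sigma> (sign_vector_signal p \<Delta> \<epsilon>) \<eta> \<xi>)) \<eta> \<partial>noise p n) / 2 ^ p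
    = (\<integral>\<xi>. mixture p n a (coords \<eta>) \<xi> * pair_error i j (est (observation p n \<sigma> (0\<^sub>v p) \<eta>' \<xi>)) \<eta> \<partial>noise p n)"
proof -
  define f where "f = (\<lambda>\<xi>. pair_error i j (est (observation p n \<sigma> (0\<^sub>v p) \<eta>' \<xi>)) \<eta>)"
  have fm [measurable]: "f \<in> borel_measurable (noise p n)"
    unfolding f_def
    by (rule measurable_compose[OF observation_measurable measurable_compose[OF est[unfolded estimators_def]]]) simp
  define m where "m = (\<lambda>\<epsilon> (i :: nat, k). a * \<epsilon> i * coords \<eta> k)"
  have int: "integrable (noise p n) (\<lambda>\<xi>. tilt p n (m \<epsilon>) \<xi> * f \<xi>)" for \<epsilon>
  proof (rule Bochner_Integration.integrable_bound[OF tilt_integral(1)[of p n "m \<epsilon>"]])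
    show "AE \<xi> in noise p n. norm (tilt p n (m \<epsilon>) \<xi> * f \<xi>) \<le> norm (tilt p n (m \<epsilon>) \<xi>)"
      by (intro AE_I2) (simp add: f_def pair_error_def tilt_def)
  qed measurable
  have "(\<integral>\<xi>. pair_error i j (est (observation p n \<sigma> (sign_vector_signal p \<Delta> \<epsilon>) \<eta> \<xi>)) \<eta> \<partial>noise p n) =
      (\<integral>\<xi>. tilt p n (m \<epsilon>) \<xi> * f \<xi> \<partial>noise p n)" for \<epsilon>
    using integral_shifted_noise[OF p n fm, of "m \<epsilon>"]
    by (simp add: observation_sign_vector_signal[OF p \<sigma>, where \<eta>' = \<eta>'] f_def m_def a_def)
  then have "(\<Sum>\<epsilon>\<in>sign_patterns p. \<integral>\<xi>. pair_error i j (est (observation p n \<sigma> (sign_vector_signal p \<Delta> \<epsilon>) \<eta> \<xi>)) \<eta> \<partial>noise p n) / 2 ^ p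
     = (\<Sum>\<epsilon>\<in>sign_patterns p. \<integral>\<xi>. tilt p n (m \<epsilon>) \<xi> * f \<xi> \<partial>noise p n) / 2 ^ p" by simp
  also have "\<dots> = (\<integral>\<xi>. (\<Sum>\<epsilon>\<in>sign_patterns p. tilt p n (m \<epsilon>) \<xi> * f \<xi>) / 2 ^ p \<partial>noise p n)"
    using int by (simp add: Bochner_Integration.integral_sum)
  also have "\<dots> = (\<integral>\<xi>. mixture p n a (coords \<eta>) \<xi> * f \<xi> \<partial>noise p n)"
    by (simp add: mixture_def m_def sum_distrib_right)
  finally show ?thesis by (simp only: f_def)
qed

text \<open>The maximal risk is at least the average over uniform signs of the signal and uniform labels. Flipping
  label \<open>j\<close> permutes the labels and turns a correct product \<open>\<eta>\<^sub>i \<eta>\<^sub>j\<close> into a wrong one, so the two-point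
  bound applies to each pair \<open>i \<noteq> j\<close>. There are \<open>n (n - 1) \<ge> n\<^sup>2 / 2\<close> such pairs.\<close>

lemma max_risk_ge_row_overlap:
  assumes p: "p > 0" and n: "n \<ge> 2" and \<sigma>: "\<sigma> > 0" and \<Delta>: "\<Delta> > 0" and est: "est \<in> estimators p n"
  shows "ereal ((row_overlap (\<Delta>\<^sup>2 / (real p * \<sigma>\<^sup>2)) n ^ p)\<^sup>2 / 8) \<le> max_risk p n \<sigma> \<Delta> est"
proof -
  define a where "a = \<Delta> / (sqrt (real p) * \<sigma>)"
  define A where "A = row_overlap (a\<^sup>2) n ^ p"
  have a2: "a\<^sup>2 = \<Delta>\<^sup>2 / (real p * \<sigma>\<^sup>2)" by (simp add: a_def power_divide power_mult_distrib)
  define \<Theta> where "\<Theta> = sign_vector_signal p \<Delta>"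
  define \<eta>0 where "\<eta>0 = Matrix.vec n (\<lambda>_. 1 :: real)"
  have \<eta>0: "\<eta>0 \<in> labels n" by (simp add: labels_def \<eta>0_def)
  have n0: "n > 0" using n by simp
  define h where "h = (\<lambda>\<xi>. est (observation p n \<sigma> (0\<^sub>v p) \<eta>0 \<xi>))"
  define V where "V = (\<lambda>i j \<eta>. \<integral>\<xi>. mixture p n a (coords \<eta>) \<xi> * pair_error i j (h \<xi>) \<eta> \<partial>noise p n)"
  define P where "P = (\<lambda>i j \<epsilon> \<eta>. \<integral>\<xi>. pair_error i j (est (observation p n \<sigma> (\<Theta> \<epsilon>) \<eta> \<xi>)) \<eta> \<partial>noise p n)"
  have PV: "(\<Sum>\<epsilon>\<in>sign_patterns p. P i j \<epsilon> \<eta>) / 2 ^ p = V i j \<eta>" if "\<eta> \<in> labels n" for i j \<eta>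
    unfolding P_def V_def \<Theta>_def h_def a_def by (rule average_pair_error[OF p n0 \<sigma> est that])
  have pm: "(\<lambda>\<xi>. pair_error i j (est (observation p n \<sigma> \<theta> \<eta>1 \<xi>)) \<eta>) \<in> borel_measurable (noise p n)" for i j \<theta> \<eta>1 \<eta>
    by (rule measurable_compose[OF observation_measurable measurable_compose[OF est[unfolded estimators_def]]]) simp
  have risk_ge: "(\<Sum>i<n. \<Sum>j\<in>{..<n} - {i}. P i j \<epsilon> \<eta>) \<le> (real n)\<^sup>2 * risk p n \<sigma> est (\<Theta> \<epsilon>) \<eta>"
    if \<eta>: "\<eta> \<in> labels n" for \<epsilon> \<eta>
  proof -
    have int: "integrable (noise p n) (\<lambda>\<xi>. pair_error i j (est (observation p n \<sigma> (\<Theta> \<epsilon>) \<eta> \<xi>)) \<eta>)" for i j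
      by (rule noise.integrable_const_bound[where B = 1, OF _ pm]) (auto simp: pair_error_def)
    have lm: "(\<lambda>\<xi>. loss n (est (observation p n \<sigma> (\<Theta> \<epsilon>) \<eta> \<xi>)) \<eta>) \<in> borel_measurable (noise p n)"
      by (rule measurable_compose[OF observation_measurable measurable_compose[OF est[unfolded estimators_def]]]) simp
    have lab: "est (observation p n \<sigma> (\<Theta> \<epsilon>) \<eta> \<xi>) \<in> labels n" for \<xi>
      by (rule estimator_labels[OF est observation_carrier])
    have lint: "integrable (noise p n) (\<lambda>\<xi>. loss n (est (observation p n \<sigma> (\<Theta> \<epsilon>) \<eta> \<xi>)) \<eta>)"
      using loss_nonneg[OF lab \<eta>] loss_le[OF lab \<eta>]
      by (intro noise.integrable_const_bound[where B = "real n", OF _ lm]) auto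
    have "(\<Sum>i<n. \<Sum>j\<in>{..<n} - {i}. P i j \<epsilon> \<eta>) =
        (\<integral>\<xi>. (\<Sum>i<n. \<Sum>j\<in>{..<n} - {i}. pair_error i j (est (observation p n \<sigma> (\<Theta> \<epsilon>) \<eta> \<xi>)) \<eta>) \<partial>noise p n)"
      unfolding P_def using int by (simp add: Bochner_Integration.integral_sum Bochner_Integration.integrable_sum)
    also have "\<dots> \<le> (\<integral>\<xi>. real n * loss n (est (observation p n \<sigma> (\<Theta> \<epsilon>) \<eta> \<xi>)) \<eta> \<partial>noise p n)"
      by (intro integral_mono Bochner_Integration.integrable_sum int integrable_mult_right lint loss_ge_pair_errors lab \<eta> n0)
    also have "\<dots> = (real n)\<^sup>2 * risk p n \<sigma> est (\<Theta> \<epsilon>) \<eta>"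
      using n0 by (simp add: risk_eq_noise[OF est] power2_eq_square)
    finally show ?thesis .
  qed
  have pair: "real (card (labels n)) * (A\<^sup>2 / 4) \<le> (\<Sum>\<eta>\<in>labels n. V i j \<eta>)" if ij: "i < n" "j < n" "i \<noteq> j" for i j
  proof -
    have "A\<^sup>2 / 2 \<le> V i j \<eta> + V i j (flip_label j \<eta>)" if \<eta>: "\<eta> \<in> labels n" for \<eta>
    proof -
      have d: "dim_vec \<eta> = n" using \<eta> by (auto simp: labels_def)
      have hl: "h \<xi> \<in> labels n" for \<xi> unfolding h_def by (rule estimator_labels[OF est observation_carrier])
      have flip_err: "pair_error i j (h \<xi>) (flip_label j \<eta>) = 1 - pair_error i j (h \<xi>) \<eta>" for \<xi>
        using labels_coords[OF \<eta> ij(1)] labels_coords[OF \<eta> ij(2)] labels_coords[OF hl[of \<xi>] ij(1)] labels_coords[OF hl[of \<xi>] ij(2)] ij d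
        by (auto simp: pair_error_def flip_label_def coords_def)
      have mix: "mixture p n a (coords (flip_label j \<eta>)) = mixture p n a (flip j (coords \<eta>))"
      proof
        fix \<xi>
        have "coords (flip_label j \<eta>) k = flip j (coords \<eta>) k" if "k < n" for k
          using that d by (simp add: coords_def flip_label_def flip_def)
        then have "tilt p n (\<lambda>(i, k). a * \<epsilon> i * coords (flip_label j \<eta>) k) \<xi> = tilt p n (\<lambda>(i, k). a * \<epsilon> i * flip j (coords \<eta>) k) \<xi>" for \<epsilon>
          unfolding tilt_def by (intro arg_cong[where f = exp] arg_cong2[where f = "(-)"] arg_cong2[where f = "(/)"] sum.cong) auto
        then show "mixture p n a (coords (flip_label j \<eta>)) \<xi> = mixture p n a (flip j (coords \<eta>)) \<xi>"
          by (simp add: mixture_def)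
      qed
      have "A\<^sup>2 / 2 \<le> (\<integral>\<xi>. mixture p n a (coords \<eta>) \<xi> * pair_error i j (h \<xi>) \<eta> \<partial>noise p n) +
          (\<integral>\<xi>. mixture p n a (flip j (coords \<eta>)) \<xi> * (1 - pair_error i j (h \<xi>) \<eta>) \<partial>noise p n)"
        unfolding A_def h_def using pm pair_error_range by (intro two_point_bound labels_coords[OF \<eta>] ij(2)) auto
      then show ?thesis unfolding V_def flip_err mix .
    qed
    then have "(\<Sum>\<eta>\<in>labels n. A\<^sup>2 / 2) \<le> (\<Sum>\<eta>\<in>labels n. V i j \<eta> + V i j (flip_label j \<eta>))"
      by (intro sum_mono)
    also have "\<dots> = 2 * (\<Sum>\<eta>\<in>labels n. V i j \<eta>)"
      by (simp add: sum.distrib sum_flip_label)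
    finally show ?thesis by simp
  qed
  define B where "B = sign_patterns p \<times> labels n"
  have B: "finite B" "card B > 0"
    using finite_sign_patterns[of p] finite_labels[of n] \<eta>0
    by (auto simp: B_def card_cartesian_product card_sign_patterns card_gt_0_iff)
  have cardB: "real (card B) = 2 ^ p * real (card (labels n))"
    by (simp add: B_def card_cartesian_product card_sign_patterns)
  \<comment> \<open>sum the pairwise bounds over all labels and compare with the sum of the risks over the prior\<close>
  have "(\<Sum>i<n. \<Sum>j\<in>{..<n} - {i}. real (card (labels n)) * (A\<^sup>2 / 4)) \<le> (\<Sum>i<n. \<Sum>j\<in>{..<n} - {i}. \<Sum>\<eta>\<in>labels n. V i j \<eta>)"
    using pair by (intro sum_mono) auto
  also have "\<dots> = (\<Sum>\<eta>\<in>labels n. \<Sum>i<n. \<Sum>j\<in>{..<n} - {i}. V i j \<eta>)"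
  proof -
    have "(\<Sum>i<n. \<Sum>j\<in>{..<n} - {i}. \<Sum>\<eta>\<in>labels n. V i j \<eta>) = (\<Sum>i<n. \<Sum>\<eta>\<in>labels n. \<Sum>j\<in>{..<n} - {i}. V i j \<eta>)"
      by (intro sum.cong refl sum.swap)
    also have "\<dots> = (\<Sum>\<eta>\<in>labels n. \<Sum>i<n. \<Sum>j\<in>{..<n} - {i}. V i j \<eta>)" by (rule sum.swap)
    finally show ?thesis .
  qed
  also have "\<dots> = (\<Sum>\<eta>\<in>labels n. (\<Sum>\<epsilon>\<in>sign_patterns p. \<Sum>i<n. \<Sum>j\<in>{..<n} - {i}. P i j \<epsilon> \<eta>) / 2 ^ p)"
  proof (intro sum.cong refl)
    fix \<eta> assume \<eta>: "\<eta> \<in> labels n"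
    have "(\<Sum>i<n. \<Sum>j\<in>{..<n} - {i}. V i j \<eta>) = (\<Sum>i<n. \<Sum>j\<in>{..<n} - {i}. \<Sum>\<epsilon>\<in>sign_patterns p. P i j \<epsilon> \<eta>) / 2 ^ p"
      by (simp add: PV[OF \<eta>, symmetric] sum_divide_distrib)
    also have "(\<Sum>i<n. \<Sum>j\<in>{..<n} - {i}. \<Sum>\<epsilon>\<in>sign_patterns p. P i j \<epsilon> \<eta>) = (\<Sum>i<n. \<Sum>\<epsilon>\<in>sign_patterns p. \<Sum>j\<in>{..<n} - {i}. P i j \<epsilon> \<eta>)"
      by (intro sum.cong refl sum.swap)
    also have "\<dots> = (\<Sum>\<epsilon>\<in>sign_patterns p. \<Sum>i<n. \<Sum>j\<in>{..<n} - {i}. P i j \<epsilon> \<eta>)" by (rule sum.swap)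
    finally show "(\<Sum>i<n. \<Sum>j\<in>{..<n} - {i}. V i j \<eta>) = (\<Sum>\<epsilon>\<in>sign_patterns p. \<Sum>i<n. \<Sum>j\<in>{..<n} - {i}. P i j \<epsilon> \<eta>) / 2 ^ p" .
  qed
  also have "\<dots> \<le> (\<Sum>\<eta>\<in>labels n. (\<Sum>\<epsilon>\<in>sign_patterns p. (real n)\<^sup>2 * risk p n \<sigma> est (\<Theta> \<epsilon>) \<eta>) / 2 ^ p)"
    by (intro sum_mono divide_right_mono risk_ge) auto
  also have "\<dots> = (real n)\<^sup>2 / 2 ^ p * (\<Sum>\<eta>\<in>labels n. \<Sum>\<epsilon>\<in>sign_patterns p. risk p n \<sigma> est (\<Theta> \<epsilon>) \<eta>)"
    by (simp add: sum_distrib_left sum_divide_distrib)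
  also have "(\<Sum>\<eta>\<in>labels n. \<Sum>\<epsilon>\<in>sign_patterns p. risk p n \<sigma> est (\<Theta> \<epsilon>) \<eta>) = (\<Sum>(\<epsilon>, \<eta>)\<in>B. risk p n \<sigma> est (\<Theta> \<epsilon>) \<eta>)"
    unfolding B_def sum.cartesian_product[symmetric] by (rule sum.swap)
  finally have total: "real n * (real n - 1) * (real (card (labels n)) * (A\<^sup>2 / 4)) \<le>
      (real n)\<^sup>2 / 2 ^ p * (\<Sum>(\<epsilon>, \<eta>)\<in>B. risk p n \<sigma> est (\<Theta> \<epsilon>) \<eta>)"
    using n0 by (simp add: of_nat_diff)
  have "\<exists>(\<epsilon>, \<eta>)\<in>B. A\<^sup>2 / 8 \<le> risk p n \<sigma> est (\<Theta> \<epsilon>) \<eta>"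
  proof (rule ccontr)
    assume "\<not> ?thesis"
    then have "(\<Sum>(\<epsilon>, \<eta>)\<in>B. risk p n \<sigma> est (\<Theta> \<epsilon>) \<eta>) < (\<Sum>(\<epsilon>, \<eta>)\<in>B. A\<^sup>2 / 8)"
      using B by (intro sum_strict_mono) (auto simp: not_le)
    also have "\<dots> = 2 ^ p * real (card (labels n)) * (A\<^sup>2 / 8)" by (simp add: cardB case_prod_unfold)
    finally have lt: "(\<Sum>(\<epsilon>, \<eta>)\<in>B. risk p n \<sigma> est (\<Theta> \<epsilon>) \<eta>) < 2 ^ p * real (card (labels n)) * (A\<^sup>2 / 8)" .
    have "(real n)\<^sup>2 / 2 ^ p * (\<Sum>(\<epsilon>, \<eta>)\<in>B. risk p n \<sigma> est (\<Theta> \<epsilon>) \<eta>) < (real n)\<^sup>2 / 2 ^ p * (2 ^ p * real (card (labels n)) * (A\<^sup>2 / 8))"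
      using lt n0 by (intro mult_strict_left_mono) auto
    also have "\<dots> = real n * (real n / 2) * (real (card (labels n)) * (A\<^sup>2 / 4))"
      by (simp add: power2_eq_square)
    also have "\<dots> \<le> real n * (real n - 1) * (real (card (labels n)) * (A\<^sup>2 / 4))"
      using n by (intro mult_right_mono mult_left_mono) auto
    finally show False using total by simp
  qed
  then obtain \<epsilon> \<eta> where w: "\<epsilon> \<in> sign_patterns p" "\<eta> \<in> labels n" "A\<^sup>2 / 8 \<le> risk p n \<sigma> est (\<Theta> \<epsilon>) \<eta>"
    by (auto simp: B_def)
  have "(\<Theta> \<epsilon>, \<eta>) \<in> params p n \<Delta>"
    unfolding \<Theta>_def by (rule sign_vector_signal_params[OF p \<Delta> sign_patternsD[OF w(1)] w(2)])
  then have "ereal (A\<^sup>2 / 8) \<le> max_risk p n \<sigma> \<Delta> est"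
    unfolding max_risk_def using w(3) by (intro SUP_upper2[of "(\<Theta> \<epsilon>, \<eta>)"]) auto
  then show ?thesis by (simp add: A_def a2)
qed

lemma row_overlap_ge:
  fixes b :: real
  assumes "b \<ge> 0" "n \<ge> 1"
  shows "exp (- b) \<le> row_overlap b n" "1 - (real n - 1) * b\<^sup>2 \<le> row_overlap b n"
proof -
  define x where "x = 1 - exp (- b)"
  define y where "y = 1 - exp (- (b * (real n - 1)))"
  have x: "0 \<le> x" "x \<le> 1" "x \<le> b" using exp_ge_add_one_self[of "- b"] assms by (simp_all add: x_def)
  have y: "0 \<le> y" "y \<le> 1" "y \<le> b * (real n - 1)"
    using exp_ge_add_one_self[of "- (b * (real n - 1))"] assms by (simp_all add: y_def)
  have o: "row_overlap b n = 1 - x * y" by (simp add: row_overlap_def x_def y_def)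
  have "x * y \<le> x * 1" using x y by (intro mult_left_mono) auto
  then show "exp (- b) \<le> row_overlap b n" unfolding o by (simp add: x_def)
  have "x * y \<le> b * (b * (real n - 1))" using x y assms by (intro mult_mono) auto
  then show "1 - (real n - 1) * b\<^sup>2 \<le> row_overlap b n" unfolding o by (simp add: power2_eq_square mult_ac)
qed

text \<open>For \<open>p \<le> n\<close> the total signal-to-noise ratio \<open>b p\<close> is at most \<open>2 K\<close>. For \<open>p > n\<close> it may be large, but the
  direction of the signal is unknown and the deficiency of one row is only \<open>(n - 1) b\<^sup>2 \<le> 4 K\<^sup>2 / p\<close>;
  the inequality \<open>- ln r \<le> 1 / r - 1\<close> turns this into a bound for the power.\<close>

lemma row_overlap_power_ge:
  fixes b K :: real
  assumes p: "p \<ge> 1" and n: "n \<ge> 2" and b: "0 \<le> b" and K: "K > 0"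
    and bK: "b \<le> K * (1 + sqrt (real p / real n)) / real p"
  shows "exp (- (2 * K + 4 * K\<^sup>2 * exp (2 * K))) \<le> row_overlap b n ^ p"
proof (cases "p \<le> n")
  case True
  have "sqrt (real p / real n) \<le> sqrt 1" using True n by (intro real_sqrt_le_mono) simp
  then have "K * (1 + sqrt (real p / real n)) / real p \<le> K * 2 / real p"
    using K by (intro divide_right_mono mult_left_mono) auto
  then have "b \<le> K * 2 / real p" using bK by linarith
  then have "b * real p \<le> 2 * K" using p by (simp add: field_simps)
  then have "exp (- (2 * K + 4 * K\<^sup>2 * exp (2 * K))) \<le> exp (- (b * real p))"
  proof -
    have "0 \<le> 4 * K\<^sup>2 * exp (2 * K)" by simp
    then have "- (2 * K + 4 * K\<^sup>2 * exp (2 * K)) \<le> - (b * real p)" using \<open>b * real p \<le> 2 * K\<close> by linarith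
    then show ?thesis by (simp only: exp_le_cancel_iff)
  qed
  also have "\<dots> = exp (- b) ^ p" by (simp add: exp_of_nat_mult[symmetric] mult.commute)
  also have "\<dots> \<le> row_overlap b n ^ p"
    using row_overlap_ge(1)[OF b] n by (intro power_mono) auto
  finally show ?thesis .
next
  case False
  then have pn: "real n < real p" by simp
  have n0: "real n > 0" "real p > 0" using n p by simp_all
  have "1 \<le> sqrt (real p / real n)" using pn n0 by simp
  then have "K * (1 + sqrt (real p / real n)) / real p \<le> K * (2 * sqrt (real p / real n)) / real p"
    using K by (intro divide_right_mono mult_left_mono) auto
  then have b2: "b \<le> 2 * K * sqrt (real p / real n) / real p" using bK by simp
  then have "b\<^sup>2 \<le> (2 * K * sqrt (real p / real n) / real p)\<^sup>2" using b by (intro power_mono) auto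
  also have "\<dots> = 4 * K\<^sup>2 / (real p * real n)"
    using n0 by (simp add: power_divide power_mult_distrib) (simp add: power2_eq_square)
  finally have bsq: "b\<^sup>2 \<le> 4 * K\<^sup>2 / (real p * real n)" .
  have b2K: "b \<le> 2 * K"
  proof (rule power2_le_imp_le)
    have "4 * K\<^sup>2 / (real p * real n) \<le> 4 * K\<^sup>2 / 1"
      using n p by (intro divide_left_mono) (auto intro: mult_ge1_I)
    then show "b\<^sup>2 \<le> (2 * K)\<^sup>2" using bsq by (simp add: power_mult_distrib)
  qed (use K in simp)
  define r where "r = row_overlap b n"
  have re: "exp (- (2 * K)) \<le> r"
  proof -
    have "exp (- (2 * K)) \<le> exp (- b)" using b2K by simp
    also have "\<dots> \<le> r" unfolding r_def using row_overlap_ge(1)[OF b] n by simp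
    finally show ?thesis .
  qed
  then have r0: "r > 0" by (rule order_less_le_trans[OF exp_gt_zero])
  have "1 - r \<le> (real n - 1) * b\<^sup>2" using row_overlap_ge(2)[OF b, of n] n by (simp add: r_def)
  also have "\<dots> \<le> real n * (4 * K\<^sup>2 / (real p * real n))"
    using bsq n by (intro mult_mono) auto
  also have "\<dots> = 4 * K\<^sup>2 / real p" using n0 by simp
  finally have def: "1 - r \<le> 4 * K\<^sup>2 / real p" .
  have inv: "1 / r \<le> exp (2 * K)"
  proof -
    have "1 = exp (2 * K) * exp (- (2 * K))" by (simp flip: exp_add)
    also have "\<dots> \<le> exp (2 * K) * r" using re by (intro mult_left_mono) auto
    finally show ?thesis using r0 by (simp add: divide_le_eq)
  qed
  have "1 / r - 1 = (1 - r) * (1 / r)" using r0 by (simp add: field_simps)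
  also have "\<dots> \<le> 4 * K\<^sup>2 / real p * exp (2 * K)"
    using def inv r0 n0 by (intro mult_mono) auto
  finally have gap: "1 / r - 1 \<le> 4 * K\<^sup>2 / real p * exp (2 * K)" .
  have "1 / r \<le> exp (4 * K\<^sup>2 / real p * exp (2 * K))"
    using exp_ge_add_one_self[of "4 * K\<^sup>2 / real p * exp (2 * K)"] gap by linarith
  then have "exp (- (4 * K\<^sup>2 / real p * exp (2 * K))) \<le> r"
    using r0 by (simp add: exp_minus field_simps)
  then have "exp (- (4 * K\<^sup>2 / real p * exp (2 * K))) ^ p \<le> r ^ p" by (intro power_mono) auto
  moreover have "exp (- (4 * K\<^sup>2 / real p * exp (2 * K))) ^ p = exp (- (4 * K\<^sup>2 * exp (2 * K)))"
    using n0 by (simp add: exp_of_nat_mult[symmetric])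
  moreover have "exp (- (2 * K + 4 * K\<^sup>2 * exp (2 * K))) \<le> exp (- (4 * K\<^sup>2 * exp (2 * K)))"
    using K by simp
  ultimately show ?thesis unfolding r_def by linarith
qed

lemma almost_full_recovery_impossible_below_threshold:
  fixes p :: "nat \<Rightarrow> nat" and \<sigma> \<Delta> :: "nat \<Rightarrow> real"
  assumes p: "\<And>n. n \<ge> 2 \<Longrightarrow> p n \<ge> 1"
    and \<sigma>: "\<And>n. n \<ge> 2 \<Longrightarrow> \<sigma> n > 0"
    and \<Delta>: "\<And>n. n \<ge> 2 \<Longrightarrow> \<Delta> n > 0"
    and snr: "(\<lambda>n. (\<Delta> n)\<^sup>2) \<in> O(\<lambda>n. (\<sigma> n)\<^sup>2 * (1 + sqrt (real (p n) / real n)))"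
  shows "almost_full_recovery_impossible p \<sigma> \<Delta>"
proof -
  obtain K where K: "K > 0" and ev: "eventually (\<lambda>n. norm ((\<Delta> n)\<^sup>2) \<le> K * norm ((\<sigma> n)\<^sup>2 * (1 + sqrt (real (p n) / real n)))) sequentially"
    using landau_o.bigE[OF snr] by blast
  define c where "c = (exp (- (2 * K + 4 * K\<^sup>2 * exp (2 * K))))\<^sup>2 / 8"
  have c: "c > 0" by (simp add: c_def)
  have "eventually (\<lambda>n. ereal c \<le> (INF est\<in>estimators (p n) n. max_risk (p n) n (\<sigma> n) (\<Delta> n) est)) sequentially"
    using ev eventually_ge_at_top[of "2::nat"]
  proof eventually_elim
    case (elim n)
    note n = elim(2)
    have pos: "p n \<ge> 1" "\<sigma> n > 0" "\<Delta> n > 0" using p \<sigma> \<Delta> n by auto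
    define b where "b = (\<Delta> n)\<^sup>2 / (real (p n) * (\<sigma> n)\<^sup>2)"
    have "(\<Delta> n)\<^sup>2 \<le> K * ((\<sigma> n)\<^sup>2 * (1 + sqrt (real (p n) / real n)))" using elim(1) by simp
    then have "b \<le> K * ((\<sigma> n)\<^sup>2 * (1 + sqrt (real (p n) / real n))) / (real (p n) * (\<sigma> n)\<^sup>2)"
      unfolding b_def by (intro divide_right_mono) auto
    also have "\<dots> = K * (1 + sqrt (real (p n) / real n)) / real (p n)" using pos by simp
    finally have bK: "b \<le> K * (1 + sqrt (real (p n) / real n)) / real (p n)" .
    have "exp (- (2 * K + 4 * K\<^sup>2 * exp (2 * K))) \<le> row_overlap b n ^ p n"
      by (rule row_overlap_power_ge[OF pos(1) n _ K bK]) (simp add: b_def)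
    then have "(exp (- (2 * K + 4 * K\<^sup>2 * exp (2 * K))))\<^sup>2 \<le> (row_overlap b n ^ p n)\<^sup>2" by (intro power_mono) auto
    then have cb: "c \<le> (row_overlap b n ^ p n)\<^sup>2 / 8" by (simp add: c_def)
    show ?case
    proof (rule INF_greatest)
      fix est assume "est \<in> estimators (p n) n"
      then have "ereal ((row_overlap b n ^ p n)\<^sup>2 / 8) \<le> max_risk (p n) n (\<sigma> n) (\<Delta> n) est"
        unfolding b_def using pos n by (intro max_risk_ge_row_overlap) auto
      with cb show "ereal c \<le> max_risk (p n) n (\<sigma> n) (\<Delta> n) est"
        by (meson ereal_less_eq(3) order_trans)
    qed
  qed
  then have "ereal c \<le> liminf (\<lambda>n. INF est\<in>estimators (p n) n. max_risk (p n) n (\<sigma> n) (\<Delta> n) est)"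
    by (rule Liminf_bounded)
  moreover have "0 < ereal c" using c by simp
  ultimately show ?thesis unfolding almost_full_recovery_impossible_def by (rule order_less_le_trans[rotated])
qed

theorem theorem7:
  fixes p :: "nat \<Rightarrow> nat" and \<sigma> \<Delta> :: "nat \<Rightarrow> real"
  assumes "\<And>n. n \<ge> 2 \<Longrightarrow> p n \<ge> 1"
    and "\<And>n. n \<ge> 2 \<Longrightarrow> \<sigma> n > 0"
    and "\<And>n. n \<ge> 2 \<Longrightarrow> \<Delta> n > 0"
  shows
    "((\<lambda>n. (\<sigma> n)\<^sup>2 * (1 + sqrt (real (p n) / real n))) \<in> o(\<lambda>n. (\<Delta> n)\<^sup>2) \<longrightarrow>
       (\<forall>s\<in>{-1, 1}. \<forall>v :: nat \<Rightarrow> real Matrix.mat \<Rightarrow> real Matrix.vec.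
          (\<forall>n\<ge>2. \<forall>Y\<in>carrier_mat (p n) n. top_eigenvector (hollow_gram Y) (v n Y)) \<longrightarrow>
          (\<forall>n\<ge>2. spectral_iterate s (v n) 0 \<in> estimators (p n) n) \<longrightarrow>
          achieves_almost_full_recovery p \<sigma> \<Delta>
            (\<lambda>n. spectral_iterate s (v n) (nat \<lfloor>3 * ln (real n)\<rfloor>))))
     \<and> ((\<lambda>n. (\<Delta> n)\<^sup>2) \<in> O(\<lambda>n. (\<sigma> n)\<^sup>2 * (1 + sqrt (real (p n) / real n))) \<longrightarrow>
          almost_full_recovery_impossible p \<sigma> \<Delta>)"
proof (intro conjI impI ballI allI)
  fix s :: real and v :: "nat \<Rightarrow> real Matrix.mat \<Rightarrow> real Matrix.vec"
  assume "(\<lambda>n. (\<sigma> n)\<^sup>2 * (1 + sqrt (real (p n) / real n))) \<in> o(\<lambda>n. (\<Delta> n)\<^sup>2)" "s \<in> {-1, 1}"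
    and "\<forall>n\<ge>2. \<forall>Y\<in>carrier_mat (p n) n. top_eigenvector (hollow_gram Y) (v n Y)"
    and "\<forall>n\<ge>2. spectral_iterate s (v n) 0 \<in> estimators (p n) n"
  with assms show "achieves_almost_full_recovery p \<sigma> \<Delta>
      (\<lambda>n. spectral_iterate s (v n) (nat \<lfloor>3 * ln (real n)\<rfloor>))"
    by (intro spectral_almost_full_recovery)
next
  assume "(\<lambda>n. (\<Delta> n)\<^sup>2) \<in> O(\<lambda>n. (\<sigma> n)\<^sup>2 * (1 + sqrt (real (p n) / real n)))"
  with assms show "almost_full_recovery_impossible p \<sigma> \<Delta>"
    by (intro almost_full_recovery_impossible_below_threshold)
qed

end
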